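(* Let $q$ be a complex number with $|q|<1$, let $a,b,c,d,e,f,g$ be complex numbers with $\max\{|a^3q^2/bcdefg|,\,|aq/fg|\}<1$, and put $\mu=bcde/aq$. Then $$ {}_8\psi_8\left[\begin{matrix} qa^{\frac{1}{2}}, -qa^{\frac{1}{2}}, b, c, d, e, f, g \\ a^{\frac{1}{2}}, -a^{\frac{1}{2}}, aq/b, aq/c, aq/d, aq/e, aq/f, aq/g \end{matrix} ; q, \frac{a^3q^2}{bcdefg} \right] $$ $$ = \frac{(aq, q/a, aq/cd, aq/ce, aq/de, aq/fg, b/a, \mu q/c, \mu q/d, \mu q/e, aq/\mu f, aq/\mu g; q)_\infty}{(q/f, q/g, aq/c, aq/d, aq/e, bc/a, bd/a, be/a, b/\mu, \mu q, q/\mu, a^2q/\mu fg; q)_\infty} \times {}_8\psi_8\left[\begin{matrix} q\mu^{\frac{1}{2}}, -q\mu^{\frac{1}{2}}, b, c, d, e, \mu f/a, \mu g/a \\ \mu^{\frac{1}{2}}, -\mu^{\frac{1}{2}}, \mu q/b, \mu q/c, \mu q/d, \mu q/e, aq/f, aq/g \end{matrix} ; q, \frac{aq}{fg} \right] $$ $$ + \frac{(q, aq, q/a, c, d, e, bq/c, bq/d, bq/e, bq/f, bq/g; q)_\infty}{(q/f, q/g, aq/b, aq/c, aq/d, aq/e, aq/f, aq/g, bc/a, bd/a, be/a; q)_\infty} \times \frac{(aq/bf, aq/bg, bcde/a^2q, a^2q^2/bcde; q)_\infty}{(q/b, b^2q/a, cde/aq, aq^2/cde; q)_\infty} \times {}_8\phi_7\left[\begin{matrix}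 b^2/a, qba^{-\frac{1}{2}}, -qba^{-\frac{1}{2}}, bc/a, bd/a, be/a, bf/a, bg/a \\ ba^{-\frac{1}{2}}, -ba^{-\frac{1}{2}}, bq/c, bq/d, bq/e, bq/f, bq/g \end{matrix} ; q, \frac{a^3q^2}{bcdefg} \right]. $$
   Context: For $|q|<1$, integer $n$ and complex $x$: $(x;q)_\infty=\prod_{i\ge 0}(1-xq^i)$, $(x;q)_n=(x;q)_\infty/(xq^n;q)_\infty$, and $(x_1,\dots,x_r;q)_n=(x_1;q)_n\cdots(x_r;q)_n$ (also for $n=\infty$). The bilateral series is ${}_r\psi_r\left[\begin{matrix} a_1,\dots,a_r\\ b_1,\dots,b_r\end{matrix};q,z\right]=\sum_{k=-\infty}^{\infty}\frac{(a_1,\dots,a_r;q)_k}{(b_1,\dots,b_r;q)_k}z^k$, and the unilateral series is ${}_{r+1}\phi_r\left[\begin{matrix} a_1,\dots,a_{r+1}\\ b_1,\dots,b_r\end{matrix};q,z\right]=\sum_{k=0}^{\infty}\frac{(a_1,\dots,a_{r+1};q)_k}{(q,b_1,\dots,b_r;q)_k}z^k$. Square roots denote fixed choices of branch, used consistently. Parameters are assumed such that all denominators are nonzero. *)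

theory Defs
  imports "HOL-Analysis.Analysis"
begin

definition qpoch_inf :: "complex \<Rightarrow> complex \<Rightarrow> complex" where
  "qpoch_inf x q = (\<Prod>i. 1 - x * q ^ i)"

definition qpoch_inf_list :: "complex list \<Rightarrow> complex \<Rightarrow> complex" where
  "qpoch_inf_list xs q = (\<Prod>x\<leftarrow>xs. qpoch_inf x q)"

text \<open>
  The quotient \<open>(x;q)\<^sub>\<infinity> / (x q\<^sup>n;q)\<^sub>\<infinity>\<close> with the common factors cancelled, so that it also
  has its usual value when \<open>x\<close> is an integer power of \<open>q\<close> and the quotient reads \<open>0/0\<close>
  (for instance in terminating series). The lemma \<open>qpoch_eq_quotient\<close> below shows that
  it is that quotient whenever the denominator is nonzero.
\<close>

definition qpoch :: "complex \<Rightarrow> complex \<Rightarrow> int \<Rightarrow> complex" where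
  "qpoch x q n =
     (if n \<ge> 0 then (\<Prod>i<nat n. 1 - x * q ^ i)
      else 1 / (\<Prod>j=1..nat (- n). 1 - x / q ^ j))"

definition qpoch_list :: "complex list \<Rightarrow> complex \<Rightarrow> int \<Rightarrow> complex" where
  "qpoch_list xs q n = (\<Prod>x\<leftarrow>xs. qpoch x q n)"

definition bilateral_psi ::
    "complex list \<Rightarrow> complex list \<Rightarrow> complex \<Rightarrow> complex \<Rightarrow> complex" where
  "bilateral_psi as bs q z =
     (\<Sum>\<^sub>\<infinity>k\<in>(UNIV :: int set). qpoch_list as q k / qpoch_list bs q k * z powi k)"

definition basic_phi ::
    "complex list \<Rightarrow> complex list \<Rightarrow> complex \<Rightarrow> complex \<Rightarrow> complex" where
  "basic_phi as bs q z =
     (\<Sum>k. qpoch_list as q (int k) / qpoch_list (q # bs) q (int k) * z ^ k)"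

text \<open>
  No zero denominators in the terms of a bilateral series: the factors of \<open>(b;q)\<^sub>k\<close>
  for \<open>k \<ge> 0\<close> and those of \<open>1 / (a;q)\<^sub>k\<close> for \<open>k < 0\<close> do not vanish. A lower parameter
  \<open>b = q\<^sup>j\<close> with \<open>j \<ge> 1\<close> is allowed: then \<open>1 / (b;q)\<^sub>k = 0\<close> for \<open>k \<le> -j\<close>, in agreement
  with HOL's \<open>x / 0 = 0\<close>, and the series is bounded below.
\<close>

definition psi_denoms_nonzero :: "complex list \<Rightarrow> complex list \<Rightarrow> complex \<Rightarrow> bool" where
  "psi_denoms_nonzero as bs q \<longleftrightarrow>
     (\<forall>b\<in>set bs. \<forall>i::nat. 1 - b * q ^ i \<noteq> 0) \<and>
     (\<forall>a\<in>set as. \<forall>j::nat. j \<ge> 1 \<longrightarrow> 1 - a / q ^ j \<noteq> 0)"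

definition phi_denoms_nonzero :: "complex list \<Rightarrow> complex \<Rightarrow> bool" where
  "phi_denoms_nonzero bs q \<longleftrightarrow> (\<forall>b\<in>set bs. \<forall>i::nat. 1 - b * q ^ i \<noteq> 0)"

lemma convergent_prod_qpoch_inf:
  fixes x q :: complex
  assumes "norm q < 1"
  shows "convergent_prod (\<lambda>i. 1 - x * q ^ i)"
proof -
  have "summable (\<lambda>i. norm (- x * q ^ i))"
    using assms by (simp add: norm_mult norm_power summable_mult summable_geometric)
  then have "abs_convergent_prod (\<lambda>i. 1 - x * q ^ i)"
    by (simp add: abs_convergent_prod_conv_summable)
  then show ?thesis
    by (rule abs_convergent_prod_imp_convergent_prod)
qed

lemma qpoch_inf_split:
  fixes x q :: complex
  assumes "norm q < 1"
  shows "qpoch_inf x q = (\<Prod>i<n. 1 - x * q ^ i) * qpoch_inf (x * q ^ n) q"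
proof -
  have "(\<Prod>i. 1 - x * q ^ i) = (\<Prod>i<n. 1 - x * q ^ i) * (\<Prod>i. 1 - x * q ^ (i + n))"
    using has_prod_ignore_initial_segment'[OF convergent_prod_qpoch_inf[OF assms, of x]]
    by (rule has_prod_unique[symmetric])
  moreover have "(\<lambda>i. 1 - x * q ^ (i + n)) = (\<lambda>i. 1 - x * q ^ n * q ^ i)"
    by (simp add: power_add mult_ac)
  ultimately show ?thesis
    by (simp only: qpoch_inf_def)
qed

lemma qpoch_eq_quotient:
  fixes x q :: complex and n :: int
  assumes "q \<noteq> 0" "norm q < 1" and nz: "qpoch_inf (x * q powi n) q \<noteq> 0"
  shows "qpoch x q n = qpoch_inf x q / qpoch_inf (x * q powi n) q"
proof (cases "n \<ge> 0")
  case True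
  then show ?thesis
    using qpoch_inf_split[OF assms(2), of x "nat n"] nz
    by (simp add: qpoch_def power_int_def)
next
  case False
  define m where "m = nat (- n)"
  define y where "y = x * q powi n"
  have y: "y = x / q ^ m"
    using False by (simp add: y_def m_def power_int_def divide_inverse power_inverse)
  have "(\<Prod>i<m. 1 - y * q ^ i) = (\<Prod>j=1..m. 1 - x / q ^ j)"
  proof (rule prod.reindex_bij_witness[where i = "\<lambda>j. m - j" and j = "\<lambda>i. m - i"])
    fix i assume "i \<in> {..<m}"
    then have "q ^ m = q ^ (m - i) * q ^ i"
      by (simp flip: power_add)
    then show "1 - x / q ^ (m - i) = 1 - y * q ^ i"
      using assms(1) by (simp add: y)
  qed auto
  moreover have "qpoch_inf y q = (\<Prod>i<m. 1 - y * q ^ i) * qpoch_inf x q"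
    using qpoch_inf_split[OF assms(2), of y m] assms(1) by (simp add: y)
  ultimately show ?thesis
    using nz False by (simp add: qpoch_def m_def flip: y_def)
qed

end

theory Submission
  imports Defs "HOL-Complex_Analysis.Complex_Analysis"
begin

text \<open>
  Scale the parameters by \<open>a \<mapsto> a y^2\<close> and \<open>b, c, d, e, f, g \<mapsto> b y, \<dots>, g y\<close>, so that also \<open>\<mu> \<mapsto> \<mu> y^2\<close>.
  Multiplied by the infinite products that clear its denominators, the bilateral series becomes a
  holomorphic function of \<open>y \<noteq> 0\<close> that vanishes together with the theta function \<open>\<theta> (a y^2)\<close>, and
  the quotient is multiplied by a monomial when \<open>y\<close> is replaced by \<open>q y\<close>. The difference \<open>D\<close> of the
  two sides, treated in this way, satisfies \<open>D (q y) = \<kappa> y^(-3) D y\<close>, hence it vanishes identically as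
  soon as it has four zeros that are distinct modulo powers of \<open>q\<close>. At \<open>y = 1/c, 1/d, 1/e\<close> the two
  bilateral series become unilateral, the last term vanishes, and the relation is Bailey's two-term
  transformation of nonterminating very-well-poised series; at \<open>y = b/a\<close> the second bilateral
  series drops out and the first one is the unilateral series on the right.

  Bailey's transformation follows from Rogers' and Jackson's sums by interchanging two summations, and
  these two sums follow by telescoping the step \<open>a \<mapsto> a q\<close>. Parameters in special position are
  approached along a curve of parameters in general position.
\<close>

section \<open>Infinite products\<close>

text \<open>The scaling leaves \<open>a^3 q^2/(bcdefg)\<close> and \<open>aq/(fg)\<close> unchanged,
  so both bilateral series converge for every \<open>y\<close> and can be compared on the whole
  punctured plane. Under scaling the products \<open>(q/x, aq/x;q)\<close> vanish at infinitely many
  points, so they are absorbed into each term; hence the series are treated below in a form without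
  denominators. Replacing \<open>y\<close> by \<open>q y\<close> is a shift of the summation index
  by one. The divisor \<open>\<theta> (a y^2)\<close> is forced by the reflection of the index,
  \<open>k\<close> to \<open>-k\<close>: together with the shift it makes the series its own
  negative whenever \<open>a y^2\<close> is an integer power of \<open>q\<close>. Dividing it out is
  what brings the exponent of the multiplier down to three. A nonzero solution of
  \<open>D (q y) = \<kappa> y^(-3) D y\<close> has exactly three zeros modulo powers of
  \<open>q\<close>, counted with multiplicity, so four distinct ones leave no room. Three of the
  four do not see the coefficient of the last term; the fourth, \<open>b/a\<close>, determines
  it.\<close>

locale q_base =
  fixes q :: complex
  assumes norm_q: "norm q < 1" and q_nz: "q \<noteq> 0"
begin

abbreviation qP :: "complex \<Rightarrow> complex" where "qP x \<equiv> qpoch_inf x q"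

definition qp :: "complex \<Rightarrow> nat \<Rightarrow> complex" where "qp x n = (\<Prod>i<n. 1 - x * q ^ i)"

lemma qp_0 [simp]: "qp x 0 = 1"
  by (simp add: qp_def)

lemma qp_Suc: "qp x (Suc n) = qp x n * (1 - x * q ^ n)"
  by (simp add: qp_def)

lemma qp_Suc_left: "qp x (Suc n) = (1 - x) * qp (x * q) n"
  unfolding qp_def by (subst prod.lessThan_Suc_shift) (simp add: mult_ac)

lemma qp_add: "qp x (m + n) = qp x m * qp (x * q ^ m) n"
  by (induction n) (simp_all add: qp_Suc power_add mult_ac)

lemma qP_split: "qP x = qp x n * qP (x * q ^ n)"
  unfolding qp_def by (rule qpoch_inf_split[OF norm_q])

lemma qP_rec: "qP x = (1 - x) * qP (x * q)"
  using qP_split[of x 1] by (simp add: qp_def)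

lemma qP_1 [simp]: "qP 1 = 0"
  by (subst qP_rec) simp

lemma qP_LIMSEQ: "qp x \<longlonglongrightarrow> qP x"
proof -
  have "(\<lambda>n. \<Prod>i\<le>n. 1 - x * q ^ i) \<longlonglongrightarrow> qP x"
    unfolding qpoch_inf_def
    by (rule convergent_prod_LIMSEQ[OF convergent_prod_qpoch_inf[OF norm_q]])
  then have "(\<lambda>n. qp x (Suc n)) \<longlonglongrightarrow> qP x"
    by (simp add: qp_def lessThan_Suc_atMost)
  then show ?thesis
    by (rule LIMSEQ_imp_Suc)
qed

lemma qP_zero_iff: "qP x = 0 \<longleftrightarrow> (\<exists>i. x * q ^ i = 1)"
proof
  assume "qP x = 0"
  then have "\<exists>i. 1 - x * q ^ i = 0"
    using prodinf_nonzero[OF convergent_prod_qpoch_inf[OF norm_q, of x]]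
    unfolding qpoch_inf_def by blast
  then show "\<exists>i. x * q ^ i = 1" by auto
next
  assume "\<exists>i. x * q ^ i = 1"
  then obtain i where "x * q ^ i = 1" ..
  then have "qp x (Suc i) = 0"
    by (simp add: qp_Suc)
  then show "qP x = 0"
    using qP_split[of x "Suc i"] by simp
qed

lemma qp_nz: "qP x \<noteq> 0 \<Longrightarrow> qp x n \<noteq> 0"
  using qP_split[of x n] by auto

lemma qP_shift_nz: "qP x \<noteq> 0 \<Longrightarrow> qP (x * q ^ n) \<noteq> 0"
  using qP_split[of x n] by auto

lemma qP_q_nz: "qP q \<noteq> 0"
proof
  assume "qP q = 0"
  then obtain i where "q ^ Suc i = 1"
    unfolding qP_zero_iff by auto
  then have "norm q ^ Suc i = 1"
    by (metis norm_one norm_power)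
  moreover have "norm q ^ Suc i < 1"
    using norm_q q_nz by (intro power_Suc_less_one) auto
  ultimately show False by simp
qed

section \<open>Bounds that do not depend on the number of factors\<close>

definition K :: "real \<Rightarrow> real" where "K R = exp (R / (1 - norm q))"

lemma K_pos: "K R > 0"
  by (simp add: K_def)

text \<open>From \<open>1 + t \<le> exp t\<close> and the geometric series; the exponent in
  \<open>K\<close> is \<open>R\<close> times the sum of that series.\<close>

lemma prod_one_plus_geometric_le:
  assumes "R \<ge> 0"
  shows "(\<Prod>i<n. 1 + R * norm q ^ i) \<le> K R"
proof -
  have "(\<Prod>i<n. 1 + R * norm q ^ i) \<le> (\<Prod>i<n. exp (R * norm q ^ i))"
    using assms by (intro prod_mono) auto
  also have "\<dots> = exp (R * (\<Sum>i<n. norm q ^ i))"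
    by (simp add: exp_sum sum_distrib_left)
  also have "(\<Sum>i<n. norm q ^ i) \<le> 1 / (1 - norm q)"
  proof -
    have "(\<Sum>i<n. norm q ^ i) \<le> (\<Sum>i. norm q ^ i)"
      using norm_q by (intro sum_le_suminf summable_geometric) auto
    then show ?thesis
      using norm_q by (simp add: suminf_geometric)
  qed
  finally show ?thesis
    using assms by (simp add: K_def mult_left_mono)
qed

lemma norm_qp_le:
  assumes "norm x \<le> R"
  shows "norm (qp x n) \<le> K R"
proof -
  have R: "R \<ge> 0"
    using assms norm_ge_zero order_trans by blast
  have "norm (qp x n) \<le> (\<Prod>i<n. 1 + R * norm q ^ i)"
    unfolding qp_def prod_norm[symmetric]
  proof (intro prod_mono conjI norm_ge_zero)
    fix i
    have "norm (1 - x * q ^ i) \<le> 1 + norm x * norm q ^ i"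
      by (metis norm_mult norm_one norm_power norm_triangle_ineq4)
    also have "\<dots> \<le> 1 + R * norm q ^ i"
      using assms by (simp add: mult_right_mono)
    finally show "norm (1 - x * q ^ i) \<le> 1 + R * norm q ^ i" .
  qed
  also have "\<dots> \<le> K R"
    using R by (rule prod_one_plus_geometric_le)
  finally show ?thesis .
qed

lemma norm_qP_le: "norm x \<le> R \<Longrightarrow> norm (qP x) \<le> K R"
  by (rule LIMSEQ_le_const2[OF tendsto_norm[OF qP_LIMSEQ]]) (auto intro: norm_qp_le)

lemma norm_q_power_le_1: "norm q ^ n \<le> 1"
  using norm_q by (simp add: power_le_one)

lemma norm_mult_q_power_le: "norm x \<le> R \<Longrightarrow> norm (x * q ^ n) \<le> R"
proof -
  assume "norm x \<le> R"
  have "norm (x * q ^ n) = norm x * norm q ^ n"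
    by (simp add: norm_mult norm_power)
  also have "\<dots> \<le> norm x * 1"
    by (intro mult_left_mono norm_q_power_le_1) auto
  finally show ?thesis using \<open>norm x \<le> R\<close> by simp
qed

lemma norm_qP_shift_le: "norm x \<le> R \<Longrightarrow> norm (qP (x * q ^ n)) \<le> K R"
  by (intro norm_qP_le norm_mult_q_power_le)

text \<open>The tail in \<open>qP x = qp x n * qP (x * q ^ n)\<close> is bounded by
  \<open>K\<close>, so a nonzero infinite product keeps all its finite products uniformly away from
  zero.\<close>

lemma norm_qp_ge: "norm (qP x) / K (norm x) \<le> norm (qp x n)"
proof -
  have "norm (qP x) = norm (qp x n) * norm (qP (x * q ^ n))"
    by (subst qP_split[of x n]) (simp add: norm_mult)
  also have "\<dots> \<le> norm (qp x n) * K (norm x)"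
    by (intro mult_left_mono norm_qP_shift_le) auto
  finally show ?thesis
    using K_pos[of "norm x"] by (simp add: divide_le_eq)
qed

lemma norm_inverse_qp_le:
  assumes "qP x \<noteq> 0"
  shows "norm (1 / qp x n) \<le> K (norm x) / norm (qP x)"
proof -
  have "0 < norm (qP x) / K (norm x)"
    using assms K_pos by simp
  then have "inverse (norm (qp x n)) \<le> inverse (norm (qP x) / K (norm x))"
    by (intro le_imp_inverse_le norm_qp_ge)
  then show ?thesis
    by (simp add: norm_divide norm_inverse divide_inverse mult.commute)
qed

text \<open>The part of \<open>(b;q)\<^sub>n\<close> that is a polynomial in \<open>\<beta> = 1/b\<close>; see \<open>qp_conv_rp\<close>.\<close>

definition rp :: "complex \<Rightarrow> nat \<Rightarrow> complex" where "rp \<beta> n = (\<Prod>j<n. q ^ j - \<beta>)"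

text \<open>Taking \<open>r\<close> out of each factor leaves at most
  \<open>1 + norm q ^ j / r\<close>. The growth rate is therefore \<open>r\<close> itself, without
  loss, and the product of these rates over all parameters reproduces the sharp convergence
  conditions.\<close>

lemma norm_rp_le:
  assumes "norm \<beta> \<le> r" "r > 0"
  shows "norm (rp \<beta> n) \<le> r ^ n * K (1 / r)"
proof -
  have "norm (rp \<beta> n) \<le> (\<Prod>j<n. r * (1 + 1 / r * norm q ^ j))"
    unfolding rp_def prod_norm[symmetric]
  proof (intro prod_mono conjI norm_ge_zero)
    fix j
    have "norm (q ^ j - \<beta>) \<le> norm q ^ j + norm \<beta>"
      by (metis norm_power norm_triangle_ineq4)
    also have "\<dots> \<le> r * (1 + 1 / r * norm q ^ j)"
      using assms by (simp add: field_simps)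
    finally show "norm (q ^ j - \<beta>) \<le> r * (1 + 1 / r * norm q ^ j)" .
  qed
  also have "\<dots> = r ^ n * (\<Prod>j<n. 1 + 1 / r * norm q ^ j)"
    by (simp add: prod.distrib)
  also have "\<dots> \<le> r ^ n * K (1 / r)"
    using assms by (intro mult_left_mono prod_one_plus_geometric_le) auto
  finally show ?thesis .
qed

lemma qp_conv_rp:
  assumes "b \<noteq> 0"
  shows "qp b n = (- b) ^ n * rp (1 / b) n"
proof -
  have "qp b n = (\<Prod>j<n. (- b) * (q ^ j - 1 / b))"
    unfolding qp_def using assms by (intro prod.cong) (auto simp: field_simps)
  also have "\<dots> = (- b) ^ n * (\<Prod>j<n. q ^ j - 1 / b)"
    by (subst prod.distrib) simp
  finally show ?thesis
    by (simp add: rp_def)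
qed

text \<open>The finite products converge uniformly on closed discs of radius 1, by the Weierstrass
  test: the factors differ from 1 by at most \<open>(norm x + 1) * norm q ^ n\<close> there.\<close>

lemma qP_holomorphic: "qP holomorphic_on UNIV"
proof (rule holomorphic_uniform_sequence[where f = "\<lambda>n x. qp x n"])
  fix x :: complex
  have "uniform_limit (cball x 1) (\<lambda>n x. qp x n) qP sequentially"
  proof -
    have "uniformly_convergent_on (cball x 1) (\<lambda>N y. \<Prod>n<N. 1 - y * q ^ n)"
    proof (rule uniformly_convergent_on_prod')
      show "uniformly_convergent_on (cball x 1) (\<lambda>N y. \<Sum>n<N. norm (1 - y * q ^ n - 1))"
      proof (rule Weierstrass_m_test'_ev[OF always_eventually])
        show "\<forall>n. \<forall>y\<in>cball x 1. norm (norm (1 - y * q ^ n - 1)) \<le> (norm x + 1) * norm q ^ n"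
        proof (intro allI ballI)
          fix n y assume "y \<in> cball x 1"
          then have "norm y \<le> norm x + 1"
            using norm_triangle_ineq2[of y x] by (simp add: dist_norm norm_minus_commute)
          then show "norm (norm (1 - y * q ^ n - 1)) \<le> (norm x + 1) * norm q ^ n"
            by (simp add: norm_mult norm_power mult_right_mono)
        qed
        show "summable (\<lambda>n. (norm x + 1) * norm q ^ n)"
          using norm_q by (intro summable_mult summable_geometric) auto
      qed
    qed (auto intro!: continuous_intros)
    then have "uniform_limit (cball x 1) (\<lambda>N y. \<Prod>n<N. 1 - y * q ^ n)
        (\<lambda>y. lim (\<lambda>N. \<Prod>n<N. 1 - y * q ^ n)) sequentially"
      by (rule uniformly_convergent_uniform_limit_iff[THEN iffD1])
    moreover have "lim (\<lambda>N. \<Prod>n<N. 1 - y * q ^ n) = qP y" for y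
      using qP_LIMSEQ[of y] unfolding qp_def by (rule limI)
    ultimately show ?thesis
      by (simp add: qp_def)
  qed
  then show "\<exists>d>0. cball x d \<subseteq> UNIV \<and> uniform_limit (cball x d) (\<lambda>n x. qp x n) qP sequentially"
    by (intro exI[of _ 1]) auto
qed (auto simp: qp_def intro!: holomorphic_intros)

lemma qP_holomorphic_comp [holomorphic_intros]:
  "f holomorphic_on A \<Longrightarrow> (\<lambda>x. qP (f x)) holomorphic_on A"
  using holomorphic_on_compose[of f A qP] holomorphic_on_subset[OF qP_holomorphic]
  by (auto simp: o_def)

section \<open>The theta function\<close>

definition \<theta> :: "complex \<Rightarrow> complex" where "\<theta> x = qP x * qP (q / x)"

lemma \<theta>_holomorphic_comp [holomorphic_intros]:
  "f holomorphic_on A \<Longrightarrow> (\<And>x. x \<in> A \<Longrightarrow> f x \<noteq> 0) \<Longrightarrow> (\<lambda>x. \<theta> (f x)) holomorphic_on A"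
  unfolding \<theta>_def by (auto intro!: holomorphic_intros)

lemma \<theta>_q:
  assumes "x \<noteq> 0"
  shows "\<theta> (q * x) = - \<theta> x / x"
proof -
  have "qP (1 / x) = (1 - 1 / x) * qP (q / x)"
    by (subst qP_rec) simp
  then have "\<theta> (q * x) = qP (q * x) * ((1 - 1 / x) * qP (q / x))"
    using q_nz by (simp add: \<theta>_def)
  also have "\<dots> = - ((1 - x) * qP (q * x) * qP (q / x)) / x"
    using assms by (simp add: field_simps)
  also have "(1 - x) * qP (q * x) = qP x"
    by (subst (2) qP_rec) (simp add: mult.commute)
  finally show ?thesis
    by (simp add: \<theta>_def)
qed

lemma \<theta>_reflect [simp]: "\<theta> (q / x) = \<theta> x"
  using q_nz by (simp add: \<theta>_def)

lemma \<theta>_inverse: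
  assumes "x \<noteq> 0"
  shows "\<theta> (1 / x) = - \<theta> x / x"
  using \<theta>_reflect[of "q * x"] \<theta>_q[OF assms] q_nz by (simp del: \<theta>_reflect)

lemma \<theta>_1 [simp]: "\<theta> 1 = 0"
  by (simp add: \<theta>_def)

lemma \<theta>_zero_imp:
  assumes "x \<noteq> 0" "\<theta> x = 0"
  obtains j :: int where "x = q powi j"
proof -
  from assms consider "qP x = 0" | "qP (q / x) = 0"
    by (auto simp: \<theta>_def)
  then show ?thesis
  proof cases
    case 1
    then obtain i where "x * q ^ i = 1" by (auto simp: qP_zero_iff)
    then have "x = q powi (- int i)"
      using q_nz by (simp add: power_int_minus field_simps)
    then show ?thesis by (rule that)
  next
    case 2
    then obtain i where "q / x * q ^ i = 1" by (auto simp: qP_zero_iff)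
    then have "x = q powi int (Suc i)"
      using assms by (simp add: field_simps del: of_nat_Suc)
    then show ?thesis by (rule that)
  qed
qed

lemma \<theta>_quasi:
  assumes "x \<noteq> 0"
  obtains u where "u \<noteq> 0" "\<And>y. y \<noteq> 0 \<Longrightarrow> \<theta> (q powi j * y) = u * y powi (- j) * \<theta> y"
proof -
  have nonneg: "\<exists>u. u \<noteq> 0 \<and> (\<forall>y. y \<noteq> 0 \<longrightarrow> \<theta> (q ^ n * y) = u * y powi (- int n) * \<theta> y)" for n
  proof (induction n)
    case 0
    then show ?case by (intro exI[of _ 1]) auto
  next
    case (Suc n)
    then obtain u where u: "u \<noteq> 0" "\<And>y. y \<noteq> 0 \<Longrightarrow> \<theta> (q ^ n * y) = u * y powi (- int n) * \<theta> y"
      by blast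
    have "\<theta> (q ^ Suc n * y) = (- u / q ^ n) * y powi (- int (Suc n)) * \<theta> y" if "y \<noteq> 0" for y
    proof -
      have "\<theta> (q * (q ^ n * y)) = - (u * y powi (- int n) * \<theta> y) / (q ^ n * y)"
        using \<theta>_q[of "q ^ n * y"] u(2)[OF that] that q_nz by simp
      moreover have "y powi (- int (Suc n)) = y powi (- int n) / y"
        using that by (simp add: power_int_minus divide_simps del: of_nat_Suc)
      ultimately show ?thesis
        by (simp only: power_Suc mult.assoc) simp
    qed
    then show ?case
      using u(1) q_nz by (intro exI[of _ "- u / q ^ n"]) auto
  qed
  show ?thesis
  proof (cases "j \<ge> 0")
    case True
    then obtain n where "j = int n" by (metis nonneg_int_cases)
    then show ?thesis using nonneg[of n] that by auto
  next
    case False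
    \<comment> \<open>A negative exponent is reduced to a positive one by applying the relation at
      \<open>z = y / q ^ n\<close>; the power \<open>q ^ (n * n)\<close> in the constant comes from
      \<open>z ^ n\<close>.\<close>
    define n where "n = nat (- j)"
    have j: "j = - int n" using False by (simp add: n_def)
    obtain u where u: "u \<noteq> 0" "\<And>y. y \<noteq> 0 \<Longrightarrow> \<theta> (q ^ n * y) = u * y powi (- int n) * \<theta> y"
      using nonneg[of n] by blast
    show ?thesis
    proof (rule that)
      show "1 / (u * q ^ (n * n)) \<noteq> 0" using u(1) q_nz by simp
      fix y :: complex assume y: "y \<noteq> 0"
      define z where "z = y / q ^ n"
      have z: "z \<noteq> 0" "q ^ n * z = y" "q powi j * y = z"
        using y q_nz by (auto simp: z_def j power_int_minus divide_inverse)
      have zn: "z ^ n = y ^ n / q ^ (n * n)"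
        by (simp add: z_def power_divide power_mult)
      have "\<theta> y = u * (1 / z ^ n) * \<theta> z"
        using u(2)[OF z(1)] z(2) by (simp add: power_int_minus divide_inverse)
      then have "\<theta> z = z ^ n / u * \<theta> y"
        using z(1) u(1) by simp
      then show "\<theta> (q powi j * y) = 1 / (u * q ^ (n * n)) * y powi (- j) * \<theta> y"
        unfolding z(3) by (simp add: zn j)
    qed
  qed
qed

end

section \<open>Removing simple zeros of a divisor\<close>

lemma holomorphic_division_simple_zeros:
  assumes "open S" and f: "f holomorphic_on S" and g: "g holomorphic_on S"
    and z: "\<And>z. z \<in> S \<Longrightarrow> g z = 0 \<Longrightarrow> f z = 0 \<and> deriv g z \<noteq> 0"
  obtains h where "h holomorphic_on S" "\<And>z. z \<in> S \<Longrightarrow> f z = g z * h z"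
proof -
  \<comment> \<open>At a common zero the quotient gets its limit value. Near such a point
    \<open>h\<close> is the quotient \<open>F / G\<close> of the two difference quotients; these are
    holomorphic, and \<open>G\<close> does not vanish there because the zero of \<open>g\<close> is
    simple.\<close>
  define h where "h = (\<lambda>z. if g z = 0 then deriv f z / deriv g z else f z / g z)"
  have "\<exists>U. open U \<and> z0 \<in> U \<and> h holomorphic_on U" if z0: "z0 \<in> S" for z0
  proof -
    define F where "F = (\<lambda>z. if z = z0 then deriv f z0 else (f z - f z0) / (z - z0))"
    define G where "G = (\<lambda>z. if z = z0 then deriv g z0 else (g z - g z0) / (z - z0))"
    have F: "F holomorphic_on S" and G: "G holomorphic_on S"
      unfolding F_def G_def using f g \<open>open S\<close> by (simp_all add: pole_lemma_open)
    show ?thesis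
    proof (cases "g z0 = 0")
      case False
      have "open (S \<inter> g -` (- {0}))"
        using g \<open>open S\<close> by (intro continuous_open_preimage holomorphic_on_imp_continuous_on) auto
      moreover have "h holomorphic_on S \<inter> g -` (- {0})"
        by (rule holomorphic_transform[where f = "\<lambda>z. f z / g z"])
           (auto simp: h_def intro!: holomorphic_intros
             intro: holomorphic_on_subset[OF f] holomorphic_on_subset[OF g])
      ultimately show ?thesis
        using False z0 by (intro exI[of _ "S \<inter> g -` (- {0})"]) auto
    next
      case True
      have "open (S \<inter> G -` (- {0}))"
        using G \<open>open S\<close> by (intro continuous_open_preimage holomorphic_on_imp_continuous_on) auto
      moreover have "h holomorphic_on S \<inter> G -` (- {0})"
      proof (rule holomorphic_transform[where f = "\<lambda>z. F z / G z"])
        show "(\<lambda>z. F z / G z) holomorphic_on S \<inter> G -` (- {0})"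
          by (auto intro!: holomorphic_intros intro: holomorphic_on_subset[OF F] holomorphic_on_subset[OF G])
        show "F z / G z = h z" if "z \<in> S \<inter> G -` (- {0})" for z
          using that True z[OF z0 True] by (auto simp: F_def G_def h_def)
      qed
      moreover have "G z0 \<noteq> 0"
        using z[OF z0 True] by (simp add: G_def)
      ultimately show ?thesis
        using z0 by (intro exI[of _ "S \<inter> G -` (- {0})"]) auto
    qed
  qed
  then have "h holomorphic_on S"
    unfolding holomorphic_on_def by (metis at_within_open field_differentiable_at_within)
  then show ?thesis
    by (rule that) (auto simp: h_def dest: z)
qed

text \<open>Simple zeros are isolated, so \<open>D\<close> vanishes on a punctured neighbourhood of
  each of them. This carries a functional equation, obtained by cancelling a divisor, over to the
  zeros of that divisor.\<close>

lemma continuous_eq_0_off_simple_zeros: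
  fixes D g :: "complex \<Rightarrow> complex"
  assumes "open S" and g: "g holomorphic_on S" "\<And>z. z \<in> S \<Longrightarrow> g z = 0 \<Longrightarrow> deriv g z \<noteq> 0"
    and D: "continuous_on S D" "\<And>z. z \<in> S \<Longrightarrow> g z \<noteq> 0 \<Longrightarrow> D z = 0" and "z \<in> S"
  shows "D z = 0"
proof (cases "g z = 0")
  case True
  have "(g has_field_derivative deriv g z) (at z)"
    using g(1) \<open>open S\<close> \<open>z \<in> S\<close> by (rule holomorphic_derivI)
  then have "((\<lambda>w. (g w - g z) / (w - z)) \<longlongrightarrow> deriv g z) (at z)"
    by (simp add: has_field_derivative_iff)
  then have "eventually (\<lambda>w. (g w - g z) / (w - z) \<noteq> 0) (at z)"
    using g(2)[OF \<open>z \<in> S\<close> True] by (rule tendsto_imp_eventually_ne)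
  moreover have "eventually (\<lambda>w. w \<in> S) (at z)"
    using \<open>open S\<close> \<open>z \<in> S\<close> by (intro eventually_at_in_open')
  ultimately have "eventually (\<lambda>w. D w = 0) (at z)"
    by eventually_elim (use True D(2) in auto)
  then have "(D \<longlongrightarrow> 0) (at z)"
    by (rule tendsto_eventually)
  moreover have "(D \<longlongrightarrow> D z) (at z)"
    using D(1) \<open>open S\<close> \<open>z \<in> S\<close> by (metis continuous_on_def at_within_open)
  ultimately show ?thesis
    by (metis LIM_unique)
qed (use D(2) \<open>z \<in> S\<close> in auto)

context q_base
begin

lemma \<theta>_field_differentiable: "x \<noteq> 0 \<Longrightarrow> \<theta> field_differentiable at x"
  by (rule holomorphic_on_imp_differentiable_at[of _ "- {0}"])
     (auto intro!: \<theta>_holomorphic_comp[of "\<lambda>x. x", simplified] simp: open_Compl)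

text \<open>The zero comes from the first factor of \<open>qP z\<close>: one has
  \<open>\<theta> z = (1 - z) * h z\<close>, where \<open>h 1\<close> is the square of
  \<open>qP q\<close>.\<close>

lemma deriv_\<theta>_1: "deriv \<theta> 1 = - (qP q)\<^sup>2"
proof (rule DERIV_imp_deriv)
  define h where "h = (\<lambda>z. qP (z * q) * qP (q / z))"
  have "h holomorphic_on - {0}"
    unfolding h_def by (auto intro!: holomorphic_intros)
  then have "(h has_field_derivative deriv h 1) (at 1)"
    by (intro holomorphic_derivI[of h "- {0}"]) (auto simp: open_Compl)
  then have "((\<lambda>z. (1 - z) * h z) has_field_derivative - h 1) (at 1)"
    by (auto intro!: derivative_eq_intros)
  moreover have "(\<lambda>z. (1 - z) * h z) = \<theta>"
    by (rule ext) (simp add: h_def \<theta>_def, subst (3) qP_rec, simp)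
  ultimately show "(\<theta> has_field_derivative - (qP q)\<^sup>2) (at 1)"
    by (simp add: h_def power2_eq_square)
qed

text \<open>Quasi-periodicity carries the simple zero at 1 to the zero at \<open>q powi j\<close>.
  When the relation is differentiated at \<open>y = 1\<close>, the derivative of the power of
  \<open>y\<close> is multiplied by \<open>\<theta> 1 = 0\<close> and drops out.\<close>

lemma deriv_\<theta>_nz:
  assumes "x \<noteq> 0" "\<theta> x = 0"
  shows "deriv \<theta> x \<noteq> 0"
proof
  assume 0: "deriv \<theta> x = 0"
  obtain j where j: "x = q powi j"
    using \<theta>_zero_imp[OF assms] .
  obtain u where u: "u \<noteq> 0" "\<And>y. y \<noteq> 0 \<Longrightarrow> \<theta> (q powi j * y) = u * y powi (- j) * \<theta> y"
    using \<theta>_quasi by (metis zero_neq_one)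
  have d: "(\<theta> has_field_derivative deriv \<theta> y) (at y)" if "y \<noteq> 0" for y
    using \<theta>_field_differentiable[OF that] DERIV_deriv_iff_field_differentiable by blast
  have "((\<lambda>y. \<theta> (q powi j * y)) has_field_derivative deriv \<theta> x * x) (at 1)"
    using DERIV_chain2[OF d[of "q powi j * 1"] DERIV_cmult_Id, where s = UNIV] assms(1) by (simp add: j)
  moreover have "((\<lambda>y. u * y powi (- j) * \<theta> y) has_field_derivative u * deriv \<theta> 1) (at 1)"
    by (rule derivative_eq_intros d | simp)+
  then have "((\<lambda>y. \<theta> (q powi j * y)) has_field_derivative u * deriv \<theta> 1) (at 1)"
    by (rule has_field_derivative_transform_within_open[where S = "- {0}"]) (auto simp: u open_Compl)
  ultimately have "deriv \<theta> x * x = u * deriv \<theta> 1"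
    by (rule DERIV_unique)
  then show False
    using 0 u(1) qP_q_nz by (simp add: deriv_\<theta>_1)
qed

section \<open>Quasi-periodic functions on the punctured plane\<close>

text \<open>The images of the annulus \<open>A\<close> under powers of \<open>q\<close> cover the
  punctured plane. Where \<open>norm (\<kappa> * z) \<le> 1\<close>, a step towards 0 does not
  increase \<open>norm (f z)\<close>; where this norm is at least 1, such a step does not decrease
  it. So the bound on \<open>A\<close> holds everywhere, \<open>f\<close> extends over 0 and is
  constant by Liouville's theorem, which the nonconstant multiplier allows only for the constant
  0.\<close>

lemma quasi_periodic_degree_neg_eq_0:
  assumes f: "f holomorphic_on - {0}"
    and qf: "\<And>y. y \<noteq> 0 \<Longrightarrow> f (q * y) = \<kappa> * y * f y" and "y \<noteq> 0"
  shows "f y = 0"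
proof (cases "\<kappa> = 0")
  case True
  then show ?thesis
    using qf[of "y / q"] \<open>y \<noteq> 0\<close> q_nz by simp
next
  case \<kappa>: False
  define A where "A = {z. norm q \<le> norm (\<kappa> * z) \<and> norm (\<kappa> * z) \<le> 1}"
  have "compact A"
  proof (rule compact_eq_bounded_closed[THEN iffD2], intro conjI)
    show "bounded A"
      using \<kappa> by (auto simp: bounded_iff A_def norm_mult field_simps intro!: exI[of _ "1 / norm \<kappa>"])
    show "closed A"
      unfolding A_def by (intro closed_Collect_conj closed_Collect_le continuous_intros)
  qed
  moreover have "A \<subseteq> - {0}"
    using q_nz by (auto simp: A_def)
  then have "continuous_on A f"
    using f holomorphic_on_imp_continuous_on continuous_on_subset by blast
  ultimately have "bounded (f ` A)"
    using compact_continuous_image compact_imp_bounded by blast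
  then obtain M where M: "\<And>z. z \<in> A \<Longrightarrow> norm (f z) \<le> M"
    by (auto simp: bounded_iff)
  have small: "norm (f (q ^ n * z)) \<le> norm (f z)" if "norm (\<kappa> * z) \<le> 1" "z \<noteq> 0" for n z
  proof (induction n)
    case (Suc n)
    have "norm (f (q ^ Suc n * z)) = norm (\<kappa> * z * q ^ n) * norm (f (q ^ n * z))"
      using qf[of "q ^ n * z"] that q_nz by (simp add: norm_mult mult_ac)
    also have "\<dots> \<le> 1 * norm (f (q ^ n * z))"
      using norm_mult_q_power_le[OF that(1)] by (intro mult_right_mono) auto
    finally show ?case
      using Suc by simp
  qed auto
  have large: "norm (f z) \<le> norm (f (q ^ n * z))" if "z \<noteq> 0" "\<And>i. i < n \<Longrightarrow> 1 \<le> norm (\<kappa> * (q ^ i * z))" for n z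
    using that(2)
  proof (induction n)
    case (Suc n)
    have "norm (f z) \<le> 1 * norm (f (q ^ n * z))"
      using Suc by simp
    also have "\<dots> \<le> norm (\<kappa> * (q ^ n * z)) * norm (f (q ^ n * z))"
      using Suc.prems[of n] by (intro mult_right_mono) auto
    also have "\<dots> = norm (f (q ^ Suc n * z))"
      using qf[of "q ^ n * z"] that q_nz by (simp add: norm_mult mult_ac)
    finally show ?case .
  qed auto
  have to0: "\<exists>n. norm q ^ n < e" if "e > 0" for e
    using real_arch_pow_inv[OF that norm_q] by blast
  have bound: "norm (f z) \<le> M" if z: "z \<noteq> 0" for z
  proof (cases "norm (\<kappa> * z) \<le> 1")
    case True
    \<comment> \<open>Going outwards: \<open>k = m - 1\<close> divisions by \<open>q\<close> bring
      \<open>z\<close> into \<open>A\<close>.\<close>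
    define m where "m = (LEAST m. norm q ^ m < norm (\<kappa> * z))"
    have m: "norm q ^ m < norm (\<kappa> * z)"
      unfolding m_def using to0[of "norm (\<kappa> * z)"] z \<kappa> by (auto intro: LeastI_ex)
    have "m \<noteq> 0"
      using m True by (intro notI) simp
    then obtain k where k: "m = Suc k"
      using not0_implies_Suc by blast
    have "\<not> norm q ^ k < norm (\<kappa> * z)"
      using not_less_Least[of k "\<lambda>m. norm q ^ m < norm (\<kappa> * z)"] k by (simp add: m_def)
    then have "z / q ^ k \<in> A"
      using m k q_nz by (simp add: A_def norm_mult norm_divide norm_power field_simps)
    then have "norm (f (q ^ k * (z / q ^ k))) \<le> M"
      using small[of "z / q ^ k" k] M[of "z / q ^ k"] z q_nz by (force simp: A_def)
    then show ?thesis using q_nz by simp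
  next
    case False
    \<comment> \<open>Going inwards: \<open>m\<close> multiplications by \<open>q\<close> are just
      enough to enter \<open>A\<close>, and all earlier points still satisfy the hypothesis of
      \<open>large\<close>.\<close>
    define m where "m = (LEAST m. norm (\<kappa> * (q ^ m * z)) \<le> 1)"
    have "\<exists>m. norm (\<kappa> * (q ^ m * z)) \<le> 1"
    proof -
      obtain n where "norm q ^ n < 1 / norm (\<kappa> * z)"
        using to0[of "1 / norm (\<kappa> * z)"] z \<kappa> by auto
      then show ?thesis
        using z \<kappa> by (intro exI[of _ n]) (simp add: norm_mult norm_power field_simps)
    qed
    then have m: "norm (\<kappa> * (q ^ m * z)) \<le> 1"
      unfolding m_def by (rule LeastI_ex)
    have less: "1 \<le> norm (\<kappa> * (q ^ i * z))" if "i < m" for i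
      using not_less_Least[of i "\<lambda>m. norm (\<kappa> * (q ^ m * z)) \<le> 1"] that by (simp add: m_def)
    have "m \<noteq> 0"
      using m False by (intro notI) simp
    then obtain k where k: "m = Suc k"
      using not0_implies_Suc by blast
    have "norm q * 1 \<le> norm q * norm (\<kappa> * (q ^ k * z))"
      using less[of k] k by (intro mult_left_mono) auto
    then have "q ^ m * z \<in> A"
      using m by (simp add: A_def k norm_mult mult_ac)
    then show ?thesis
      using large[OF z less, of m] M by force
  qed
  have "(\<exists>g. g holomorphic_on UNIV \<and> (\<forall>z\<in>UNIV - {0}. g z = f z))"
    by (subst holomorphic_on_extend_bounded)
       (use f bound in \<open>auto simp: Compl_eq_Diff_UNIV eventually_at_filter intro!: exI[of _ M]\<close>)
  then obtain g where g: "g holomorphic_on UNIV" "\<And>z. z \<noteq> 0 \<Longrightarrow> g z = f z"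
    by auto
  have "norm (g z) \<le> max M (norm (g 0))" for z
    using bound[of z] g(2)[of z] by (cases "z = 0") (auto simp: le_max_iff_disj)
  then have "bounded (range g)"
    by (auto simp: bounded_iff)
  then obtain c where c: "\<And>z. g z = c"
    using Liouville_theorem[OF g(1)] by (auto simp: constant_on_def)
  \<comment> \<open>At this point the multiplier equals 2, so the constant value is its own
    double.\<close>
  have "f (q * (2 / \<kappa>)) = 2 * f (2 / \<kappa>)"
    using qf[of "2 / \<kappa>"] \<kappa> by simp
  then have "c = 2 * c"
    using g(2)[of "q * (2 / \<kappa>)"] g(2)[of "2 / \<kappa>"] c \<kappa> q_nz by simp
  then show ?thesis
    using g(2)[OF \<open>y \<noteq> 0\<close>] c by simp
qed

lemma quasi_periodic_zero_at_q_powi: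
  assumes qf: "\<And>y. y \<noteq> 0 \<Longrightarrow> f (q * y) * y ^ n = \<kappa> * y * f y" and "\<kappa> \<noteq> 0" "x \<noteq> 0" "f x = (0::complex)"
  shows "f (q powi j * x) = 0"
proof -
  have iff: "f (q * y) = 0 \<longleftrightarrow> f y = 0" if "y \<noteq> 0" for y
    using qf[OF that] that \<open>\<kappa> \<noteq> 0\<close> by auto
  have nat: "f (q ^ m * y) = 0 \<longleftrightarrow> f y = 0" if "y \<noteq> 0" for m y
    by (induction m) (use iff that q_nz in \<open>auto simp: mult.assoc\<close>)
  show ?thesis
  proof (cases "j \<ge> 0")
    case True
    then show ?thesis
      using nat[of x "nat j"] assms by (simp add: power_int_def)
  next
    case False
    then have "q ^ nat (- j) * (q powi j * x) = x"
      using q_nz by (simp add: power_int_def power_inverse)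
    then show ?thesis
      using nat[of "q powi j * x" "nat (- j)"] assms q_nz by (simp flip: mult.assoc)
  qed
qed

lemma quasi_periodic_eq_0:
  assumes "f holomorphic_on - {0}"
    and "\<And>y. y \<noteq> 0 \<Longrightarrow> f (q * y) * y ^ length xs = \<kappa> * y * f y" and "\<kappa> \<noteq> 0"
    and "\<And>x. x \<in> set xs \<Longrightarrow> x \<noteq> 0 \<and> f x = 0"
    and "sorted_wrt (\<lambda>x y. \<theta> (y / x) \<noteq> 0) xs" and "y \<noteq> 0"
  shows "f y = 0"
  using assms
  \<comment> \<open>dividing by \<open>\<theta> (y / x)\<close> removes all zeros \<open>x q\<^sup>j\<close> and lowers the exponent by one\<close>
proof (induction xs arbitrary: f \<kappa> y)
  case Nil
  then show ?case
    using quasi_periodic_degree_neg_eq_0[of f \<kappa> y] by simp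
next
  case (Cons x xs)
  have x: "x \<noteq> 0" "f x = 0"
    using Cons.prems(4)[of x] by auto
  have hol: "(\<lambda>y. \<theta> (y / x)) holomorphic_on - {0}"
    using x by (auto intro!: holomorphic_intros)
  have zeros: "f z = 0 \<and> deriv (\<lambda>y. \<theta> (y / x)) z \<noteq> 0"
    if "z \<in> - {0}" and zq: "\<theta> (z / x) = 0" for z
  proof
    have "z / x \<noteq> 0" using that x by simp
    then obtain j where "z / x = q powi j"
      using \<theta>_zero_imp zq by blast
    then have "z = q powi j * x"
      using x by (simp add: field_simps)
    then show "f z = 0"
      using quasi_periodic_zero_at_q_powi[OF Cons.prems(2) Cons.prems(3) x] by simp
    have "(\<theta> has_field_derivative deriv \<theta> (z / x)) (at (z / x))"
      using \<theta>_field_differentiable[OF \<open>z / x \<noteq> 0\<close>] DERIV_deriv_iff_field_differentiable by blast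
    then have "((\<lambda>y. \<theta> (y / x)) has_field_derivative deriv \<theta> (z / x) * (1 / x)) (at z)"
      by (rule DERIV_chain2) (auto intro!: derivative_eq_intros simp: x)
    then have "deriv (\<lambda>y. \<theta> (y / x)) z = deriv \<theta> (z / x) * (1 / x)"
      by (rule DERIV_imp_deriv)
    then show "deriv (\<lambda>y. \<theta> (y / x)) z \<noteq> 0"
      using deriv_\<theta>_nz[OF \<open>z / x \<noteq> 0\<close> zq] x by simp
  qed
  obtain h where h: "h holomorphic_on - {0}" "\<And>z. z \<noteq> 0 \<Longrightarrow> f z = \<theta> (z / x) * h z"
    using holomorphic_division_simple_zeros[OF _ Cons.prems(1) hol zeros]
    by (metis ComplI open_Compl closed_singleton singletonD)
  have "h y = 0" if "y \<noteq> 0" for y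
  proof (rule Cons.IH[where f = h and y = y and \<kappa> = "- \<kappa> / x"])
    show "h holomorphic_on - {0}" by (rule h)
    show "sorted_wrt (\<lambda>x y. \<theta> (y / x) \<noteq> 0) xs" "y \<noteq> 0" "- \<kappa> / x \<noteq> 0"
      using Cons.prems that x by auto
    show "z \<noteq> 0 \<and> h z = 0" if "z \<in> set xs" for z
      using Cons.prems(4)[of z] Cons.prems(5) that h(2)[of z] by auto
    \<comment> \<open>The divisor itself obeys
      \<open>\<theta> (q * y / x) = - \<theta> (y / x) * x / y\<close>, which turns
      \<open>\<kappa>\<close> into \<open>- \<kappa> / x\<close>. Cancelling it is possible only
      where it does not vanish; the remaining points are reached by continuity of \<open>D\<close>
      below.\<close>
    have hq: "h (q * y) * y ^ length xs = - \<kappa> / x * y * h y" if y: "y \<noteq> 0" "\<theta> (y / x) \<noteq> 0" for y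
    proof -
      have "\<theta> (q * y / x) = - \<theta> (y / x) * x / y"
        using \<theta>_q[of "y / x"] y x by (simp add: field_simps)
      then have "\<theta> (y / x) * (- x * h (q * y) * y ^ length xs) = \<theta> (y / x) * (\<kappa> * y * h y)"
        using Cons.prems(2)[OF y(1)] h(2)[of y] h(2)[of "q * y"] y x q_nz by (simp add: mult_ac)
      then have "- x * h (q * y) * y ^ length xs = \<kappa> * y * h y"
        by (simp only: mult_left_cancel[OF y(2)])
      then have "\<kappa> * y * h y = - (x * (h (q * y) * y ^ length xs))"
        by (simp only: mult.assoc mult_minus_left)
      moreover have "x * (- \<kappa> / x * y * h y) = - (\<kappa> * y * h y)"
        using x(1) by simp
      ultimately have "x * (h (q * y) * y ^ length xs) = x * (- \<kappa> / x * y * h y)"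
        by (simp only: minus_minus)
      then show ?thesis
        by (simp only: mult_left_cancel[OF x(1)])
    qed
    show "h (q * y) * y ^ length xs = - \<kappa> / x * y * h y" if y: "y \<noteq> 0" for y
    proof -
      define D where "D = (\<lambda>y. h (q * y) * y ^ length xs - (- \<kappa> / x * y * h y))"
      have "(h \<circ> (\<lambda>y. q * y)) holomorphic_on - {0}"
      proof (rule holomorphic_on_compose_gen[OF _ h(1)])
        show "(\<lambda>y. q * y) holomorphic_on - {0}"
          by (intro holomorphic_intros)
        show "(\<lambda>y. q * y) ` (- {0}) \<subseteq> - {0}"
          using q_nz by auto
      qed
      then have "(\<lambda>y. h (q * y)) holomorphic_on - {0}"
        by (simp only: o_def)
      then have "D holomorphic_on - {0}"
        unfolding D_def by (intro holomorphic_intros h(1))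
      then have cont: "continuous_on (- {0}) D"
        by (rule holomorphic_on_imp_continuous_on)
      have "D y = 0"
      proof (rule continuous_eq_0_off_simple_zeros[OF _ hol _ cont])
        show "deriv (\<lambda>y. \<theta> (y / x)) z \<noteq> 0" if "z \<in> - {0}" "\<theta> (z / x) = 0" for z
          using zeros[OF that] by blast
        show "D z = 0" if "z \<in> - {0}" "\<theta> (z / x) \<noteq> 0" for z
          unfolding D_def using hq[of z] that by simp
      qed (use y in \<open>auto simp: open_Compl\<close>)
      then show ?thesis
        by (simp only: D_def right_minus_eq)
    qed
  qed
  then show ?case
    using h(2) Cons.prems(6) by simp
qed

end

section \<open>The sums of Rogers and Jackson\<close>

text \<open>With \<open>x = q ^ Suc N\<close>, this is one step of the telescoping for Jackson's sum
  after all common factors have been cancelled. Here \<open>u\<close> is \<open>e + f\<close>, and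
  \<open>e1\<close>, \<open>e2\<close>, \<open>e3\<close> are the elementary symmetric functions of
  \<open>b\<close>, \<open>c\<close>, \<open>d\<close>; the relation is symmetric in these
  parameters, and in the new variables its expansion is much shorter.\<close>

lemma jackson_poly_aux:
  fixes w :: complex
  shows "(1 - w) * (1 - a * (x * x)) * (1 - u + a * w) * x * (1 - w * e2 * x + w * w * e1 * e3 * x * x - w * w * w * e3 * e3 * x * x * x)
    - (1 - w * e1 + w * w * e2 - w * w * w * e3) * (1 - w * e3 * (x * x)) * (1 - a * x) * (1 - u * x + a * w * x * x) * x
    = - (w * (1 - w * w * e3 * x) * (1 - a * x) * (1 - e1 * x + e2 * x * x - e3 * x * x * x) * (1 - u * x + a * w * x * x)
      - (1 - a * w * x) * (1 - x) * (1 - w * e2 * x + w * w * e1 * e3 * x * x - w * w * w * e3 * e3 * x * x * x) * (w - u * x + a * x * x))"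
  by (simp add: algebra_simps)

lemma jackson_poly:
  fixes w :: complex
  assumes ef: "e * f = a * w" and X: "w * X = w - (e + f) * x + a * x * x"
  shows "(1 - w) * (1 - a * (x * x)) * ((1 - e) * (1 - f)) * x * ((1 - w * c * d * x) * (1 - w * b * d * x) * (1 - w * b * c * x))
    - ((1 - w * b) * (1 - w * c) * (1 - w * d)) * (1 - w * (b * c * d) * (x * x)) * (1 - a * x) * ((1 - e * x) * (1 - f * x)) * x
    = - (w * (1 - w * w * (b * c * d) * x) * (1 - a * x) * ((1 - b * x) * (1 - c * x) * (1 - d * x)) * ((1 - e * x) * (1 - f * x))
      - (1 - a * w * x) * (1 - x) * ((1 - w * c * d * x) * (1 - w * b * d * x) * (1 - w * b * c * x)) * (w * X))"
proof -
  define e1 e2 e3 where "e1 = b + c + d" "e2 = b * c + b * d + c * d" "e3 = b * c * d"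
  have 1: "(1 - e) * (1 - f) = 1 - (e + f) + a * w"
    by (simp add: algebra_simps flip: ef)
  have 2: "(1 - e * x) * (1 - f * x) = 1 - (e + f) * x + a * w * x * x"
    by (simp add: algebra_simps flip: ef)
  have 3: "(1 - w * c * d * x) * (1 - w * b * d * x) * (1 - w * b * c * x)
      = 1 - w * e2 * x + w * w * e1 * e3 * x * x - w * w * w * e3 * e3 * x * x * x"
    by (simp add: e1_e2_e3_def algebra_simps)
  have 4: "(1 - b * x) * (1 - c * x) * (1 - d * x) = 1 - e1 * x + e2 * x * x - e3 * x * x * x"
    by (simp add: e1_e2_e3_def algebra_simps)
  have 5: "(1 - w * b) * (1 - w * c) * (1 - w * d) = 1 - w * e1 + w * w * e2 - w * w * w * e3"
    by (simp add: e1_e2_e3_def algebra_simps)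
  show ?thesis
    unfolding 1 2 3 4 5 X e1_e2_e3_def(3)[symmetric] by (rule jackson_poly_aux)
qed

text \<open>The corresponding step for Rogers' sum. Its argument is \<open>w\<close> for the base
  \<open>a\<close> and \<open>w * q\<close> for the base \<open>a * q\<close>, hence the extra
  factor \<open>x\<close> in the second product only.\<close>

lemma rogers_poly:
  fixes w :: complex
  shows "(1 - w) * (1 - a * (x * x)) * ((1 - w * c * d * x) * (1 - w * b * d * x) * (1 - w * b * c * x))
    - ((1 - w * b) * (1 - w * c) * (1 - w * d)) * x * (1 - w * (b * c * d) * (x * x)) * (1 - a * x)
    = - (w * (1 - w * w * (b * c * d) * x) * (1 - a * x) * ((1 - b * x) * (1 - c * x) * (1 - d * x)))
      + (1 - a * w * x) * (1 - x) * ((1 - w * c * d * x) * (1 - w * b * d * x) * (1 - w * b * c * x))"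
  by (simp add: algebra_simps)

lemma telescope_aux:
  fixes U :: "'a :: field"
  assumes "D \<noteq> 0" "C = B * D"
  shows "D * (- (U * A) / D - - (U * B)) = U * (- A + C)"
    and "D * (- (U * A) / D - - (U * B)) = U * (- (A - C))"
  using assms by (simp_all add: algebra_simps)

context q_base
begin

text \<open>The coefficients of a very-well-poised series: \<open>vw\<close> collects the parameters \<open>a, q\<surd>a, -q\<surd>a\<close> over
  \<open>q, \<surd>a, -\<surd>a\<close>, and \<open>fr a b\<close> is the contribution of a numerator parameter \<open>b\<close> and its partner \<open>aq/b\<close>.\<close>

definition vw :: "complex \<Rightarrow> nat \<Rightarrow> complex" where
  "vw a k = (1 - a * q ^ (2 * k)) / (1 - a) * (qp a k / qp q k)"

definition fr :: "complex \<Rightarrow> complex \<Rightarrow> nat \<Rightarrow> complex" where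
  "fr a b k = qp b k / qp (a * q / b) k"

lemma vw_0: "a \<noteq> 1 \<Longrightarrow> vw a 0 = 1"
  by (simp add: vw_def)

lemma vw_Suc:
  "a \<noteq> 1 \<Longrightarrow> vw a (Suc n) = (1 - a * (q ^ Suc n * q ^ Suc n)) * qp (a * q) n / qp q (Suc n)"
  unfolding vw_def qp_Suc_left[of a] by (simp add: mult_2 power_add)

lemma fr_0 [simp]: "fr a b 0 = 1"
  by (simp add: fr_def)

lemma qp_q_nz: "qp q n \<noteq> 0"
  by (rule qp_nz[OF qP_q_nz])

lemma fr_shift:
  assumes "qP (a * q / b) \<noteq> 0" "b \<noteq> 0"
  shows "fr (a * q) b k = fr a b k * (1 - a * q / b) / (1 - a * q / b * q ^ k)"
proof -
  have "(1 - a * q / b) * qp (a * q / b * q) k = qp (a * q / b) k * (1 - a * q / b * q ^ k)"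
    by (metis qp_Suc qp_Suc_left)
  moreover have "qp (a * q / b) k \<noteq> 0" "1 - a * q / b \<noteq> 0" "1 - a * q / b * q ^ k \<noteq> 0"
    using qp_nz[OF assms(1), of k] qp_nz[OF assms(1), of "Suc k"] qp_nz[OF assms(1), of 1]
    by (auto simp: qp_Suc)
  ultimately have "qp (a * q / b * q) k = qp (a * q / b) k * (1 - a * q / b * q ^ k) / (1 - a * q / b)"
    by (simp add: field_simps)
  then show ?thesis
    by (simp add: fr_def mult_ac)
qed

definition jackson_term where
  "jackson_term a b c d e f k = vw a k * (fr a b k * fr a c k * fr a d k) * (fr a e k * fr a f k) * q ^ k"

definition rogers_term where
  "rogers_term a b c d k = vw a k * (fr a b k * fr a c k * fr a d k) * (a * q / (b * c * d)) ^ k"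

text \<open>With \<open>w = a * q / (b * c * d)\<close>, this is \<open>1 - w\<close> times the
  ratio of the closed forms for the bases \<open>a\<close> and \<open>a * q\<close>. Rogers' and
  Jackson's sums share this ratio, the latter if its length drops by one at the same time.\<close>

definition jackson_coef where
  "jackson_coef a b c d = (1 - a * q) * ((1 - a * q / (b * c)) * (1 - a * q / (b * d)) * (1 - a * q / (c * d)))
     / ((1 - a * q / b) * (1 - a * q / c) * (1 - a * q / d))"

text \<open>Common part of both antidifferences: the partial sums up to \<open>N\<close> are
  \<open>- w\<close> times this, multiplied by \<open>w ^ N\<close> for Rogers' sum and by the
  quotients belonging to \<open>e\<close> and \<open>f\<close> for Jackson's.\<close>

definition boundary where
  "boundary a b c d w N = (1 - w * (a * q) * q ^ N) * (qp (a * q) N * (1 / qp q N))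
     * (fr a b (Suc N) * fr a c (Suc N) * fr a d (Suc N))"

context
  fixes a b c d w :: complex
  assumes nz: "a \<noteq> 0" "b \<noteq> 0" "c \<noteq> 0" "d \<noteq> 0" and w: "w = a * q / (b * c * d)"
    and qPa: "qP a \<noteq> 0" and qPb: "qP (a * q / b) \<noteq> 0" and qPc: "qP (a * q / c) \<noteq> 0"
    and qPd: "qP (a * q / d) \<noteq> 0"
begin

lemma w_simps:
  "a * q / b = w * c * d" "a * q / c = w * b * d" "a * q / d = w * b * c"
  "a * q / (b * c) = w * d" "a * q / (b * d) = w * c" "a * q / (c * d) = w * b"
  "a * q = w * (b * c * d)"
  using nz by (simp_all add: w)

lemma a_nz1: "a \<noteq> 1" "a * q \<noteq> 1"
  using qp_nz[OF qPa, of 1] qp_nz[OF qPa, of 2] by (auto simp: qp_Suc numeral_2_eq_2)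

text \<open>Common factor of the terms of index \<open>Suc N\<close> for both bases and of the
  boundary values at \<open>N\<close> and \<open>Suc N\<close>. What remains of each of them is a
  polynomial in \<open>x = q ^ Suc N\<close>, possibly over \<open>Dx x\<close>, so that telescoping
  becomes a polynomial identity.\<close>

private definition U where
  "U N = qp (a * q) N / qp q (Suc N) * (fr a b (Suc N) * fr a c (Suc N) * fr a d (Suc N))"

private definition Dx where
  "Dx x = (1 - w * c * d * x) * (1 - w * b * d * x) * (1 - w * b * c * x)"

private lemma Dx_nz: "Dx (q ^ N) \<noteq> 0"
  using qp_nz[OF qPb, of "Suc N"] qp_nz[OF qPc, of "Suc N"] qp_nz[OF qPd, of "Suc N"]
  unfolding w_simps(1-3) by (auto simp: qp_Suc Dx_def)

private lemma coef_Dx: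
  "jackson_coef a b c d * Dx 1 = (1 - w * (b * c * d)) * ((1 - w * b) * (1 - w * c) * (1 - w * d))"
  using Dx_nz[of 0] unfolding jackson_coef_def w_simps(1-6) by (simp add: Dx_def w_simps(7))

private lemma boundary_0: "(1 - w) - jackson_coef a b c d = - (w * boundary a b c d w 0)"
proof -
  have "((1 - w) - jackson_coef a b c d) * Dx 1 = (1 - w) * Dx 1 - (1 - w * (b * c * d)) * ((1 - w * b) * (1 - w * c) * (1 - w * d))"
    by (simp only: left_diff_distrib coef_Dx)
  also have "\<dots> = - (w * (1 - w * (w * (b * c * d))) * (1 - b) * (1 - c) * (1 - d))"
    by (simp add: Dx_def algebra_simps)
  finally have "(1 - w) - jackson_coef a b c d = - (w * (1 - w * (w * (b * c * d))) * (1 - b) * (1 - c) * (1 - d)) / Dx 1"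
    using Dx_nz[of 0] by (simp only: nonzero_eq_divide_eq power_0 not_False_eq_True)
  then show ?thesis
    unfolding boundary_def fr_def One_nat_def[symmetric]
    by (simp add: qp_def w_simps(1-3) Dx_def) (simp add: w_simps(7) mult_ac)
qed

context
  fixes N :: nat and x :: complex
  assumes x: "x = q ^ Suc N"
begin

lemma well_poised_Suc:
  "vw a (Suc N) * (fr a b (Suc N) * fr a c (Suc N) * fr a d (Suc N)) = U N * (1 - a * (x * x))"
  unfolding vw_Suc[OF a_nz1(1)] x[symmetric] by (simp add: U_def)

lemma well_poised_shift_Suc:
  "jackson_coef a b c d * (vw (a * q) (Suc N) * (fr (a * q) b (Suc N) * fr (a * q) c (Suc N) * fr (a * q) d (Suc N)))
    = U N * (((1 - w * b) * (1 - w * c) * (1 - w * d)) * (1 - w * (b * c * d) * (x * x)) * (1 - a * x)) / Dx x"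
proof -
  have "vw (a * q) (Suc N) * (fr (a * q) b (Suc N) * fr (a * q) c (Suc N) * fr (a * q) d (Suc N)) =
    (1 - a * q * (x * x)) * qp (a * q * q) N / qp q (Suc N) *
     (fr a b (Suc N) * (1 - w * c * d) / (1 - w * c * d * x) *
      (fr a c (Suc N) * (1 - w * b * d) / (1 - w * b * d * x)) *
      (fr a d (Suc N) * (1 - w * b * c) / (1 - w * b * c * x)))"
    unfolding vw_Suc[OF a_nz1(2)] fr_shift[OF qPb nz(2)] fr_shift[OF qPc nz(3)]
      fr_shift[OF qPd nz(4)] w_simps(1-3) x[symmetric] ..
  also have "qp (a * q * q) N = qp (a * q) N * (1 - a * x) / (1 - a * q)"
    using a_nz1 qp_Suc_left[of "a * q" N] qp_Suc[of "a * q" N] by (simp add: field_simps x)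
  finally have "jackson_coef a b c d * (vw (a * q) (Suc N) * (fr (a * q) b (Suc N) * fr (a * q) c (Suc N) * fr (a * q) d (Suc N)))
    = (jackson_coef a b c d * Dx 1) / (1 - a * q) * (U N * (1 - a * q * (x * x)) * (1 - a * x)) / Dx x"
    by (simp add: U_def Dx_def)
  also have "jackson_coef a b c d * Dx 1 / (1 - a * q) = (1 - w * b) * (1 - w * c) * (1 - w * d)"
    unfolding coef_Dx using a_nz1 by (simp add: w_simps(7))
  finally show ?thesis
    by (simp only: w_simps(7) mult_ac)
qed

lemma boundary_eq: "boundary a b c d w N = U N * ((1 - a * w * x) * (1 - x))"
proof -
  have "qp q (Suc N) = qp q N * (1 - x)"
    by (simp add: qp_Suc x)
  then have "1 / qp q N = (1 - x) / qp q (Suc N)"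
    using qp_q_nz[of "Suc N"] by auto
  moreover have "w * (a * q) * q ^ N = a * w * x"
    by (simp add: x)
  ultimately show ?thesis
    unfolding boundary_def U_def by simp
qed

lemma boundary_Suc:
  "boundary a b c d w (Suc N) = U N * ((1 - w * w * (b * c * d) * x) * (1 - a * x)
      * ((1 - b * x) * (1 - c * x) * (1 - d * x))) / Dx x"
proof -
  have 1: "qp (a * q) (Suc N) = qp (a * q) N * (1 - a * x)"
    by (simp add: qp_Suc x mult_ac)
  have 2: "fr a y (Suc (Suc N)) = fr a y (Suc N) * (1 - y * x) / (1 - a * q / y * x)" for y
    unfolding fr_def qp_Suc[of _ "Suc N"] x by simp
  show ?thesis
    unfolding boundary_def 1 2 w_simps(1-3) by (simp add: U_def Dx_def x[symmetric] del: power_Suc) (simp add: w_simps(7) mult_ac)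
qed

end

text \<open>The increment of the right-hand side has to be the new summand; after cancelling the
  common factor \<open>V\<close> and multiplying by \<open>Dx x\<close>, this is
  \<open>rogers_poly\<close>.\<close>

lemma rogers_telescope:
  "(\<Sum>k\<le>N. (1 - w) * rogers_term a b c d k - jackson_coef a b c d * rogers_term (a * q) b c d k)
    = - (w ^ N * (w * boundary a b c d w N))"
  (is "_ = ?g N")
proof (induction N)
  case 0
  show ?case
    using boundary_0 a_nz1 by (simp add: rogers_term_def vw_0)
next
  case (Suc N)
  define x where x: "x = q ^ Suc N"
  define V where "V = U N * w ^ Suc N"
  have Dx: "Dx x \<noteq> 0" unfolding x by (rule Dx_nz)
  have t1: "rogers_term a b c d (Suc N) = V * (1 - a * (x * x))"
    unfolding rogers_term_def well_poised_Suc[OF x] w[symmetric] V_def by (simp only: mult_ac)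
  have wq: "a * q * q / (b * c * d) = w * q"
    by (simp add: w)
  have t2: "jackson_coef a b c d * rogers_term (a * q) b c d (Suc N)
     = V * (((1 - w * b) * (1 - w * c) * (1 - w * d)) * x * (1 - w * (b * c * d) * (x * x)) * (1 - a * x)) / Dx x"
  proof -
    have "jackson_coef a b c d * rogers_term (a * q) b c d (Suc N) = jackson_coef a b c d
      * (vw (a * q) (Suc N) * (fr (a * q) b (Suc N) * fr (a * q) c (Suc N) * fr (a * q) d (Suc N))) * (w ^ Suc N * x)"
      unfolding rogers_term_def wq power_mult_distrib x[symmetric] by (simp only: mult.assoc)
    then show ?thesis
      unfolding well_poised_shift_Suc[OF x] V_def by (simp add: mult_ac)
  qed
  have g1: "?g (Suc N) = - (V * (w * (1 - w * w * (b * c * d) * x) * (1 - a * x)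
      * ((1 - b * x) * (1 - c * x) * (1 - d * x)))) / Dx x"
    unfolding boundary_Suc[OF x] V_def by (simp add: mult_ac)
  have g0: "?g N = - (V * ((1 - a * w * x) * (1 - x)))"
    unfolding boundary_eq[OF x] V_def by simp
  have "Dx x * ((1 - w) * rogers_term a b c d (Suc N) - jackson_coef a b c d * rogers_term (a * q) b c d (Suc N))
    = V * ((1 - w) * (1 - a * (x * x)) * Dx x - ((1 - w * b) * (1 - w * c) * (1 - w * d)) * x * (1 - w * (b * c * d) * (x * x)) * (1 - a * x))"
    unfolding t1 t2 right_diff_distrib[of "Dx x"] right_diff_distrib[of V "_ * _ * Dx x"] using Dx by (simp add: mult_ac)
  also have "\<dots> = V * (- (w * (1 - w * w * (b * c * d) * x) * (1 - a * x) * ((1 - b * x) * (1 - c * x) * (1 - d * x)))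
    + (1 - a * w * x) * (1 - x) * Dx x)"
    unfolding Dx_def rogers_poly ..
  also have "\<dots> = Dx x * (?g (Suc N) - ?g N)"
    unfolding g1 g0 using Dx by (intro telescope_aux(1)[symmetric]) auto
  finally show ?case
    using Suc.IH Dx by simp
qed

text \<open>The balancing condition \<open>e * f = a * w\<close> survives when \<open>a\<close>,
  \<open>w\<close>, \<open>e\<close>, \<open>f\<close> are all multiplied by \<open>q\<close>, which
  is what allows the relation to be iterated.\<close>

lemma jackson_telescope:
  assumes ef: "e * f = a * w" and ef0: "e \<noteq> 0" "f \<noteq> 0"
    and Ee: "\<And>k. a * q / e * q ^ k \<noteq> 1" and Ff: "\<And>k. a * q / f * q ^ k \<noteq> 1"
  shows "(\<Sum>k\<le>N. (1 - w) * jackson_term a b c d e f k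
      - jackson_coef a b c d * jackson_term (a * q) b c d (e * q) (f * q) k)
    = - (w * boundary a b c d w N * (qp (e * q) N / qp (a * q / e) N * (qp (f * q) N / qp (a * q / f) N)))"
  (is "_ = ?g N")
proof (induction N)
  case 0
  show ?case
    using boundary_0 a_nz1 by (simp add: jackson_term_def vw_0)
next
  case (Suc N)
  define x where x: "x = q ^ Suc N"
  define P where "P = qp (e * q) N * qp (f * q) N / (qp (a * q / e) (Suc N) * qp (a * q / f) (Suc N))"
  define V where "V = U N * P"
  \<comment> \<open>The factor by which the denominators of \<open>e\<close> and \<open>f\<close>
    grow from \<open>N\<close> to \<open>Suc N\<close>. Since \<open>a / e = f / w\<close> and
    \<open>a / f = e / w\<close>, the product \<open>w * X\<close> is the quadratic polynomial that
    \<open>jackson_poly\<close> expects.\<close>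
  define X where "X = (1 - a * x / e) * (1 - a * x / f)"
  have Dx: "Dx x \<noteq> 0" unfolding x by (rule Dx_nz)
  have w0: "w \<noteq> 0"
    using nz q_nz by (simp add: w)
  have "a / e = f / w" "a / f = e / w"
    using ef ef0 w0 by (auto simp: field_simps)
  then have "X = (1 - f / w * x) * (1 - e / w * x)"
    unfolding X_def times_divide_eq_left[symmetric] by simp
  then have "w * X = w - (e + f) * x + e * f / w * x * x"
    using w0 by (simp add: field_simps)
  then have X: "w * X = w - (e + f) * x + a * x * x"
    using w0 by (simp add: ef)
  have fe: "fr a e (Suc N) * fr a f (Suc N) = (1 - e) * (1 - f) * P"
    by (simp add: fr_def P_def qp_Suc_left[of e] qp_Suc_left[of f])
  have "a * q * q / (e * q) = a * q / e" "a * q * q / (f * q) = a * q / f"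
    using q_nz by simp_all
  then have feq: "fr (a * q) (e * q) (Suc N) * fr (a * q) (f * q) (Suc N) = (1 - e * x) * (1 - f * x) * P"
    by (simp add: fr_def P_def qp_Suc[of "e * q"] qp_Suc[of "f * q"] x mult_ac)
  have t1: "jackson_term a b c d e f (Suc N) = V * ((1 - a * (x * x)) * ((1 - e) * (1 - f)) * x)"
    unfolding jackson_term_def well_poised_Suc[OF x] fe x[symmetric] V_def by (simp only: mult_ac)
  have t2: "jackson_coef a b c d * jackson_term (a * q) b c d (e * q) (f * q) (Suc N)
     = V * (((1 - w * b) * (1 - w * c) * (1 - w * d)) * (1 - w * (b * c * d) * (x * x)) * (1 - a * x)
         * ((1 - e * x) * (1 - f * x)) * x) / Dx x"
  proof -
    have "jackson_coef a b c d * jackson_term (a * q) b c d (e * q) (f * q) (Suc N) = jackson_coef a b c d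
      * (vw (a * q) (Suc N) * (fr (a * q) b (Suc N) * fr (a * q) c (Suc N) * fr (a * q) d (Suc N)))
      * ((fr (a * q) (e * q) (Suc N) * fr (a * q) (f * q) (Suc N)) * x)"
      by (simp only: jackson_term_def x[symmetric] mult.assoc)
    then show ?thesis
      unfolding well_poised_shift_Suc[OF x] feq V_def by (simp add: mult_ac)
  qed
  have g1: "?g (Suc N) = - (V * (w * (1 - w * w * (b * c * d) * x) * (1 - a * x)
      * ((1 - b * x) * (1 - c * x) * (1 - d * x)) * ((1 - e * x) * (1 - f * x)))) / Dx x"
  proof -
    have "qp (e * q) (Suc N) / qp (a * q / e) (Suc N) * (qp (f * q) (Suc N) / qp (a * q / f) (Suc N))
        = (1 - e * x) * (1 - f * x) * P"
      by (simp add: P_def qp_Suc[of "e * q"] qp_Suc[of "f * q"] x mult_ac)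
    then show ?thesis
      unfolding boundary_Suc[OF x] V_def by (simp only: times_divide_eq_left times_divide_eq_right minus_divide_left mult_ac)
  qed
  have g0: "?g N = - (V * (w * (1 - a * w * x) * (1 - x) * X))"
  proof -
    have 3: "qp (a * q / y) (Suc N) = qp (a * q / y) N * (1 - a * x / y)" for y
      by (simp add: qp_Suc x mult_ac)
    have "1 - a * x / e \<noteq> 0" "1 - a * x / f \<noteq> 0"
      using Ee[of N] Ff[of N] by (simp_all add: x mult_ac)
    then have 4: "qp (e * q) N / qp (a * q / e) N * (qp (f * q) N / qp (a * q / f) N) = X * P"
      unfolding P_def 3 X_def using ef0 by simp
    show ?thesis
      unfolding 4 boundary_eq[OF x] V_def by (simp only: mult_ac)
  qed
  have "Dx x * ((1 - w) * jackson_term a b c d e f (Suc N) - jackson_coef a b c d * jackson_term (a * q) b c d (e * q) (f * q) (Suc N))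
    = V * ((1 - w) * (1 - a * (x * x)) * ((1 - e) * (1 - f)) * x * Dx x
      - ((1 - w * b) * (1 - w * c) * (1 - w * d)) * (1 - w * (b * c * d) * (x * x)) * (1 - a * x) * ((1 - e * x) * (1 - f * x)) * x)"
    unfolding t1 t2 right_diff_distrib[of "Dx x"] right_diff_distrib[of V] using Dx by (simp add: mult_ac)
  also have "\<dots> = V * (- (w * (1 - w * w * (b * c * d) * x) * (1 - a * x) * ((1 - b * x) * (1 - c * x) * (1 - d * x)) * ((1 - e * x) * (1 - f * x))
    - (1 - a * w * x) * (1 - x) * Dx x * (w * X)))"
    unfolding Dx_def jackson_poly[OF ef X] ..
  also have "\<dots> = Dx x * (?g (Suc N) - ?g N)"
    unfolding g1 g0 using Dx by (intro telescope_aux(2)[symmetric]) (auto simp: mult_ac)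
  finally show ?case
    using Suc.IH Dx by simp
qed

end

end

section \<open>Bounds uniform in several indices\<close>

definition bdd :: "('a \<Rightarrow> complex) \<Rightarrow> bool" where
  "bdd f \<longleftrightarrow> (\<exists>C. \<forall>x. norm (f x) \<le> C)"

lemma bddI: "(\<And>x. norm (f x) \<le> C) \<Longrightarrow> bdd f"
  by (auto simp: bdd_def)

lemma bddE:
  assumes "bdd f"
  obtains C where "C > 0" "\<And>x. norm (f x) \<le> C"
proof -
  obtain C where C: "\<And>x. norm (f x) \<le> C"
    using assms by (auto simp: bdd_def)
  show ?thesis
    by (rule that[of "max C 1"]) (use C in \<open>auto simp: le_max_iff_disj\<close>)
qed

lemma bdd_const: "bdd (\<lambda>x. c)"
  by (rule bddI[of _ "norm c"]) simp

lemma bdd_mult: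
  assumes "bdd f" "bdd g"
  shows "bdd (\<lambda>x. f x * g x)"
proof -
  obtain C where C: "C > 0" "\<And>x. norm (f x) \<le> C"
    using bddE[OF assms(1)] by blast
  obtain D where D: "D > 0" "\<And>x. norm (g x) \<le> D"
    using bddE[OF assms(2)] by blast
  from C D show ?thesis
    by (intro bddI[of _ "C * D"]) (simp add: norm_mult mult_mono)
qed

lemma bdd_diff:
  assumes "bdd f" "bdd g"
  shows "bdd (\<lambda>x. f x - g x)"
proof -
  obtain C where C: "\<And>x. norm (f x) \<le> C"
    using bddE[OF assms(1)] by blast
  obtain D where D: "\<And>x. norm (g x) \<le> D"
    using bddE[OF assms(2)] by blast
  from C D show ?thesis
    by (intro bddI[of _ "C + D"]) (meson add_mono norm_triangle_ineq4 order_trans)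
qed

context q_base
begin

lemma bdd_q_power: "bdd (\<lambda>x. q ^ n x)"
  by (rule bddI[of _ 1]) (simp add: norm_power norm_q_power_le_1)

lemma bdd_qp: "bdd (\<lambda>x. qp (c * q ^ m x) (n x))"
  by (rule bddI) (rule norm_qp_le[OF norm_mult_q_power_le[OF order_refl]])

lemma bdd_qp': "bdd (\<lambda>x. qp c (n x))"
  using bdd_qp[of c "\<lambda>_. 0" n] by simp

text \<open>The shifted base is absorbed by
  \<open>1 / qp (c * q ^ m) n = qp c m / qp c (m + n)\<close>, so the lower bound for the fixed base
  \<open>c\<close> suffices.\<close>

lemma bdd_inverse_qp:
  assumes "qP c \<noteq> 0"
  shows "bdd (\<lambda>x. 1 / qp (c * q ^ m x) (n x))"
proof -
  have "1 / qp (c * q ^ m x) (n x) = qp c (m x) * (1 / qp c (m x + n x))" for x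
    using qp_add[of c "m x" "n x"] qp_nz[OF assms] by simp
  moreover have "bdd (\<lambda>x. 1 / qp c (m x + n x))"
    by (rule bddI) (rule norm_inverse_qp_le[OF assms])
  ultimately show ?thesis
    by (simp only: bdd_mult bdd_qp')
qed

lemma bdd_inverse_qp': "qP c \<noteq> 0 \<Longrightarrow> bdd (\<lambda>x. 1 / qp c (n x))"
  using bdd_inverse_qp[of c "\<lambda>_. 0" n] by simp

lemma bdd_fr:
  assumes "qP (a * q / b) \<noteq> 0"
  shows "bdd (\<lambda>x. fr (a * q ^ m x) b (n x))"
proof -
  have *: "fr (a * q ^ m x) b (n x) = qp b (n x) * (1 / qp (a * q / b * q ^ m x) (n x))" for x
    by (simp add: fr_def mult_ac)
  show ?thesis
    unfolding * by (intro bdd_mult bdd_qp' bdd_inverse_qp assms)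
qed

lemma bdd_vw:
  assumes "qP a \<noteq> 0"
  shows "bdd (\<lambda>x. vw (a * q ^ m x) (n x))"
proof -
  have *: "vw (a * q ^ m x) (n x) = (1 - a * q ^ m x * q ^ (2 * n x)) * (1 / qp (a * q ^ m x) 1)
     * (qp (a * q ^ m x) (n x) * (1 / qp q (n x)))" for x
    by (simp add: vw_def qp_Suc)
  show ?thesis
    unfolding *
    by (intro bdd_mult bdd_qp bdd_diff bdd_const bdd_q_power bdd_inverse_qp assms
        bdd_inverse_qp'[OF qP_q_nz])
qed

context
  fixes a b c d w :: complex
  assumes nz: "a \<noteq> 0" "b \<noteq> 0" "c \<noteq> 0" "d \<noteq> 0" and w: "w = a * q / (b * c * d)"
    and qPa: "qP a \<noteq> 0" and qPb: "qP (a * q / b) \<noteq> 0" and qPc: "qP (a * q / c) \<noteq> 0"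
    and qPd: "qP (a * q / d) \<noteq> 0"
begin

lemma shift_nz: "qP (a * q ^ N) \<noteq> 0" "qP (a * q ^ N * q / b) \<noteq> 0"
  "qP (a * q ^ N * q / c) \<noteq> 0" "qP (a * q ^ N * q / d) \<noteq> 0" "a * q ^ N \<noteq> 0" "a * q ^ N \<noteq> 1"
proof -
  have *: "a * q ^ N * q / y = a * q / y * q ^ N" for y by (simp add: mult_ac)
  show "qP (a * q ^ N) \<noteq> 0" "qP (a * q ^ N * q / b) \<noteq> 0"
    "qP (a * q ^ N * q / c) \<noteq> 0" "qP (a * q ^ N * q / d) \<noteq> 0"
    unfolding * by (intro qP_shift_nz qPa qPb qPc qPd)+
  show "a * q ^ N \<noteq> 0"
    using nz q_nz by simp
  show "a * q ^ N \<noteq> 1"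
    using qP_shift_nz[OF qPa, of N] qP_1 by metis
qed

text \<open>The base \<open>a * q ^ N\<close> has the argument \<open>w * q ^ N\<close>, while the
  coefficients are bounded uniformly in both indices. The factor \<open>norm q ^ (N * k)\<close>
  makes every term except the one with \<open>k = 0\<close> disappear as \<open>N\<close>
  grows.\<close>

lemma rogers_term_bound:
  obtains C where "C > 0" "\<And>N k. norm (rogers_term (a * q ^ N) b c d k) \<le> C * (norm w ^ k * norm q ^ (N * k))"
proof -
  define h where "h = (\<lambda>(N, k). vw (a * q ^ N) k * (fr (a * q ^ N) b k * fr (a * q ^ N) c k * fr (a * q ^ N) d k))"
  have "bdd h"
    unfolding h_def case_prod_unfold by (intro bdd_mult bdd_vw bdd_fr qPa qPb qPc qPd)
  from bddE[OF this] obtain C where C: "C > 0" "\<And>x. norm (h x) \<le> C"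
    by blast
  show ?thesis
  proof (rule that[OF C(1)])
    fix N k
    have "rogers_term (a * q ^ N) b c d k = h (N, k) * (w * q ^ N) ^ k"
      by (simp add: rogers_term_def h_def w mult_ac)
    then have "norm (rogers_term (a * q ^ N) b c d k) = norm (h (N, k)) * (norm w ^ k * norm q ^ (N * k))"
      by (simp add: norm_mult norm_power power_mult_distrib power_mult)
    then show "norm (rogers_term (a * q ^ N) b c d k) \<le> C * (norm w ^ k * norm q ^ (N * k))"
      using C(2) by (simp add: mult_right_mono)
  qed
qed

lemma rogers_summable:
  assumes "norm w < 1"
  shows "summable (\<lambda>k. norm (rogers_term (a * q ^ N) b c d k))"
proof -
  obtain C where C: "C > 0" "\<And>N k. norm (rogers_term (a * q ^ N) b c d k) \<le> C * (norm w ^ k * norm q ^ (N * k))"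
    by (rule rogers_term_bound) blast
  show ?thesis
  proof (rule summable_comparison_test'[where N = 0])
    show "summable (\<lambda>k. C * norm w ^ k)"
      using assms by (intro summable_mult summable_geometric) auto
    fix k
    have "C * (norm w ^ k * norm q ^ (N * k)) \<le> C * (norm w ^ k * 1)"
      using C(1) norm_q_power_le_1 by (intro mult_left_mono) auto
    then show "norm (norm (rogers_term (a * q ^ N) b c d k)) \<le> C * norm w ^ k"
      using C(2)[of N k] by simp
  qed
qed

lemma rogers_limit:
  assumes w1: "norm w < 1"
  shows "(\<lambda>N. \<Sum>k. rogers_term (a * q ^ N) b c d k) \<longlonglongrightarrow> 1"
proof -
  obtain C where C: "C > 0" "\<And>N k. norm (rogers_term (a * q ^ N) b c d k) \<le> C * (norm w ^ k * norm q ^ (N * k))"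
    by (rule rogers_term_bound) blast
  have "norm ((\<Sum>k. rogers_term (a * q ^ N) b c d k) - 1) \<le> norm q ^ N * (C * (1 / (1 - norm w)))" for N
  proof -
    have s: "summable (\<lambda>k. norm (rogers_term (a * q ^ N) b c d (Suc k)))"
      using rogers_summable[OF w1, of N] by (subst summable_Suc_iff)
    have "rogers_term (a * q ^ N) b c d 0 = 1"
      by (simp add: rogers_term_def vw_0 shift_nz)
    then have "(\<Sum>k. rogers_term (a * q ^ N) b c d k) - 1 = (\<Sum>k. rogers_term (a * q ^ N) b c d (Suc k))"
      using suminf_split_head[OF summable_norm_cancel[OF rogers_summable[OF w1, of N]]] by simp
    also have "norm \<dots> \<le> (\<Sum>k. norm (rogers_term (a * q ^ N) b c d (Suc k)))"
      by (rule summable_norm[OF s])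
    also have "\<dots> \<le> (\<Sum>k. norm q ^ N * C * norm w ^ k)"
    proof (rule suminf_le[OF _ s])
      show "summable (\<lambda>k. norm q ^ N * C * norm w ^ k)"
        using w1 by (intro summable_mult summable_geometric) auto
      fix k
      have "norm w ^ Suc k * norm q ^ (N * Suc k) \<le> norm w ^ k * norm q ^ N"
        using w1
        by (intro mult_mono power_decreasing) (use norm_q in auto)
      then have "C * (norm w ^ Suc k * norm q ^ (N * Suc k)) \<le> C * (norm w ^ k * norm q ^ N)"
        using C(1) by (intro mult_left_mono) auto
      then show "norm (rogers_term (a * q ^ N) b c d (Suc k)) \<le> norm q ^ N * C * norm w ^ k"
        using C(2)[of N "Suc k"] by (simp only: mult_ac)
    qed
    also have "\<dots> = norm q ^ N * (C * (1 / (1 - norm w)))"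
      using w1 by (subst suminf_mult) (auto intro: summable_geometric simp: suminf_geometric)
    finally show ?thesis .
  qed
  moreover have "(\<lambda>N. norm q ^ N * (C * (1 / (1 - norm w)))) \<longlonglongrightarrow> 0"
    using norm_q by (intro tendsto_mult_left_zero LIMSEQ_power_zero) auto
  ultimately have "(\<lambda>N. (\<Sum>k. rogers_term (a * q ^ N) b c d k) - 1) \<longlonglongrightarrow> 0"
    by (rule Lim_null_comparison[OF always_eventually[OF allI]])
  then show ?thesis
    by (simp add: LIM_zero_iff)
qed

text \<open>The telescoped partial sums are \<open>- w ^ N\<close> times a bounded sequence, hence
  tend to 0.\<close>

lemma rogers_recurrence:
  assumes w1: "norm w < 1"
  shows "(1 - w) * (\<Sum>k. rogers_term a b c d k) = jackson_coef a b c d * (\<Sum>k. rogers_term (a * q) b c d k)"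
proof -
  define g where "g = (\<lambda>N. w * boundary a b c d w N)"
  have tel: "(\<Sum>k\<le>N. (1 - w) * rogers_term a b c d k - jackson_coef a b c d * rogers_term (a * q) b c d k)
      = - (w ^ N * g N)" for N
    unfolding rogers_telescope[OF nz w qPa qPb qPc qPd] g_def ..
  have "bdd (\<lambda>N. fr (a * q ^ 0) y (Suc N))" if "qP (a * q / y) \<noteq> 0" for y
    by (rule bdd_fr[OF that])
  then have fr: "bdd (\<lambda>N. fr a y (Suc N))" if "qP (a * q / y) \<noteq> 0" for y
    using that by simp
  have "bdd g"
    unfolding g_def boundary_def
    by (intro bdd_mult bdd_diff bdd_const bdd_q_power bdd_qp' bdd_inverse_qp' qP_q_nz fr qPb qPc qPd)
  from bddE[OF this] obtain C where C: "\<And>N. norm (g N) \<le> C"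
    by blast
  have lim0: "(\<lambda>N. - (w ^ N * g N)) \<longlonglongrightarrow> 0"
  proof (rule Lim_null_comparison[OF always_eventually])
    show "\<forall>N. norm (- (w ^ N * g N)) \<le> norm w ^ N * C"
      using C by (simp add: norm_mult norm_power mult_left_mono)
    show "(\<lambda>N. norm w ^ N * C) \<longlonglongrightarrow> 0"
      using w1 by (intro tendsto_mult_left_zero LIMSEQ_power_zero) auto
  qed
  have s: "summable (rogers_term a b c d)" "summable (rogers_term (a * q) b c d)"
    using rogers_summable[OF w1, of 0] rogers_summable[OF w1, of 1] by (auto dest: summable_norm_cancel)
  have "(\<lambda>k. (1 - w) * rogers_term a b c d k - jackson_coef a b c d * rogers_term (a * q) b c d k)
      sums ((1 - w) * (\<Sum>k. rogers_term a b c d k) - jackson_coef a b c d * (\<Sum>k. rogers_term (a * q) b c d k))"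
    by (intro sums_diff sums_mult summable_sums s)
  then have "(\<lambda>N. - (w ^ N * g N))
      \<longlonglongrightarrow> (1 - w) * (\<Sum>k. rogers_term a b c d k) - jackson_coef a b c d * (\<Sum>k. rogers_term (a * q) b c d k)"
    unfolding sums_def_le tel .
  from LIMSEQ_unique[OF this lim0] show ?thesis
    by (simp only: right_minus_eq)
qed

end

text \<open>Iterating the recurrence moves the base from \<open>a\<close> to
  \<open>a * q ^ N\<close>, where the sum tends to 1, and the finite products collected on the way
  tend to the infinite ones. All denominators stay on the left during the iteration, so that no
  division occurs before the limit is taken.\<close>

theorem rogers_sum:
  fixes a b c d w :: complex
  assumes nz: "a \<noteq> 0" "b \<noteq> 0" "c \<noteq> 0" "d \<noteq> 0" and w: "w = a * q / (b * c * d)"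
    and qP: "qP a \<noteq> 0" "qP (a * q / b) \<noteq> 0" "qP (a * q / c) \<noteq> 0" "qP (a * q / d) \<noteq> 0"
    and w1: "norm w < 1"
  shows "(\<Sum>k. rogers_term a b c d k) = qP (a * q) * (qP (a * q / (b * c)) * qP (a * q / (b * d)) * qP (a * q / (c * d)))
    / (qP (a * q / b) * qP (a * q / c) * qP (a * q / d) * qP w)"
proof -
  define F where "F = (\<lambda>N. \<Sum>k. rogers_term (a * q ^ N) b c d k)"
  note sh = shift_nz[OF nz w qP]
  have rec: "F N * ((1 - a * q / b * q ^ N) * (1 - a * q / c * q ^ N) * (1 - a * q / d * q ^ N) * (1 - w * q ^ N))
      = (1 - a * q * q ^ N) * ((1 - a * q / (b * c) * q ^ N) * (1 - a * q / (b * d) * q ^ N) * (1 - a * q / (c * d) * q ^ N))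
        * F (Suc N)" for N
  proof -
    have "norm (w * q ^ N) < 1"
      using norm_mult_q_power_le[of w "norm w" N] w1 by simp
    then have *: "(1 - w * q ^ N) * F N = jackson_coef (a * q ^ N) b c d * F (Suc N)"
      using rogers_recurrence[of "a * q ^ N" b c d "w * q ^ N", OF sh(5) nz(2-4) _ sh(1-4)]
      by (simp add: F_def w mult_ac)
    have y: "a * q ^ N * q / y = a * q / y * q ^ N" for y by (simp add: mult_ac)
    have "1 - a * q / b * q ^ N \<noteq> 0" "1 - a * q / c * q ^ N \<noteq> 0" "1 - a * q / d * q ^ N \<noteq> 0"
      using qp_nz[OF sh(2)[of N], of 1] qp_nz[OF sh(3)[of N], of 1] qp_nz[OF sh(4)[of N], of 1] by (simp_all add: qp_Suc y)
    then have P: "(1 - a * q / b * q ^ N) * (1 - a * q / c * q ^ N) * (1 - a * q / d * q ^ N) \<noteq> 0"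
      by (intro no_zero_divisors)
    have J: "jackson_coef (a * q ^ N) b c d * ((1 - a * q / b * q ^ N) * (1 - a * q / c * q ^ N) * (1 - a * q / d * q ^ N))
       = (1 - a * q * q ^ N) * ((1 - a * q / (b * c) * q ^ N) * (1 - a * q / (b * d) * q ^ N) * (1 - a * q / (c * d) * q ^ N))"
    proof (rule nonzero_eq_divide_eq[THEN iffD1, OF P])
      have aq: "a * q ^ N * q = a * q * q ^ N" by simp
      show "jackson_coef (a * q ^ N) b c d = (1 - a * q * q ^ N) * ((1 - a * q / (b * c) * q ^ N)
        * (1 - a * q / (b * d) * q ^ N) * (1 - a * q / (c * d) * q ^ N)) / ((1 - a * q / b * q ^ N) * (1 - a * q / c * q ^ N) * (1 - a * q / d * q ^ N))"
        unfolding jackson_coef_def y by (simp only: aq)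
    qed
    have "F N * ((1 - a * q / b * q ^ N) * (1 - a * q / c * q ^ N) * (1 - a * q / d * q ^ N) * (1 - w * q ^ N))
      = (1 - w * q ^ N) * F N * ((1 - a * q / b * q ^ N) * (1 - a * q / c * q ^ N) * (1 - a * q / d * q ^ N))"
      by (simp only: mult_ac)
    also have "\<dots> = jackson_coef (a * q ^ N) b c d * ((1 - a * q / b * q ^ N) * (1 - a * q / c * q ^ N) * (1 - a * q / d * q ^ N)) * F (Suc N)"
      unfolding * by (simp only: mult_ac)
    finally show ?thesis
      unfolding J .
  qed
  have "F 0 * (qp (a * q / b) N * qp (a * q / c) N * qp (a * q / d) N * qp w N)
      = qp (a * q) N * (qp (a * q / (b * c)) N * qp (a * q / (b * d)) N * qp (a * q / (c * d)) N) * F N" for N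
  proof (induction N)
    case (Suc N)
    have "F 0 * (qp (a * q / b) (Suc N) * qp (a * q / c) (Suc N) * qp (a * q / d) (Suc N) * qp w (Suc N))
      = F 0 * (qp (a * q / b) N * qp (a * q / c) N * qp (a * q / d) N * qp w N) *
        ((1 - a * q / b * q ^ N) * (1 - a * q / c * q ^ N) * (1 - a * q / d * q ^ N) * (1 - w * q ^ N))"
      by (simp only: qp_Suc mult_ac)
    also have "\<dots> = qp (a * q) N * (qp (a * q / (b * c)) N * qp (a * q / (b * d)) N * qp (a * q / (c * d)) N) *
       (F N * ((1 - a * q / b * q ^ N) * (1 - a * q / c * q ^ N) * (1 - a * q / d * q ^ N) * (1 - w * q ^ N)))"
      unfolding Suc.IH by (simp only: mult.assoc)
    also have "\<dots> = qp (a * q) (Suc N) * (qp (a * q / (b * c)) (Suc N) * qp (a * q / (b * d)) (Suc N)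
        * qp (a * q / (c * d)) (Suc N)) * F (Suc N)"
      unfolding rec by (simp only: qp_Suc mult_ac)
    finally show ?case .
  qed simp
  note iter = this
  have lim1: "(\<lambda>N. F 0 * (qp (a * q / b) N * qp (a * q / c) N * qp (a * q / d) N * qp w N))
      \<longlonglongrightarrow> F 0 * (qP (a * q / b) * qP (a * q / c) * qP (a * q / d) * qP w)"
    by (intro tendsto_intros qP_LIMSEQ)
  have lim2: "(\<lambda>N. qp (a * q) N * (qp (a * q / (b * c)) N * qp (a * q / (b * d)) N * qp (a * q / (c * d)) N) * F N)
      \<longlonglongrightarrow> qP (a * q) * (qP (a * q / (b * c)) * qP (a * q / (b * d)) * qP (a * q / (c * d))) * 1"
    unfolding F_def by (intro tendsto_intros qP_LIMSEQ rogers_limit[OF nz w qP w1])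
  have eq: "F 0 * (qP (a * q / b) * qP (a * q / c) * qP (a * q / d) * qP w)
      = qP (a * q) * (qP (a * q / (b * c)) * qP (a * q / (b * d)) * qP (a * q / (c * d)))"
    using LIMSEQ_unique[OF lim1[unfolded iter] lim2] by (simp only: mult_1_right)
  have "qP w \<noteq> 0"
  proof
    assume "qP w = 0"
    then obtain i where "w * q ^ i = 1" by (auto simp: qP_zero_iff)
    then show False
      using norm_mult_q_power_le[of w "norm w" i] w1 by simp
  qed
  with qP have "qP (a * q / b) * qP (a * q / c) * qP (a * q / d) * qP w \<noteq> 0"
    by (intro no_zero_divisors)
  then have "F 0 = qP (a * q) * (qP (a * q / (b * c)) * qP (a * q / (b * d)) * qP (a * q / (c * d)))
    / (qP (a * q / b) * qP (a * q / c) * qP (a * q / d) * qP w)"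
    by (rule nonzero_eq_divide_eq[THEN iffD2, OF _ eq])
  then show ?thesis
    by (simp add: F_def)
qed

lemma \<theta>_q_powi [simp]: "\<theta> (q powi j) = 0"
proof -
  obtain u where "\<And>y. y \<noteq> 0 \<Longrightarrow> \<theta> (q powi j * y) = u * y powi (- j) * \<theta> y"
    using \<theta>_quasi by (metis zero_neq_one)
  from this[of 1] show ?thesis by simp
qed

text \<open>Passing from \<open>a\<close> to \<open>a * q\<close> turns the terminating parameter
  \<open>1 / q ^ Suc n\<close> into \<open>1 / q ^ n\<close>, so the telescoped relation is a
  recurrence in \<open>n\<close>. The condition on \<open>\<theta> w\<close> is invariant under
  \<open>w\<close> to \<open>w * q\<close>; it keeps the denominators of the parameter
  \<open>e = a * w * q ^ n\<close> nonzero, because \<open>a * q / e\<close> is \<open>1 / w\<close>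
  times a power of \<open>q\<close>.\<close>

theorem jackson_sum:
  fixes a b c d w :: complex
  assumes nz: "a \<noteq> 0" "b \<noteq> 0" "c \<noteq> 0" "d \<noteq> 0" and w: "w = a * q / (b * c * d)"
    and qP: "qP a \<noteq> 0" "qP (a * q / b) \<noteq> 0" "qP (a * q / c) \<noteq> 0" "qP (a * q / d) \<noteq> 0"
    and tw: "\<theta> w \<noteq> 0"
  shows "(\<Sum>k\<le>n. jackson_term a b c d (a * w * q ^ n) (1 / q ^ n) k)
    = qp (a * q) n * (qp (a * q / (b * c)) n * qp (a * q / (b * d)) n * qp (a * q / (c * d)) n)
      / (qp (a * q / b) n * qp (a * q / c) n * qp (a * q / d) n * qp w n)"
  using nz(1) w qP tw
proof (induction n arbitrary: a w)
  case 0
  have "a \<noteq> 1" using qP_1 0 by metis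
  then show ?case
    by (simp add: jackson_term_def vw_0)
next
  case (Suc n)
  define e f where "e = a * w * q ^ Suc n" and "f = 1 / q ^ Suc n"
  have w0: "w \<noteq> 0" using Suc.prems nz q_nz by simp
  note sh = shift_nz[OF Suc.prems(1) nz(2-4) Suc.prems(2-6), of 1, simplified]
  have "e * f = a * w" "e \<noteq> 0" "f \<noteq> 0"
    using w0 q_nz Suc.prems(1) by (simp_all add: e_def f_def)
  note tel = jackson_telescope[OF Suc.prems(1) nz(2-4) Suc.prems(2-6) this, of "Suc n"]
  have "a * q / e * q ^ k \<noteq> 1" for k
  proof
    assume *: "a * q / e * q ^ k = 1"
    have "w = q powi (int k - int n)"
      using * Suc.prems(1) w0 q_nz
      by (simp add: e_def power_int_diff field_simps)
    then show False using \<open>\<theta> w \<noteq> 0\<close> by simp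
  qed
  moreover have "a * q / f * q ^ k \<noteq> 1" for k
  proof
    assume "a * q / f * q ^ k = 1"
    then have "a * q ^ (Suc (Suc n) + k) = 1"
      by (simp add: f_def power_add mult_ac)
    then show False
      using Suc.prems(3) qP_zero_iff by blast
  qed
  moreover have fq: "f * q = 1 / q ^ n" "e * q = (a * q) * (w * q) * q ^ n"
    using q_nz by (simp_all add: f_def e_def)
  \<comment> \<open>The last factor is \<open>1 - 1\<close>. It kills the boundary value at
    \<open>Suc n\<close> and also the last term of the shifted sum, which therefore ends at
    \<open>n\<close>.\<close>
  have z: "qp (f * q) (Suc n) = 0"
    using q_nz by (simp add: qp_Suc fq)
  moreover have "jackson_term (a * q) b c d (e * q) (f * q) (Suc n) = 0"
    by (simp add: jackson_term_def fr_def z)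
  ultimately have "(1 - w) * (\<Sum>k\<le>Suc n. jackson_term a b c d e f k)
      = jackson_coef a b c d * (\<Sum>k\<le>n. jackson_term (a * q) b c d (e * q) (f * q) k)"
    using tel by (simp only: sum_subtractf sum_distrib_left[symmetric]) (simp add: z)
  also have "(\<Sum>k\<le>n. jackson_term (a * q) b c d (e * q) (f * q) k) =
     qp (a * q * q) n * (qp (a * q * q / (b * c)) n * qp (a * q * q / (b * d)) n * qp (a * q * q / (c * d)) n)
      / (qp (a * q * q / b) n * qp (a * q * q / c) n * qp (a * q * q / d) n * qp (w * q) n)"
    unfolding fq
  proof (rule Suc.IH)
    show "\<theta> (w * q) \<noteq> 0"
      using \<theta>_q[OF w0] Suc.prems(7) w0 by (simp add: mult.commute)
    show "w * q = a * q * q / (b * c * d)"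
      by (simp add: Suc.prems(2))
  qed (use sh in auto)
  finally have eq: "(1 - w) * (\<Sum>k\<le>Suc n. jackson_term a b c d e f k) = jackson_coef a b c d * \<dots>" .
  have S: "qp (a * q / y) (Suc n) = (1 - a * q / y) * qp (a * q * q / y) n" for y
    by (simp add: qp_Suc_left)
  have "1 - w \<noteq> 0" using \<open>\<theta> w \<noteq> 0\<close> \<theta>_1 by auto
  then have "(\<Sum>k\<le>Suc n. jackson_term a b c d e f k) = (1 - w) * (\<Sum>k\<le>Suc n. jackson_term a b c d e f k) / (1 - w)"
    by simp
  then show ?case
    unfolding eq S e_def[symmetric] f_def[symmetric] qp_Suc_left[of "a * q"] qp_Suc_left[of w] jackson_coef_def
    by (simp only: times_divide_eq_left times_divide_eq_right divide_divide_eq_left mult_ac)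
qed

end

section \<open>Bailey's two-term transformation\<close>

lemma infsum_eq_suminf:
  fixes f :: "nat \<Rightarrow> 'a :: banach"
  assumes "summable (\<lambda>n. norm (f n))"
  shows "infsum f UNIV = suminf f"
  using norm_summable_imp_has_sum[OF assms summable_sums[OF summable_norm_cancel[OF assms]]]
  by (rule infsumI)

lemma abs_summable_on_double_geometric:
  fixes X :: "nat \<times> nat \<Rightarrow> complex"
  assumes "\<And>j m. norm (X (j, m)) \<le> C * (s ^ j * r ^ m)" "0 \<le> s" "s < 1" "0 \<le> r" "r < 1"
  shows "X summable_on UNIV \<times> UNIV"
proof -
  have C: "C \<ge> 0"
    using order_trans[OF norm_ge_zero assms(1)[of 0 0]] by simp
  have geo: "((\<lambda>n. t ^ n) has_sum 1 / (1 - t)) UNIV" if "0 \<le> t" "t < 1" for t :: real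
  proof (rule norm_summable_imp_has_sum)
    show "summable (\<lambda>n. norm (t ^ n))" "(\<lambda>n. t ^ n) sums (1 / (1 - t))"
      using that by (auto simp: norm_power intro: summable_geometric geometric_sums)
  qed
  have "(\<lambda>(j, m). C * (s ^ j * r ^ m)) summable_on UNIV \<times> UNIV"
  proof (rule summable_on_SigmaI[where g = "\<lambda>j. C * (s ^ j * (1 / (1 - r)))"])
    show "((\<lambda>m. case (j, m) of (j, m) \<Rightarrow> C * (s ^ j * r ^ m)) has_sum C * (s ^ j * (1 / (1 - r)))) UNIV" for j
      using has_sum_cmult_right[OF has_sum_cmult_right[OF geo[OF assms(4,5)], of "s ^ j"], of C] by simp
    show "(\<lambda>j. C * (s ^ j * (1 / (1 - r)))) summable_on UNIV"
      using has_sum_cmult_right[OF has_sum_cmult_left[OF geo[OF assms(2,3)], of "1 / (1 - r)"], of C]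
      by (auto simp: summable_on_def)
    show "0 \<le> (case (j, m) of (j, m) \<Rightarrow> C * (s ^ j * r ^ m))" for j m
      using C assms by simp
  qed
  then have "(\<lambda>x. norm (case x of (j, m) \<Rightarrow> C * (s ^ j * r ^ m))) summable_on UNIV \<times> UNIV"
    using C assms by (simp add: case_prod_unfold abs_mult)
  then have "(\<lambda>x. norm (X x)) summable_on UNIV \<times> UNIV"
  proof (rule Infinite_Sum.abs_summable_on_comparison_test)
    fix x :: "nat \<times> nat"
    obtain j m where x: "x = (j, m)" by (cases x)
    have "0 \<le> C * (s ^ j * r ^ m)"
      using C assms by simp
    then show "norm (X x) \<le> norm (case x of (j, m) \<Rightarrow> C * (s ^ j * r ^ m))"
      using assms(1)[of j m] by (simp add: x)
  qed
  then show ?thesis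
    by (rule abs_summable_summable)
qed

lemma infsum_triangle:
  fixes X :: "nat \<times> nat \<Rightarrow> complex"
  assumes "X summable_on UNIV \<times> UNIV"
  shows "infsum (\<lambda>n. \<Sum>j\<le>n. X (j, n - j)) UNIV = infsum (\<lambda>j. infsum (\<lambda>m. X (j, m)) UNIV) UNIV"
proof -
  define g where "g = (\<lambda>(n, j). (j, n - j :: nat))"
  have bij: "bij_betw g (Sigma UNIV (\<lambda>n. {..n})) (UNIV \<times> UNIV)"
    by (rule bij_betw_byWitness[where f' = "\<lambda>(j, m). (j + m, j)"]) (auto simp: g_def)
  have s: "(\<lambda>x. X (g x)) summable_on Sigma UNIV (\<lambda>n. {..n})"
    using assms by (subst summable_on_reindex_bij_betw[OF bij])
  have "infsum (\<lambda>j. infsum (\<lambda>m. X (j, m)) UNIV) UNIV = infsum X (UNIV \<times> UNIV)"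
    by (rule infsum_Sigma_banach[OF assms])
  also have "\<dots> = infsum (\<lambda>x. X (g x)) (Sigma UNIV (\<lambda>n. {..n}))"
    by (rule infsum_reindex_bij_betw[OF bij, symmetric])
  also have "\<dots> = infsum (\<lambda>n. infsum (\<lambda>j. X (g (n, j))) {..n}) UNIV"
    by (rule infsum_Sigma_banach[OF s, symmetric])
  also have "\<dots> = infsum (\<lambda>n. \<Sum>j\<le>n. X (j, n - j)) UNIV"
    by (simp add: g_def)
  finally show ?thesis ..
qed

context q_base
begin

definition w8_term where
  "w8_term a b c d e f k = vw a k * (fr a b k * fr a c k * fr a d k) * (fr a e k * fr a f k)
     * (a\<^sup>2 * q\<^sup>2 / (b * c * d * e * f)) ^ k"

text \<open>The factors are taken in reverse order and a monomial is split off from each. The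
  resulting product of powers of \<open>q\<close> does not involve \<open>x\<close>, so it cancels
  in the ratio of two such expressions.\<close>

lemma qp_reflect:
  assumes "x \<noteq> 0"
  shows "qp (x * q ^ m) j = (- x) ^ j * (\<Prod>i<j. q ^ (j + m - Suc i)) * qp (q / (x * q ^ (j + m))) j"
proof -
  have "qp (x * q ^ m) j = (\<Prod>i<j. 1 - x * q ^ m * q ^ (j - Suc i))"
    unfolding qp_def by (rule prod.nat_diff_reindex[symmetric])
  also have "\<dots> = (\<Prod>i<j. (- x) * q ^ (j + m - Suc i) * (1 - q / (x * q ^ (j + m)) * q ^ i))"
  proof (rule prod.cong[OF refl])
    fix i assume i: "i \<in> {..<j}"
    then have 1: "q ^ (j + m) = q ^ (j + m - Suc i) * (q * q ^ i)"
      by (simp flip: power_add power_Suc)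
    have 2: "q ^ m * q ^ (j - Suc i) = q ^ (j + m - Suc i)"
      using i by (simp add: add.commute[of m j] flip: power_add)
    have "q / (x * q ^ (j + m)) * q ^ i = 1 / (x * q ^ (j + m - Suc i))"
      unfolding 1 using q_nz assms by simp
    then have "(- x) * q ^ (j + m - Suc i) * (1 - q / (x * q ^ (j + m)) * q ^ i) = 1 - x * q ^ (j + m - Suc i)"
      using q_nz assms by (simp add: right_diff_distrib)
    then show "1 - x * q ^ m * q ^ (j - Suc i)
        = (- x) * q ^ (j + m - Suc i) * (1 - q / (x * q ^ (j + m)) * q ^ i)"
      by (simp add: mult.assoc 2)
  qed
  also have "\<dots> = (- x) ^ j * (\<Prod>i<j. q ^ (j + m - Suc i)) * qp (q / (x * q ^ (j + m))) j"
    unfolding qp_def prod.distrib by simp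
  finally show ?thesis .
qed

context
  fixes a b c d e f l z z' :: complex
  assumes nz: "a \<noteq> 0" "b \<noteq> 0" "c \<noteq> 0" "d \<noteq> 0" "e \<noteq> 0" "f \<noteq> 0"
    and l: "l = q * a\<^sup>2 / (b * c * d)"
    and z: "z = l * q / (e * f)" and z': "z' = a * q / (e * f)"
    and z1: "norm z < 1" and z1': "norm z' < 1"
    and qPa: "qP a \<noteq> 0" and qPbcd: "qP (a * q / b) \<noteq> 0" "qP (a * q / c) \<noteq> 0" "qP (a * q / d) \<noteq> 0"
    and qPef: "qP (a * q / e) \<noteq> 0" "qP (a * q / f) \<noteq> 0"
    and qPl: "qP l \<noteq> 0" and qPlef: "qP (l * q / e) \<noteq> 0" "qP (l * q / f) \<noteq> 0"
    and tl: "\<theta> (a / l) \<noteq> 0"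
begin

private lemma l_nz: "l \<noteq> 0" "1 - l \<noteq> 0" "qP (l * q) \<noteq> 0" "qP (a * q) \<noteq> 0" "qP (a / l) \<noteq> 0"
  "1 - a * q ^ n \<noteq> 0" "1 - a \<noteq> 0"
  using nz q_nz qP_shift_nz[OF qPl, of 1] qP_shift_nz[OF qPa, of 1] tl qp_nz[OF qPl, of 1]
    qp_nz[OF qPa, of "Suc n"] qp_nz[OF qPa, of 1]
  by (auto simp: l \<theta>_def qp_Suc)

private lemma lows: "l * q / (l * b / a) = a * q / b" "l * q / (l * c / a) = a * q / c"
    "l * q / (l * d / a) = a * q / d"
  using l_nz nz by simp_all

text \<open>Summing \<open>X (j, m)\<close> over \<open>m\<close> is Rogers' sum and gives the series with base \<open>l\<close>; summing it over
  \<open>j + m = n\<close> is Jackson's sum and gives the series with base \<open>a\<close>.\<close>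

private definition Y where
  "Y j = vw l j * (fr l (l * b / a) j * fr l (l * c / a) j * fr l (l * d / a) j)
     * ((qp e j * (1 / qp (a * q / e) j)) * (qp f j * (1 / qp (a * q / f) j)))
     * (qp (a * q) (2 * j) * (1 / qp (l * q) (2 * j)))"

private definition X where
  "X = (\<lambda>(j, m). Y j * z' ^ j * rogers_term (a * q ^ (2 * j)) (e * q ^ j) (f * q ^ j) (a / l) m)"

text \<open>The coefficient of \<open>z' ^ j * z ^ m\<close> is bounded in both indices, so the two
  convergence conditions give a product of geometric series as majorant.\<close>

private lemma X_bound: "X summable_on UNIV \<times> UNIV"
proof -
  define h where "h = (\<lambda>x. Y (fst x) * (vw (a * q ^ (2 * fst x)) (snd x)
      * (qp (e * q ^ fst x) (snd x) * (1 / qp (a * q / e * q ^ fst x) (snd x))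
      * (qp (f * q ^ fst x) (snd x) * (1 / qp (a * q / f * q ^ fst x) (snd x)))
      * fr (a * q ^ (2 * fst x)) (a / l) (snd x))))"
  have fr0: "bdd (\<lambda>x. fr y u (n x))" if "qP (y * q / u) \<noteq> 0" for y u and n :: "'x \<Rightarrow> nat"
    using bdd_fr[OF that, of "\<lambda>_. 0" n] by simp
  have vw0: "bdd (\<lambda>x. vw l (n x))" for n :: "'x \<Rightarrow> nat"
    using bdd_vw[OF qPl, of "\<lambda>_. 0" n] by simp
  have al: "qP (a * q / (a / l)) \<noteq> 0"
    using l_nz nz by (simp add: mult.commute)
  have "bdd h"
    unfolding h_def Y_def
    by (intro bdd_mult vw0 bdd_vw bdd_fr fr0 bdd_qp bdd_qp' bdd_inverse_qp bdd_inverse_qp' qPa qPef l_nz al)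
       (simp_all only: lows qPbcd not_False_eq_True)
  from bddE[OF this] obtain C where C: "C > 0" "\<And>x. norm (h x) \<le> C"
    by blast
  have "X (j, m) = h (j, m) * (z' ^ j * z ^ m)" for j m
  proof -
    have 1: "a * q ^ (2 * j) * q / (u * q ^ j) = a * q / u * q ^ j" for u
      using q_nz by (simp add: mult_2 power_add)
    have 2: "a * q ^ (2 * j) * q / ((e * q ^ j) * (f * q ^ j) * (a / l)) = z"
      using q_nz nz l_nz by (simp add: z mult_2 power_add)
    show ?thesis
      unfolding X_def h_def rogers_term_def 2 prod.case fst_conv snd_conv fr_def 1 by (simp add: mult_ac)
  qed
  then have "norm (X (j, m)) \<le> C * (norm z' ^ j * norm z ^ m)" for j m
    using C(2)[of "(j, m)"] by (simp add: norm_mult norm_power mult_right_mono)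
  then show ?thesis
    by (rule abs_summable_on_double_geometric) (use z1 z1' in auto)
qed

text \<open>Passage from \<open>(j, m)\<close> to \<open>(j, n)\<close> with
  \<open>n = j + m\<close>. The factors of length \<open>2 * j\<close> recombine through \<open>qp y
  n * qp (y * q ^ n) j = qp y (2 * j) * qp (y * q ^ (2 * j)) m\<close>; reflecting the factors of
  length \<open>m\<close> creates the terminating parameter \<open>1 / q ^ n\<close>.\<close>

private lemma X_eq:
  "X (j, m) = vw a (j + m) * (fr a e (j + m) * fr a f (j + m)) * z ^ (j + m)
     * (qp (a / l) (j + m) / qp (l * q) (j + m))
     * jackson_term l (l * b / a) (l * c / a) (l * d / a) (a * q ^ (j + m)) (1 / q ^ (j + m)) j"
proof -
  define n where "n = j + m"
  define R where "R = (\<Prod>i<j. q ^ (j + m - Suc i))"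
  have R: "R \<noteq> 0" using q_nz by (simp add: R_def)
  have al: "a / l \<noteq> 0" using nz l_nz by simp
  have r1: "qp (a / l * q ^ m) j = (- (a / l)) ^ j * R * qp (l * q / (a * q ^ n)) j"
    using qp_reflect[OF al, of m j] by (simp add: R_def n_def mult.commute)
  have r2: "qp (q * q ^ m) j = (- q) ^ j * R * qp (1 / q ^ n) j"
    using qp_reflect[OF q_nz, of m j] q_nz by (simp add: R_def n_def)
  have pos: "qp (a / l * q ^ m) j \<noteq> 0" "qp (q * q ^ m) j \<noteq> 0" "qp (a / l) m \<noteq> 0" "qp q m \<noteq> 0"
    "qp (l * q) (2 * j) \<noteq> 0" "qp (l * q * q ^ (2 * j)) m \<noteq> 0"
    "qp (a * q / e) j \<noteq> 0" "qp (a * q / f) j \<noteq> 0" "qp (a * q / e * q ^ j) m \<noteq> 0" "qp (a * q / f * q ^ j) m \<noteq> 0"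
    by (intro qp_nz qP_shift_nz l_nz qP_q_nz qPef)+
  have nj: "qp y n = qp y j * qp (y * q ^ j) m" "qp y n = qp y m * qp (y * q ^ m) j" for y
    using qp_add[of y j m] qp_add[of y m j] by (simp_all only: n_def add.commute[of m j])
  have n2: "qp y n * qp (y * q ^ n) j = qp y (2 * j) * qp (y * q ^ (2 * j)) m" for y
    by (simp flip: qp_add) (simp add: n_def add_ac mult_2)
  have A: "(1 - a * q ^ (2 * n)) / (1 - a) * (qp a n * qp (a * q ^ n) j)
     = qp (a * q) (2 * j) * ((1 - a * q ^ (2 * j) * q ^ (2 * m)) / (1 - a * q ^ (2 * j)) * qp (a * q ^ (2 * j)) m)"
  proof -
    have "qp a (2 * j) * (1 - a * q ^ (2 * j)) = (1 - a) * qp (a * q) (2 * j)"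
      by (metis qp_Suc qp_Suc_left)
    then have 1: "qp a (2 * j) / (1 - a) = qp (a * q) (2 * j) / (1 - a * q ^ (2 * j))"
      using l_nz(6)[of "2 * j"] l_nz(7) by (simp add: field_simps)
    have 2: "q ^ (2 * n) = q ^ (2 * j) * q ^ (2 * m)"
      by (simp add: n_def power_add distrib_left)
    have 3: "x / (1 - a) * (qp a (2 * j) * M) = x * (qp a (2 * j) / (1 - a)) * M" for x M
      by simp
    show ?thesis
      unfolding n2 3 1 2 by (simp add: mult_ac)
  qed
  have B: "qp (a / l) n / qp q n * (qp (1 / q ^ n) j / qp (l * q / (a * q ^ n)) j) * q ^ j
     = (a / l) ^ j * (qp (a / l) m / qp q m)"
  proof -
    have aux: "M1 * W / (M2 * Q) * ((Q / (s * u * R)) / (W / (s * v * R))) * u = v * (M1 / M2)"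
      if "W \<noteq> 0" "Q \<noteq> 0" "s \<noteq> 0" "u \<noteq> 0" "M2 \<noteq> 0" for M1 M2 W Q s u v :: complex
      using that R by simp
    have minus: "(- y) ^ j = (- 1) ^ j * y ^ j" for y :: complex
      by (simp flip: power_mult_distrib)
    have "qp (1 / q ^ n) j = qp (q * q ^ m) j / ((- 1) ^ j * q ^ j * R)"
      unfolding r2 minus[of q] using R q_nz by simp
    moreover have "qp (l * q / (a * q ^ n)) j = qp (a / l * q ^ m) j / ((- 1) ^ j * (a / l) ^ j * R)"
      unfolding r1 minus[of "a / l"] using R al by simp
    ultimately show ?thesis
      unfolding nj(2) using aux[OF pos(1,2) _ _ pos(4)] q_nz by simp
  qed
  have Cc: "1 / (qp (l * q) n * qp (l * q * q ^ n) j) = 1 / qp (l * q) (2 * j) * (1 / qp (l * q * q ^ (2 * j)) m)"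
    unfolding n2 by simp
  have E: "fr a u n = qp u j * (1 / qp (a * q / u) j) * (qp (u * q ^ j) m * (1 / qp (a * q / u * q ^ j) m))" for u
    unfolding fr_def nj(1) by simp
  have "vw a n * (fr a e n * fr a f n) * z ^ n * (qp (a / l) n / qp (l * q) n)
     * jackson_term l (l * b / a) (l * c / a) (l * d / a) (a * q ^ n) (1 / q ^ n) j
    = vw l j * (fr l (l * b / a) j * fr l (l * c / a) j * fr l (l * d / a) j)
     * ((1 - a * q ^ (2 * n)) / (1 - a) * (qp a n * qp (a * q ^ n) j))
     * (qp (a / l) n / qp q n * (qp (1 / q ^ n) j / qp (l * q / (a * q ^ n)) j) * q ^ j)
     * (1 / (qp (l * q) n * qp (l * q * q ^ n) j)) * (fr a e n * fr a f n) * z ^ n"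
    by (simp add: jackson_term_def vw_def[of a] fr_def[of l "a * q ^ n"] fr_def[of l "1 / q ^ n"] mult_ac)
  also have "\<dots> = Y j * ((a / l) ^ j * z ^ n) *
     ((1 - a * q ^ (2 * j) * q ^ (2 * m)) / (1 - a * q ^ (2 * j)) * (qp (a * q ^ (2 * j)) m / qp q m)
      * (qp (e * q ^ j) m * (1 / qp (a * q / e * q ^ j) m) * (qp (f * q ^ j) m * (1 / qp (a * q / f * q ^ j) m))
      * (qp (a / l) m * (1 / qp (l * q * q ^ (2 * j)) m))))"
    unfolding A B Cc E Y_def by (simp add: mult_ac)
  also have "(a / l) ^ j * z ^ n = z' ^ j * z ^ m"
    using l_nz by (simp add: n_def power_add z z' power_mult_distrib power_divide)
  finally show ?thesis
  proof -
    assume *: "vw a n * (fr a e n * fr a f n) * z ^ n * (qp (a / l) n / qp (l * q) n)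
     * jackson_term l (l * b / a) (l * c / a) (l * d / a) (a * q ^ n) (1 / q ^ n) j
     = Y j * (z' ^ j * z ^ m) *
     ((1 - a * q ^ (2 * j) * q ^ (2 * m)) / (1 - a * q ^ (2 * j)) * (qp (a * q ^ (2 * j)) m / qp q m)
      * (qp (e * q ^ j) m * (1 / qp (a * q / e * q ^ j) m) * (qp (f * q ^ j) m * (1 / qp (a * q / f * q ^ j) m))
      * (qp (a / l) m * (1 / qp (l * q * q ^ (2 * j)) m))))"
    have 1: "a * q ^ (2 * j) * q / (u * q ^ j) = a * q / u * q ^ j" for u
      using q_nz by (simp add: mult_2 power_add)
    have 2: "a * q ^ (2 * j) * q / ((e * q ^ j) * (f * q ^ j) * (a / l)) = z"
      using q_nz nz l_nz by (simp add: z mult_2 power_add)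
    have 3: "a * q ^ (2 * j) * q / (a / l) = l * q * q ^ (2 * j)"
      using nz by simp
    show ?thesis
      unfolding n_def[symmetric] * X_def
      by (simp only: prod.case rogers_term_def 2 fr_def 1 3 vw_def) (simp add: mult_ac)
  qed
qed

lemma w8_split:
  "w8_term a b c d e f n = (\<Sum>j\<le>n. X (j, n - j))"
proof -
  \<comment> \<open>For the base \<open>l\<close> and these three parameters the \<open>w\<close> of
    Jackson's sum is \<open>a / l\<close>; its parameter \<open>l * w * q ^ n\<close> is then
    \<open>a * q ^ n\<close>, as in \<open>X_eq\<close>.\<close>
  have w: "a / l = l * q / (l * b / a * (l * c / a) * (l * d / a))"
    using nz q_nz by (simp add: l field_simps power2_eq_square)
  have p: "l * q / (l * b / a * (l * c / a)) = d" "l * q / (l * b / a * (l * d / a)) = c"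
    "l * q / (l * c / a * (l * d / a)) = b"
    using nz q_nz by (simp_all add: l field_simps power2_eq_square)
  have J: "(\<Sum>k\<le>n. jackson_term l (l * b / a) (l * c / a) (l * d / a) (a * q ^ n) (1 / q ^ n) k)
    = qp (l * q) n * (qp d n * qp c n * qp b n)
      / (qp (a * q / b) n * qp (a * q / c) n * qp (a * q / d) n * qp (a / l) n)"
  proof -
    have nz': "l * b / a \<noteq> 0" "l * c / a \<noteq> 0" "l * d / a \<noteq> 0"
      using nz l_nz by simp_all
    have "l * (a / l) = a" using l_nz by simp
    then show ?thesis
      using jackson_sum[OF l_nz(1) nz' w qPl, unfolded lows p, OF qPbcd tl, of n] by simp
  qed
  have "(\<Sum>j\<le>n. X (j, n - j)) = (\<Sum>j\<le>n. vw a n * (fr a e n * fr a f n) * z ^ n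
     * (qp (a / l) n / qp (l * q) n)
     * jackson_term l (l * b / a) (l * c / a) (l * d / a) (a * q ^ n) (1 / q ^ n) j)"
    by (intro sum.cong) (auto simp: X_eq)
  also have "\<dots> = vw a n * (fr a e n * fr a f n) * z ^ n * (qp (a / l) n / qp (l * q) n)
     * (qp (l * q) n * (qp d n * qp c n * qp b n)
      / (qp (a * q / b) n * qp (a * q / c) n * qp (a * q / d) n * qp (a / l) n))"
    unfolding J[symmetric] by (rule sum_distrib_left[symmetric])
  also have "\<dots> = vw a n * (fr a e n * fr a f n) * z ^ n * (fr a b n * fr a c n * fr a d n)"
    using qp_nz[OF l_nz(3), of n] qp_nz[OF l_nz(5), of n] by (simp add: fr_def mult_ac)
  also have "z = a\<^sup>2 * q\<^sup>2 / (b * c * d * e * f)"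
    by (simp add: z l power2_eq_square mult_ac)
  finally show ?thesis
    by (simp add: w8_term_def)
qed

theorem bailey_two_term:
  "infsum (w8_term a b c d e f) UNIV =
     qP (a * q) * qP (a * q / (e * f)) * (qP (l * q / e) * qP (l * q / f))
     / (qP (a * q / e) * qP (a * q / f) * qP (l * q) * qP (l * q / (e * f)))
     * infsum (w8_term l (l * b / a) (l * c / a) (l * d / a) e f) UNIV"
proof -
  have "infsum (w8_term a b c d e f) UNIV = infsum (\<lambda>j. infsum (\<lambda>m. X (j, m)) UNIV) UNIV"
    using infsum_triangle[OF X_bound] by (simp add: w8_split[abs_def])
  also have "(\<lambda>j. infsum (\<lambda>m. X (j, m)) UNIV) = (\<lambda>j.
     qP (a * q) * qP (a * q / (e * f)) * (qP (l * q / e) * qP (l * q / f))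
     / (qP (a * q / e) * qP (a * q / f) * qP (l * q) * qP (l * q / (e * f)))
     * w8_term l (l * b / a) (l * c / a) (l * d / a) e f j)"
  proof
    fix j
    define A where "A = a * q ^ (2 * j)"
    have 1: "A * q / (u * q ^ j) = a * q / u * q ^ j" for u
      using q_nz by (simp add: A_def mult_2 power_add)
    have 2: "A * q / ((e * q ^ j) * (f * q ^ j) * (a / l)) = z"
      using q_nz nz l_nz by (simp add: A_def z mult_2 power_add)
    have 3: "A * q / (a / l) = l * q * q ^ (2 * j)"
      using nz by (simp add: A_def)
    have 4: "A * q / (e * q ^ j * (f * q ^ j)) = a * q / (e * f)"
      using q_nz by (simp add: A_def mult_2 power_add)
    have 5: "A * q / (u * q ^ j * (a / l)) = l * q / u * q ^ j" for u
      using q_nz nz by (simp add: A_def mult_2 power_add)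
    have nzs: "A \<noteq> 0" "e * q ^ j \<noteq> 0" "f * q ^ j \<noteq> 0" "a / l \<noteq> 0" "qP A \<noteq> 0"
      "qP (A * q / (e * q ^ j)) \<noteq> 0" "qP (A * q / (f * q ^ j)) \<noteq> 0" "qP (A * q / (a / l)) \<noteq> 0"
      unfolding 1 3 using nz q_nz l_nz qP_shift_nz[OF qPa, of "2 * j"] qP_shift_nz[OF qPef(1), of j]
        qP_shift_nz[OF qPef(2), of j] qP_shift_nz[OF l_nz(3), of "2 * j"] by (auto simp: A_def)
    have "summable (\<lambda>m. norm (rogers_term A (e * q ^ j) (f * q ^ j) (a / l) m))"
      using rogers_summable[OF nzs(1-4) 2[symmetric] nzs(5-8) z1, of 0] by simp
    then have "infsum (rogers_term A (e * q ^ j) (f * q ^ j) (a / l)) UNIV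
       = qP (A * q) * (qP (a * q / (e * f)) * qP (l * q / e * q ^ j) * qP (l * q / f * q ^ j))
         / (qP (a * q / e * q ^ j) * qP (a * q / f * q ^ j) * qP (l * q * q ^ (2 * j)) * qP z)"
      using rogers_sum[OF nzs(1-4) 2[symmetric] nzs(5-8) z1] unfolding 1 3 4 5 
      by (simp add: infsum_eq_suminf)
    moreover have "A * q = a * q * q ^ (2 * j)"
      by (simp add: A_def)
    ultimately have "infsum (\<lambda>m. X (j, m)) UNIV = Y j * z' ^ j *
       (qP (a * q * q ^ (2 * j)) * (qP (a * q / (e * f)) * qP (l * q / e * q ^ j) * qP (l * q / f * q ^ j))
         / (qP (a * q / e * q ^ j) * qP (a * q / f * q ^ j) * qP (l * q * q ^ (2 * j)) * qP z))"
      by (simp only: X_def prod.case infsum_cmult_right' A_def[symmetric])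
    \<comment> \<open>Each finite product in \<open>Y j\<close> is paired with a shifted infinite
      product from Rogers' sum. The completed products no longer depend on \<open>j\<close>; only
      \<open>e\<close> and \<open>f\<close> leave behind the coefficients \<open>fr l e j\<close>
      and \<open>fr l f j\<close> of the new series.\<close>
    also have "\<dots> = vw l j * (fr l (l * b / a) j * fr l (l * c / a) j * fr l (l * d / a) j) * z' ^ j
      * ((qp (a * q) (2 * j) * qP (a * q * q ^ (2 * j))) * qP (a * q / (e * f))
        * (qp e j * qP (l * q / e * q ^ j)) * (qp f j * qP (l * q / f * q ^ j))
        / ((qp (a * q / e) j * qP (a * q / e * q ^ j)) * (qp (a * q / f) j * qP (a * q / f * q ^ j))
          * (qp (l * q) (2 * j) * qP (l * q * q ^ (2 * j))) * qP z))"
      by (simp add: Y_def mult_ac)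
    also have "\<dots> = vw l j * (fr l (l * b / a) j * fr l (l * c / a) j * fr l (l * d / a) j) * z' ^ j
      * (qP (a * q) * qP (a * q / (e * f)) * (fr l e j * qP (l * q / e)) * (fr l f j * qP (l * q / f))
        / (qP (a * q / e) * qP (a * q / f) * qP (l * q) * qP z))"
    proof -
      have "qp u j * qP (l * q / u * q ^ j) = fr l u j * qP (l * q / u)" if "qP (l * q / u) \<noteq> 0" for u
        using qP_split[of "l * q / u" j] qp_nz[OF that, of j] by (simp add: fr_def)
      then show ?thesis
        unfolding qP_split[symmetric] using qPlef by simp
    qed
    finally show "infsum (\<lambda>m. X (j, m)) UNIV =
      qP (a * q) * qP (a * q / (e * f)) * (qP (l * q / e) * qP (l * q / f))
     / (qP (a * q / e) * qP (a * q / f) * qP (l * q) * qP (l * q / (e * f)))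
     * w8_term l (l * b / a) (l * c / a) (l * d / a) e f j"
    proof -
      assume *: "infsum (\<lambda>m. X (j, m)) UNIV = vw l j * (fr l (l * b / a) j * fr l (l * c / a) j * fr l (l * d / a) j) * z' ^ j
        * (qP (a * q) * qP (a * q / (e * f)) * (fr l e j * qP (l * q / e)) * (fr l f j * qP (l * q / f))
        / (qP (a * q / e) * qP (a * q / f) * qP (l * q) * qP z))"
      have zz: "l\<^sup>2 * q\<^sup>2 / (l * b / a * (l * c / a) * (l * d / a) * e * f) = z'"
        using nz q_nz by (simp add: z' l field_simps power2_eq_square)
      show ?thesis
        unfolding w8_term_def zz * z[symmetric] by (simp add: mult_ac)
    qed
  qed
  finally show ?thesis
    by (simp only: infsum_cmult_right')
qed

end

end

section \<open>The series without denominators\<close>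

text \<open>The sum is the limit of finite sums along the filter of finite subsets. A local majorant
  makes this limit uniform on a small closed ball, so holomorphy passes to its interior.\<close>

lemma holomorphic_on_infsum:
  fixes f :: "'i \<Rightarrow> complex \<Rightarrow> complex"
  assumes "open S" and hol: "\<And>k. k \<in> A \<Longrightarrow> f k holomorphic_on S"
    and bound: "\<And>x. x \<in> S \<Longrightarrow> \<exists>M. M summable_on A \<and> (\<forall>\<^sub>F y in nhds x. \<forall>k\<in>A. norm (f k y) \<le> M k)"
  shows "(\<lambda>x. \<Sum>\<^sub>\<infinity>k\<in>A. f k x) holomorphic_on S"
proof -
  have "\<exists>U. open U \<and> x \<in> U \<and> (\<lambda>x. \<Sum>\<^sub>\<infinity>k\<in>A. f k x) holomorphic_on U" if x: "x \<in> S" for x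
  proof -
    obtain M where M: "M summable_on A" "\<forall>\<^sub>F y in nhds x. \<forall>k\<in>A. norm (f k y) \<le> M k"
      using bound[OF x] by blast
    have "\<forall>\<^sub>F y in nhds x. y \<in> S"
      using \<open>open S\<close> x by (rule eventually_nhds_in_open)
    with M(2) have "\<forall>\<^sub>F y in nhds x. y \<in> S \<and> (\<forall>k\<in>A. norm (f k y) \<le> M k)"
      by eventually_elim auto
    then obtain \<delta> where \<delta>: "\<delta> > 0" "\<And>y. dist y x < \<delta> \<Longrightarrow> y \<in> S \<and> (\<forall>k\<in>A. norm (f k y) \<le> M k)"
      by (auto simp: eventually_nhds_metric)
    have sub: "y \<in> S" "\<And>k. k \<in> A \<Longrightarrow> norm (f k y) \<le> M k" if "y \<in> cball x (\<delta> / 2)" for y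
      using \<delta>(2)[of y] \<delta>(1) that by (auto simp: dist_commute)
    have lim: "uniform_limit (cball x (\<delta> / 2)) (\<lambda>X y. \<Sum>k\<in>X. f k y) (\<lambda>y. \<Sum>\<^sub>\<infinity>k\<in>A. f k y)
        (finite_subsets_at_top A)"
      using sub(2) M(1) by (intro Weierstrass_m_test_general) auto
    have "\<forall>\<^sub>F X in finite_subsets_at_top A. continuous_on (cball x (\<delta> / 2)) (\<lambda>y. \<Sum>k\<in>X. f k y)
        \<and> (\<lambda>y. \<Sum>k\<in>X. f k y) holomorphic_on ball x (\<delta> / 2)"
    proof (rule eventually_finite_subsets_at_top_weakI)
      fix X assume "X \<subseteq> A"
      then have "(\<lambda>y. \<Sum>k\<in>X. f k y) holomorphic_on cball x (\<delta> / 2)"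
        using sub(1) by (intro holomorphic_intros holomorphic_on_subset[OF hol]) auto
      then show "continuous_on (cball x (\<delta> / 2)) (\<lambda>y. \<Sum>k\<in>X. f k y)
        \<and> (\<lambda>y. \<Sum>k\<in>X. f k y) holomorphic_on ball x (\<delta> / 2)"
        using holomorphic_on_imp_continuous_on holomorphic_on_subset[OF _ ball_subset_cball] by blast
    qed
    from holomorphic_uniform_limit[OF this lim] have "(\<lambda>y. \<Sum>\<^sub>\<infinity>k\<in>A. f k y) holomorphic_on ball x (\<delta> / 2)"
      by (simp add: finite_subsets_at_top_neq_bot)
    then show ?thesis
      using \<delta>(1) by (intro exI[of _ "ball x (\<delta> / 2)"]) auto
  qed
  then show ?thesis
    unfolding holomorphic_on_def by (metis at_within_open field_differentiable_at_within)
qed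

lemma summable_on_int_geometric:
  fixes C :: real
  assumes "0 \<le> t" "t < 1"
  shows "(\<lambda>k::int. C * t ^ nat \<bar>k\<bar>) summable_on UNIV"
proof -
  have s: "(\<lambda>n. C * t ^ n) summable_on (UNIV :: nat set)"
    using assms by (intro norm_summable_imp_summable_on)
      (auto simp: abs_mult power_abs intro!: summable_mult summable_geometric)
  have 1: "(\<lambda>k::int. C * t ^ nat \<bar>k\<bar>) summable_on range int"
    using s by (subst summable_on_reindex) (auto simp: o_def)
  have "inj (\<lambda>n. - int n)"
    by (auto simp: inj_def)
  then have 2: "(\<lambda>k::int. C * t ^ nat \<bar>k\<bar>) summable_on range (\<lambda>n. - int n)"
    using s by (subst summable_on_reindex) (auto simp: o_def)
  have "range int \<union> range (\<lambda>n. - int n) = UNIV"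
    by (auto simp: image_iff) (metis int_cases2)
  then show ?thesis
    using summable_on_union[OF 1 2] by simp
qed

context q_base
begin

text \<open>\<open>(aq/b;q)\<^sub>\<infinity> fr a b n = (-b)\<^sup>n gg (aq/b) (1/b) n\<close>, where the right-hand side has no denominator.\<close>

definition gg where "gg x \<beta> n = qP (x * q ^ n) * rp \<beta> n"

lemma norm_gg_le:
  assumes "norm x \<le> R" "norm \<beta> \<le> r" "r > 0"
  shows "norm (gg x \<beta> n) \<le> K R * K (1 / r) * r ^ n"
proof -
  have "norm (gg x \<beta> n) \<le> K R * (r ^ n * K (1 / r))"
    unfolding gg_def norm_mult
    by (intro mult_mono norm_qP_shift_le norm_rp_le assms order_less_imp_le[OF K_pos]) auto
  then show ?thesis by (simp add: mult_ac)
qed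

text \<open>\<open>(1 - a q\<^sup>2\<^sup>n) (a;q)\<^sub>n / (1 - a)\<close>, with the right value also at \<open>a = 1\<close>.\<close>

definition sv where "sv a n = (if n = 0 then 1 else (1 - a * q ^ (2 * n)) * qp (a * q) (n - 1))"

lemma sv_qp: "(1 - a * q ^ (2 * n)) * qp a n = (1 - a) * sv a n"
  by (cases n) (simp_all add: sv_def qp_Suc_left[of a])

lemma norm_sv_le: "norm a \<le> R \<Longrightarrow> norm (sv a n) \<le> (1 + R) * K R"
proof -
  assume R: "norm a \<le> R"
  then have "R \<ge> 0" using norm_ge_zero order_trans by blast
  have K1: "1 \<le> K R"
    using \<open>R \<ge> 0\<close> norm_q by (simp add: K_def)
  have "norm (1 - a * q ^ (2 * n)) \<le> 1 + R"
    using norm_triangle_ineq4[of 1 "a * q ^ (2 * n)"] norm_mult_q_power_le[OF R, of "2 * n"] by simp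
  moreover have "norm (qp (a * q) (n - 1)) \<le> K R"
    using norm_mult_q_power_le[OF R, of 1] by (intro norm_qp_le) simp
  ultimately have "norm ((1 - a * q ^ (2 * n)) * qp (a * q) (n - 1)) \<le> (1 + R) * K R"
    unfolding norm_mult using \<open>R \<ge> 0\<close> by (intro mult_mono) auto
  moreover have "1 * 1 \<le> (1 + R) * K R"
    using \<open>R \<ge> 0\<close> K1 by (intro mult_mono) auto
  ultimately show ?thesis
    by (simp add: sv_def)
qed

definition V_term where
  "V_term a b c d e f n = sv a n / qp q n * (gg (a * q / b) (1 / b) n * gg (a * q / c) (1 / c) n
     * gg (a * q / d) (1 / d) n * (gg (a * q / e) (1 / e) n * gg (a * q / f) (1 / f) n)) * (- (a\<^sup>2 * q\<^sup>2)) ^ n"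

text \<open>The very-well-poised series multiplied by
  \<open>(aq/b, aq/c, aq/d, aq/e, aq/f; q)\<close> with infinite index, see \<open>V_eq_w8\<close>.
  It stays meaningful where one of these products vanishes and at \<open>a = 1\<close>.\<close>

definition V where "V a b c d e f = (\<Sum>\<^sub>\<infinity>n. V_term a b c d e f n)"

lemma V_eq_w8:
  assumes "a \<noteq> 1" "b \<noteq> 0" "c \<noteq> 0" "d \<noteq> 0" "e \<noteq> 0" "f \<noteq> 0"
    "qP (a * q / b) \<noteq> 0" "qP (a * q / c) \<noteq> 0" "qP (a * q / d) \<noteq> 0" "qP (a * q / e) \<noteq> 0" "qP (a * q / f) \<noteq> 0"
  shows "V a b c d e f = qP (a * q / b) * qP (a * q / c) * qP (a * q / d) * (qP (a * q / e) * qP (a * q / f))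
    * infsum (w8_term a b c d e f) UNIV"
proof -
  have "V_term a b c d e f n = qP (a * q / b) * qP (a * q / c) * qP (a * q / d) * (qP (a * q / e) * qP (a * q / f))
      * w8_term a b c d e f n" for n
  proof -
    have g: "gg (a * q / y) (1 / y) n * (- y) ^ n = qP (a * q / y) * fr a y n"
      if "y \<noteq> 0" "qP (a * q / y) \<noteq> 0" for y
      using qP_split[of "a * q / y" n] qp_nz[OF that(2), of n] qp_conv_rp[OF that(1), of n]
      by (simp add: gg_def fr_def)
    have v: "vw a n = sv a n / qp q n"
      unfolding vw_def times_divide_times_eq sv_qp using assms(1) by simp
    have "(- (a\<^sup>2 * q\<^sup>2)) ^ n = (- b) ^ n * (- c) ^ n * (- d) ^ n * ((- e) ^ n * (- f) ^ n)
        * (a\<^sup>2 * q\<^sup>2 / (b * c * d * e * f)) ^ n"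
      using assms(2-6) by (simp flip: power_mult_distrib)
    then have "V_term a b c d e f n = sv a n / qp q n * ((gg (a * q / b) (1 / b) n * (- b) ^ n)
      * (gg (a * q / c) (1 / c) n * (- c) ^ n) * (gg (a * q / d) (1 / d) n * (- d) ^ n)
      * ((gg (a * q / e) (1 / e) n * (- e) ^ n) * (gg (a * q / f) (1 / f) n * (- f) ^ n)))
      * (a\<^sup>2 * q\<^sup>2 / (b * c * d * e * f)) ^ n"
      unfolding V_term_def by (simp only: mult_ac)
    then show ?thesis
      unfolding g[OF assms(2,7)] g[OF assms(3,8)] g[OF assms(4,9)] g[OF assms(5,10)] g[OF assms(6,11)]
        w8_term_def v by (simp only: mult_ac)
  qed
  then have "V_term a b c d e f = (\<lambda>n. qP (a * q / b) * qP (a * q / c) * qP (a * q / d)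
      * (qP (a * q / e) * qP (a * q / f)) * w8_term a b c d e f n)"
    by (intro ext)
  then show ?thesis
    by (simp add: V_def infsum_cmult_right')
qed

theorem bailey_two_term_V:
  assumes nz: "a \<noteq> 0" "b \<noteq> 0" "c \<noteq> 0" "d \<noteq> 0" "e \<noteq> 0" "f \<noteq> 0"
    and l: "l = q * a\<^sup>2 / (b * c * d)"
    and z1: "norm (l * q / (e * f)) < 1" and z1': "norm (a * q / (e * f)) < 1"
    and qPa: "qP a \<noteq> 0" and qPbcd: "qP (a * q / b) \<noteq> 0" "qP (a * q / c) \<noteq> 0" "qP (a * q / d) \<noteq> 0"
    and qPef: "qP (a * q / e) \<noteq> 0" "qP (a * q / f) \<noteq> 0"
    and qPl: "qP l \<noteq> 0" and qPlef: "qP (l * q / e) \<noteq> 0" "qP (l * q / f) \<noteq> 0"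
    and tl: "\<theta> (a / l) \<noteq> 0"
  shows "qP (l * q) * qP (l * q / (e * f)) * V a b c d e f
    = qP (a * q) * qP (a * q / (e * f)) * V l (l * b / a) (l * c / a) (l * d / a) e f"
proof -
  have l0: "l \<noteq> 0" using nz q_nz by (simp add: l)
  have 1: "a \<noteq> 1" "l \<noteq> 1" using qPa qPl qP_1 by metis+
  have lows: "l * q / (l * b / a) = a * q / b" "l * q / (l * c / a) = a * q / c"
    "l * q / (l * d / a) = a * q / d"
    using l0 nz by simp_all
  have z_nz: "qP x \<noteq> 0" if "norm x < 1" for x
  proof
    assume "qP x = 0"
    then obtain i where "x * q ^ i = 1" by (auto simp: qP_zero_iff)
    then show False
      using norm_mult_q_power_le[of x "norm x" i] that by simp
  qed
  have V1: "V a b c d e f = qP (a * q / b) * qP (a * q / c) * qP (a * q / d) * (qP (a * q / e) * qP (a * q / f))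
    * infsum (w8_term a b c d e f) UNIV"
    by (rule V_eq_w8) (use assms 1 in auto)
  have V2: "V l (l * b / a) (l * c / a) (l * d / a) e f
    = qP (a * q / b) * qP (a * q / c) * qP (a * q / d) * (qP (l * q / e) * qP (l * q / f))
    * infsum (w8_term l (l * b / a) (l * c / a) (l * d / a) e f) UNIV"
    using V_eq_w8[of l "l * b / a" "l * c / a" "l * d / a" e f, unfolded lows] 1 l0 nz qPbcd qPlef by simp
  have lq: "qP (l * q) \<noteq> 0"
    using qP_shift_nz[OF qPl, of 1] by simp
  show ?thesis
    unfolding V1 V2 bailey_two_term[OF nz l refl refl z1 z1' qPa qPbcd qPef qPl qPlef tl]
    using lq z_nz[OF z1] qPef by simp
qed

text \<open>\<open>\<eta> a b k = (q/b, aq/b; q)\<^sub>\<infinity> (b;q)\<^sub>k / (aq/b;q)\<^sub>k (-b)\<^sup>-\<^sup>k\<close>, written without denominators.\<close>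

definition \<eta> :: "complex \<Rightarrow> complex \<Rightarrow> int \<Rightarrow> complex" where
  "\<eta> a b k = q powi (k * (k - 1) div 2) * qP (a * q powi (1 + k) / b) * qP (q powi (1 - k) / b)"

text \<open>Raising \<open>n\<close> by one produces a factor \<open>1 - y / q ^ n\<close>, and the
  triangular exponent supplies exactly the \<open>q ^ n\<close> that clears its denominator. This
  links the infinite product in \<open>\<eta>\<close> with the polynomial \<open>rp\<close>.\<close>

lemma triangular_qP:
  "q powi (int n * (int n - 1) div 2) * qP (q powi (1 - int n) * y) = qP (q * y) * rp y n"
proof (induction n)
  case 0
  then show ?case by (simp add: rp_def)
next
  case (Suc n)
  have "int (Suc n) * (int (Suc n) - 1) = int n * (int n - 1) + int n * 2"
    by (simp add: algebra_simps)
  then have e: "int (Suc n) * (int (Suc n) - 1) div 2 = int n * (int n - 1) div 2 + int n"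
    by simp
  have "qP (q powi (1 - int (Suc n)) * y) = (1 - y / q ^ n) * qP (q powi (1 - int n) * y)"
  proof -
    have "q powi (1 - int (Suc n)) = 1 / q ^ n"
      by (simp add: power_int_minus divide_inverse)
    moreover have "q powi (1 - int n) = q / q ^ n"
      using q_nz by (simp add: power_int_diff)
    ultimately show ?thesis
      by (subst qP_rec) (simp add: mult_ac)
  qed
  moreover have "q powi (int n * (int n - 1) div 2 + int n) = q powi (int n * (int n - 1) div 2) * q ^ n"
    using q_nz by (simp add: power_int_add)
  moreover have "q ^ n * (1 - y / q ^ n) = q ^ n - y"
    using q_nz by (simp add: right_diff_distrib)
  then have "E * q ^ n * ((1 - y / q ^ n) * P) = (q ^ n - y) * (E * P)" for E P
    by (simp flip: mult.assoc)
  ultimately have "q powi (int (Suc n) * (int (Suc n) - 1) div 2) * qP (q powi (1 - int (Suc n)) * y)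
     = (q ^ n - y) * (q powi (int n * (int n - 1) div 2) * qP (q powi (1 - int n) * y))"
    unfolding e by (simp only:)
  then show ?case
    unfolding Suc.IH by (simp add: rp_def mult_ac)
qed

lemma \<eta>_nonneg: "\<eta> a b (int n) = qP (q / b) * gg (a * q / b) (1 / b) n"
proof -
  have 1: "a * q powi (1 + int n) / b = a * q / b * q ^ n"
    using q_nz by (simp add: power_int_add)
  have 2: "x * X * qP (q powi (1 - int n) / b) = X * (x * qP (q powi (1 - int n) * (1 / b)))" for x X
    by simp
  show ?thesis
    unfolding \<eta>_def 1 2 triangular_qP by (simp add: gg_def)
qed

lemma norm_\<eta>_le:
  assumes "r > 0" "s > 0" "norm (1 / b) \<le> r" "norm (a / b) \<le> s"
  shows "norm (\<eta> a b (int n)) \<le> K r * (K s * K (1 / r)) * r ^ n"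
proof -
  have "norm (q / b) \<le> r" "norm (a * q / b) \<le> s"
    using norm_mult_q_power_le[OF assms(3), of 1] norm_mult_q_power_le[OF assms(4), of 1] by simp_all
  then have "norm (\<eta> a b (int n)) \<le> K r * (K s * K (1 / r) * r ^ n)"
    unfolding \<eta>_nonneg norm_mult
    by (intro mult_mono norm_qP_le norm_gg_le assms order_less_imp_le[OF K_pos]) auto
  then show ?thesis by simp
qed

lemma \<eta>_shift:
  assumes "b \<noteq> 0"
  shows "\<eta> (a * q\<^sup>2) (b * q) k = q powi (- k) * \<eta> a b (k + 1)"
proof -
  have "(k + 1) * (k + 1 - 1) = k * (k - 1) + k * 2"
    by (simp add: algebra_simps)
  then have e: "(k + 1) * (k + 1 - 1) div 2 = k * (k - 1) div 2 + k"
    by simp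
  have 1: "a * q\<^sup>2 * q powi (1 + k) / (b * q) = a * q powi (1 + (k + 1)) / b"
    using q_nz by (simp add: power_int_add power2_eq_square)
  have 2: "q powi (1 - k) / (b * q) = q powi (1 - (k + 1)) / b"
    using q_nz by (simp add: power_int_diff power_int_minus divide_inverse)
  have 3: "q powi (- k) * q powi (k * (k - 1) div 2 + k) = q powi (k * (k - 1) div 2)"
    using q_nz by (simp flip: power_int_add)
  show ?thesis
    unfolding \<eta>_def e 1 2 3[symmetric] by (simp only: mult.assoc)
qed

lemma \<eta>_reflect:
  assumes "a \<noteq> 0"
  shows "\<eta> (1 / a) (b / a) k = q powi (- k) * \<eta> a b (- k)"
proof -
  have "- k * (- k - 1) = k * (k - 1) + k * 2"
    by (simp add: algebra_simps)
  then have e: "- k * (- k - 1) div 2 = k * (k - 1) div 2 + k"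
    by simp
  have 3: "q powi (- k) * q powi (k * (k - 1) div 2 + k) = q powi (k * (k - 1) div 2)"
    using q_nz by (simp flip: power_int_add)
  have 1: "1 / a * q powi (1 + k) / (b / a) = q powi (1 - - k) / b"
    "q powi (1 - k) / (b / a) = a * q powi (1 + - k) / b"
    using assms by simp_all
  show ?thesis
    unfolding \<eta>_def e 1 3[symmetric] by (simp only: mult_ac)
qed

section \<open>The bilateral series cleared of denominators\<close>

definition T_term where
  "T_term a b c d e f g k = (1 - a * q powi (2 * k)) * (a ^ 3 * q\<^sup>2) powi k
     * (\<eta> a b k * \<eta> a c k * \<eta> a d k * \<eta> a e k * \<eta> a f k * \<eta> a g k)"

text \<open>The bilateral series multiplied by \<open>1 - a\<close> and by
  \<open>(q/x, aq/x; q)\<close> with infinite index for its six free parameters \<open>x\<close>.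
  The powers of \<open>- x\<close> split off in \<open>\<eta>\<close> cancel the denominator of the
  argument, which leaves the powers of \<open>a ^ 3 * q ^ 2\<close>.\<close>

definition T where "T a b c d e f g = (\<Sum>\<^sub>\<infinity>k\<in>UNIV. T_term a b c d e f g k)"

lemma q_powi_minus_6: "(q powi (- k)) ^ 6 = (1 / q ^ 6) powi k"
proof -
  have "(q powi (- k)) ^ 6 = (q powi (- k)) powi 6"
    by simp
  also have "\<dots> = q powi ((- 6) * k)"
    unfolding power_int_mult[symmetric] by (simp add: mult.commute)
  also have "\<dots> = (q powi (- 6)) powi k"
    by (rule power_int_mult)
  also have "q powi (- 6) = 1 / q ^ 6"
    by (simp add: power_int_minus divide_inverse)
  finally show ?thesis .
qed

text \<open>Up to a constant, the scaled term of index \<open>k\<close> is the original term of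
  index \<open>k + 1\<close>: each of the six \<open>\<eta>\<close> yields
  \<open>q powi (- k)\<close>, and together they cancel the power of \<open>q\<close> coming from
  the cube of the new base.\<close>

lemma T_shift:
  assumes "a \<noteq> 0" "b \<noteq> 0" "c \<noteq> 0" "d \<noteq> 0" "e \<noteq> 0" "f \<noteq> 0" "g \<noteq> 0"
  shows "T (a * q\<^sup>2) (b * q) (c * q) (d * q) (e * q) (f * q) (g * q) = T a b c d e f g / (a ^ 3 * q\<^sup>2)"
proof -
  have "T_term (a * q\<^sup>2) (b * q) (c * q) (d * q) (e * q) (f * q) (g * q) k
      = 1 / (a ^ 3 * q\<^sup>2) * T_term a b c d e f g (k + 1)" for k
  proof -
    have 1: "a * q\<^sup>2 * q powi (2 * k) = a * q powi (2 * (k + 1))"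
      using q_nz by (simp add: power_int_add distrib_left power2_eq_square)
    have 2: "((a * q\<^sup>2) ^ 3 * q\<^sup>2) powi k * (q powi (- k)) ^ 6 = 1 / (a ^ 3 * q\<^sup>2) * (a ^ 3 * q\<^sup>2) powi (k + 1)"
    proof -
      have "(q powi (- k)) ^ 6 = (1 / q ^ 6) powi k"
        by (rule q_powi_minus_6)
      then have "((a * q\<^sup>2) ^ 3 * q\<^sup>2) powi k * (q powi (- k)) ^ 6 = ((a * q\<^sup>2) ^ 3 * q\<^sup>2 * (1 / q ^ 6)) powi k"
        by (simp only: power_int_mult_distrib)
      also have "(a * q\<^sup>2) ^ 3 * q\<^sup>2 * (1 / q ^ 6) = a ^ 3 * q\<^sup>2"
        using q_nz by (simp add: power_mult_distrib field_simps flip: power_mult power_add)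
      finally show ?thesis
        using assms(1) q_nz by (simp add: power_int_add)
    qed
    have 6: "x1 * y1 * (x1 * y2) * (x1 * y3) * (x1 * y4) * (x1 * y5) * (x1 * y6)
        = x1 ^ 6 * (y1 * y2 * y3 * y4 * y5 * y6)" for x1 y1 y2 y3 y4 y5 y6 :: complex
      by (simp add: eval_nat_numeral)
    have "T_term (a * q\<^sup>2) (b * q) (c * q) (d * q) (e * q) (f * q) (g * q) k
      = (1 - a * q powi (2 * (k + 1))) * (((a * q\<^sup>2) ^ 3 * q\<^sup>2) powi k * (q powi (- k)) ^ 6)
        * (\<eta> a b (k + 1) * \<eta> a c (k + 1) * \<eta> a d (k + 1) * \<eta> a e (k + 1) * \<eta> a f (k + 1) * \<eta> a g (k + 1))"
      unfolding T_term_def 1 \<eta>_shift[OF assms(2)] \<eta>_shift[OF assms(3)] \<eta>_shift[OF assms(4)]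
        \<eta>_shift[OF assms(5)] \<eta>_shift[OF assms(6)] \<eta>_shift[OF assms(7)] 6 by (simp only: mult.assoc)
    then show ?thesis
      unfolding 2 T_term_def by (simp only: mult_ac)
  qed
  then have "T (a * q\<^sup>2) (b * q) (c * q) (d * q) (e * q) (f * q) (g * q)
      = 1 / (a ^ 3 * q\<^sup>2) * (\<Sum>\<^sub>\<infinity>k\<in>UNIV. T_term a b c d e f g (k + 1))"
    by (simp only: T_def infsum_cmult_right')
  also have "(\<Sum>\<^sub>\<infinity>k\<in>UNIV. T_term a b c d e f g (k + 1)) = T a b c d e f g"
    unfolding T_def
    by (rule infsum_reindex_bij_betw[of "\<lambda>k. k + 1" UNIV UNIV "T_term a b c d e f g"])
       (rule bij_betw_byWitness[where f' = "\<lambda>k. k - 1"], auto)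
  finally show ?thesis by simp
qed

lemma T_term_reflect:
  assumes "a \<noteq> 0"
  shows "T_term (1 / a) (b / a) (c / a) (d / a) (e / a) (f / a) (g / a) k = - (1 / a) * T_term a b c d e f g (- k)"
proof -
  have 1: "1 - 1 / a * q powi (2 * k) = - (1 / a) * (1 - a * q powi (2 * (- k))) * q powi (2 * k)"
    using assms q_nz by (simp add: power_int_minus field_simps)
  have 2: "q powi (2 * k) * (((1 / a) ^ 3 * q\<^sup>2) powi k * (q powi (- k)) ^ 6) = (a ^ 3 * q\<^sup>2) powi (- k)"
  proof -
    have "(q powi (- k)) ^ 6 = (1 / q ^ 6) powi k"
      by (rule q_powi_minus_6)
    moreover have "q powi (2 * k) = (q\<^sup>2) powi k"
      by (simp add: power_int_mult)
    ultimately have "q powi (2 * k) * (((1 / a) ^ 3 * q\<^sup>2) powi k * (q powi (- k)) ^ 6)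
        = (q\<^sup>2 * ((1 / a) ^ 3 * q\<^sup>2 * (1 / q ^ 6))) powi k"
      by (simp only: power_int_mult_distrib)
    also have "q\<^sup>2 * ((1 / a) ^ 3 * q\<^sup>2 * (1 / q ^ 6)) = inverse (a ^ 3 * q\<^sup>2)"
      using q_nz assms by (simp add: field_simps flip: power_mult power_add)
    also have "inverse (a ^ 3 * q\<^sup>2) powi k = (a ^ 3 * q\<^sup>2) powi (- k)"
      by (simp only: power_int_minus power_int_inverse)
    finally show ?thesis .
  qed
  have 6: "x1 * y1 * (x1 * y2) * (x1 * y3) * (x1 * y4) * (x1 * y5) * (x1 * y6)
      = x1 ^ 6 * (y1 * y2 * y3 * y4 * y5 * y6)" for x1 y1 y2 y3 y4 y5 y6 :: complex
    by (simp add: eval_nat_numeral)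
  have "T_term (1 / a) (b / a) (c / a) (d / a) (e / a) (f / a) (g / a) k
    = - (1 / a) * (1 - a * q powi (2 * (- k))) * (q powi (2 * k) * (((1 / a) ^ 3 * q\<^sup>2) powi k * (q powi (- k)) ^ 6))
      * (\<eta> a b (- k) * \<eta> a c (- k) * \<eta> a d (- k) * \<eta> a e (- k) * \<eta> a f (- k) * \<eta> a g (- k))"
    unfolding T_term_def 1 \<eta>_reflect[OF assms] 6 by (simp only: mult.assoc)
  then show ?thesis
    unfolding 2 T_term_def by (simp only: mult_ac)
qed

text \<open>Reversal of the summation index. The minus sign comes from
  \<open>1 - a * q powi (2 * k)\<close>, which is odd under it up to a monomial.\<close>

lemma T_reflect:
  assumes "a \<noteq> 0"
  shows "T (1 / a) (b / a) (c / a) (d / a) (e / a) (f / a) (g / a) = - T a b c d e f g / a"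
proof -
  have "T (1 / a) (b / a) (c / a) (d / a) (e / a) (f / a) (g / a)
      = - (1 / a) * (\<Sum>\<^sub>\<infinity>k\<in>UNIV. T_term a b c d e f g (- k))"
    by (simp only: T_def T_term_reflect[OF assms] infsum_cmult_right')
  also have "(\<Sum>\<^sub>\<infinity>k\<in>UNIV. T_term a b c d e f g (- k)) = T a b c d e f g"
    unfolding T_def
    by (rule infsum_reindex_bij_betw[of "\<lambda>k. - k" UNIV UNIV "T_term a b c d e f g"])
       (rule bij_betw_byWitness[where f' = "\<lambda>k. - k"], auto)
  finally show ?thesis by simp
qed

text \<open>For \<open>a = 1\<close>, reflection alone gives \<open>T = - T\<close>. For
  \<open>a = q\<close>, reflection leads to the base \<open>1 / q\<close> and one shift back to
  \<open>q\<close>, again with a minus sign. Every other integer power differs from these two by an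
  even power of \<open>q\<close>, that is, by shifts; hence the split of \<open>j\<close> modulo
  2.\<close>

lemma T_q_powi_eq_0:
  assumes "b \<noteq> 0" "c \<noteq> 0" "d \<noteq> 0" "e \<noteq> 0" "f \<noteq> 0" "g \<noteq> 0"
  shows "T (q powi j) b c d e f g = 0"
proof -
  have T1: "T 1 b c d e f g = 0" for b c d e f g
    using T_reflect[of 1 b c d e f g] by (simp add: eq_neg_iff_add_eq_0)
  have Tq: "T q b c d e f g = 0" if "b \<noteq> 0" "c \<noteq> 0" "d \<noteq> 0" "e \<noteq> 0" "f \<noteq> 0" "g \<noteq> 0" for b c d e f g
  proof -
    have "T (1 / q * q\<^sup>2) (b / q * q) (c / q * q) (d / q * q) (e / q * q) (f / q * q) (g / q * q)
      = T (1 / q) (b / q) (c / q) (d / q) (e / q) (f / q) (g / q) / ((1 / q) ^ 3 * q\<^sup>2)"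
      by (rule T_shift) (use that q_nz in auto)
    moreover have "(1 / q) ^ 3 * q\<^sup>2 = 1 / q" "1 / q * q\<^sup>2 = q"
      using q_nz by (simp_all add: power2_eq_square power3_eq_cube)
    ultimately have "T q b c d e f g = - T q b c d e f g"
      unfolding T_reflect[OF q_nz] using q_nz by simp
    then show ?thesis
      by (simp add: eq_neg_iff_add_eq_0)
  qed
  have up: "T (a * q ^ (2 * n)) b c d e f g = 0 \<longleftrightarrow> T a (b / q ^ n) (c / q ^ n) (d / q ^ n) (e / q ^ n) (f / q ^ n) (g / q ^ n) = 0"
    if "a \<noteq> 0" "b \<noteq> 0" "c \<noteq> 0" "d \<noteq> 0" "e \<noteq> 0" "f \<noteq> 0" "g \<noteq> 0" for a b c d e f g n
    using that
  proof (induction n arbitrary: b c d e f g)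
    case (Suc n)
    have "T (a * q ^ (2 * Suc n)) b c d e f g
      = T (a * q ^ (2 * n) * q\<^sup>2) (b / q * q) (c / q * q) (d / q * q) (e / q * q) (f / q * q) (g / q * q)"
      using q_nz by (simp add: power2_eq_square mult_ac)
    also have "\<dots> = T (a * q ^ (2 * n)) (b / q) (c / q) (d / q) (e / q) (f / q) (g / q) / ((a * q ^ (2 * n)) ^ 3 * q\<^sup>2)"
      by (rule T_shift) (use Suc.prems q_nz in auto)
    finally have "T (a * q ^ (2 * Suc n)) b c d e f g = 0 \<longleftrightarrow>
        T (a * q ^ (2 * n)) (b / q) (c / q) (d / q) (e / q) (f / q) (g / q) = 0"
      using Suc.prems q_nz by simp
    also have "\<dots> \<longleftrightarrow> T a (b / q / q ^ n) (c / q / q ^ n) (d / q / q ^ n) (e / q / q ^ n) (f / q / q ^ n) (g / q / q ^ n) = 0"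
      by (rule Suc.IH) (use Suc.prems q_nz in auto)
    finally show ?case by simp
  qed simp
  define n where "n = nat \<bar>j div 2\<bar>"
  have base: "T (q powi (j mod 2)) b c d e f g = 0"
    if "b \<noteq> 0" "c \<noteq> 0" "d \<noteq> 0" "e \<noteq> 0" "f \<noteq> 0" "g \<noteq> 0" for b c d e f g
  proof -
    have "j mod 2 = 0 \<or> j mod 2 = 1" by auto
    then show ?thesis using T1 Tq[OF that] by auto
  qed
  show ?thesis
  proof (cases "j div 2 \<ge> 0")
    case True
    have "j = j mod 2 + int (2 * n)"
      using True by (simp add: n_def)
    then have "q powi j = q powi (j mod 2 + int (2 * n))"
      by simp
    also have "\<dots> = q powi (j mod 2) * q ^ (2 * n)"
      by (subst power_int_add) (simp_all only: q_nz power_int_of_nat not_False_eq_True simp_thms)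
    finally show ?thesis
      using up[of "q powi (j mod 2)" b c d e f g n] base assms q_nz by simp
  next
    case False
    have "int n = - (j div 2)"
      using False unfolding n_def by linarith
    then have "j mod 2 = j + int (2 * n)"
      using minus_mult_div_eq_mod[of j 2] by simp
    then have "q powi (j mod 2) = q powi (j + int (2 * n))"
      by simp
    also have "\<dots> = q powi j * q ^ (2 * n)"
      by (subst power_int_add) (simp_all only: q_nz power_int_of_nat not_False_eq_True simp_thms)
    finally have "T (q powi j * q ^ (2 * n)) (b * q ^ n) (c * q ^ n) (d * q ^ n) (e * q ^ n) (f * q ^ n) (g * q ^ n) = 0"
      using base[of "b * q ^ n" "c * q ^ n" "d * q ^ n" "e * q ^ n" "f * q ^ n" "g * q ^ n"] assms q_nz by simp
    then show ?thesis
      using up[of "q powi j" "b * q ^ n" "c * q ^ n" "d * q ^ n" "e * q ^ n" "f * q ^ n" "g * q ^ n" n] assms q_nz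
      by simp
  qed
qed

lemma T_eq_0:
  assumes "a \<noteq> 0" "b \<noteq> 0" "c \<noteq> 0" "d \<noteq> 0" "e \<noteq> 0" "f \<noteq> 0" "g \<noteq> 0" "\<theta> a = 0"
  shows "T a b c d e f g = 0"
proof -
  obtain j where "a = q powi j"
    using \<theta>_zero_imp[OF assms(1,8)] .
  then show ?thesis
    using T_q_powi_eq_0[OF assms(2-7)] by simp
qed

text \<open>When the base itself is one of the parameters, \<open>\<eta> a a k\<close> contains
  \<open>qP (q powi (1 + k))\<close>, which vanishes for all negative \<open>k\<close>.\<close>

lemma T_unilateral:
  assumes nz: "a \<noteq> 0" "b \<noteq> 0" "c \<noteq> 0" "d \<noteq> 0" "e \<noteq> 0" "f \<noteq> 0"
  shows "T a a b c d e f = (1 - a) * qP q * qP (q / a)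
    * (qP (q / b) * qP (q / c) * qP (q / d) * (qP (q / e) * qP (q / f))) * V a b c d e f"
proof -
  define C where "C = (1 - a) * qP q * qP (q / a) * (qP (q / b) * qP (q / c) * qP (q / d) * (qP (q / e) * qP (q / f)))"
  have neg: "T_term a a b c d e f k = 0" if "k < 0" for k
  proof -
    define n where "n = nat (- k - 1)"
    have k: "k = - int (Suc n)" using that by (simp add: n_def)
    have "qP (a * q powi (1 + k) / a) = 0"
      unfolding qP_zero_iff
    proof
      show "a * q powi (1 + k) / a * q ^ n = 1"
        using nz(1) q_nz by (simp add: k power_int_minus)
    qed
    then show ?thesis
      by (simp add: T_term_def \<eta>_def)
  qed
  have "T a a b c d e f = infsum (T_term a a b c d e f) (range int)"
    unfolding T_def
  proof (rule infsum_cong_neutral)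
    fix k :: int assume "k \<in> UNIV - range int"
    then have "k < 0" by (metis DiffE nonneg_int_cases not_le rangeI)
    then show "T_term a a b c d e f k = 0" by (rule neg)
  qed auto
  also have "\<dots> = infsum (\<lambda>n. T_term a a b c d e f (int n)) UNIV"
    by (subst infsum_reindex) (auto simp: o_def)
  also have "(\<lambda>n. T_term a a b c d e f (int n)) = (\<lambda>n. C * V_term a b c d e f n)"
  proof
    fix n
    have 1: "qP (q * q ^ n) = qP q / qp q n"
      using qP_split[of q n] qp_q_nz[of n] by simp
    have 2: "rp (1 / a) n * (- a) ^ n = qp a n"
      using qp_conv_rp[OF nz(1), of n] by simp
    have 3: "(a ^ 3 * q\<^sup>2) ^ n = (- (a\<^sup>2 * q\<^sup>2)) ^ n * (- a) ^ n"
      by (simp add: power2_eq_square power3_eq_cube mult_ac flip: power_mult_distrib)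
    have 4: "q powi (2 * int n) = q ^ (2 * n)"
      by (metis power_int_of_nat of_nat_mult of_nat_numeral)
    have "T_term a a b c d e f (int n) = (1 - a * q ^ (2 * n)) * (rp (1 / a) n * (- a) ^ n) * (- (a\<^sup>2 * q\<^sup>2)) ^ n *
      (qP (q / a) * qP (q * q ^ n) * (qP (q / b) * gg (a * q / b) (1 / b) n) * (qP (q / c) * gg (a * q / c) (1 / c) n)
       * (qP (q / d) * gg (a * q / d) (1 / d) n) * (qP (q / e) * gg (a * q / e) (1 / e) n)
       * (qP (q / f) * gg (a * q / f) (1 / f) n))"
      unfolding T_term_def 4 \<eta>_nonneg power_int_of_nat 3 using nz(1) by (simp add: gg_def[of "a * q / a"] gg_def[of q] mult_ac)
    also have "(1 - a * q ^ (2 * n)) * (rp (1 / a) n * (- a) ^ n) = (1 - a) * sv a n"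
      unfolding 2 by (rule sv_qp)
    finally show "T_term a a b c d e f (int n) = C * V_term a b c d e f n"
      unfolding V_term_def C_def 1 by (simp add: mult_ac)
  qed
  finally show ?thesis
    by (simp only: V_def C_def infsum_cmult_right')
qed

end

section \<open>Holomorphic dependence on the parameters\<close>

lemma norm_prod6_le:
  fixes x1 :: "'a :: real_normed_field"
  assumes "norm x1 \<le> A1 * r1 ^ n" "norm x2 \<le> A2 * r2 ^ n" "norm x3 \<le> A3 * r3 ^ n"
    "norm x4 \<le> A4 * r4 ^ n" "norm x5 \<le> A5 * r5 ^ n" "norm x6 \<le> A6 * r6 ^ n"
  shows "norm (x1 * x2 * x3 * x4 * x5 * x6) \<le> A1 * A2 * A3 * A4 * A5 * A6 * (r1 * r2 * r3 * r4 * r5 * r6) ^ n"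
proof -
  have "norm (x * y) \<le> X * Y" if "norm x \<le> X" "norm y \<le> Y" for x y :: 'a and X Y
    using that by (simp add: norm_mult mult_mono')
  then have "norm (x1 * x2 * x3 * x4 * x5 * x6)
      \<le> (A1 * r1 ^ n) * (A2 * r2 ^ n) * (A3 * r3 ^ n) * (A4 * r4 ^ n) * (A5 * r5 ^ n) * (A6 * r6 ^ n)"
    using assms by presburger
  then show ?thesis
    by (simp add: power_mult_distrib mult_ac)
qed

lemma ex_growth_factor:
  fixes c :: real
  assumes "c < 1"
  obtains t where "t > 1" "t ^ m * c < 1"
proof -
  have "((\<lambda>t. t ^ m * c) \<longlongrightarrow> 1 ^ m * c) (at_right 1)"
    by (intro tendsto_intros)
  then have "\<forall>\<^sub>F t in at_right 1. t ^ m * c < 1"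
    using assms by (auto dest: order_tendstoD(2))
  moreover have "\<forall>\<^sub>F t in at_right (1 :: real). t > 1"
    by (simp add: eventually_at_right_less)
  ultimately have "\<forall>\<^sub>F t in at_right 1. t > 1 \<and> t ^ m * c < 1"
    by eventually_elim auto
  then show ?thesis
    using that eventually_happens'[OF trivial_limit_at_right_real] by blast
qed

lemma eventually_norm_le_factor:
  fixes f :: "complex \<Rightarrow> complex"
  assumes "f holomorphic_on S" "open S" "x \<in> S" "f x \<noteq> 0" "t > 1"
  shows "\<forall>\<^sub>F y in nhds x. norm (f y) \<le> t * norm (f x)"
proof -
  have "isCont f x"
    using assms holomorphic_on_imp_continuous_on continuous_on_eq_continuous_at by blast
  then have "((\<lambda>y. norm (f y)) \<longlongrightarrow> norm (f x)) (nhds x)"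
    by (intro tendsto_norm) (simp add: isCont_def tendsto_at_iff_tendsto_nhds)
  then have "\<forall>\<^sub>F y in nhds x. norm (f y) < t * norm (f x)"
    by (rule order_tendstoD(2)) (use assms in simp)
  then show ?thesis
    by (auto elim: eventually_mono)
qed

context q_base
begin

lemma \<eta>_local_bound:
  assumes "open S" "\<alpha> holomorphic_on S" "\<beta> holomorphic_on S" "\<And>x. x \<in> S \<Longrightarrow> \<alpha> x \<noteq> 0" "\<And>x. x \<in> S \<Longrightarrow> \<beta> x \<noteq> 0"
    "x \<in> S" "t > 1"
  shows "\<exists>C>0. \<forall>\<^sub>F y in nhds x. \<forall>n. norm (\<eta> (\<alpha> y) (\<beta> y) (int n)) \<le> C * (t * norm (1 / \<beta> x)) ^ n"
proof -
  have nz: "\<alpha> x \<noteq> 0" "\<beta> x \<noteq> 0" using assms by auto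
  have pos: "t * norm (1 / \<beta> x) > 0" "t * norm (\<alpha> x / \<beta> x) > 0"
    using nz assms(7) by auto
  let ?C = "K (t * norm (1 / \<beta> x)) * (K (t * norm (\<alpha> x / \<beta> x)) * K (1 / (t * norm (1 / \<beta> x))))"
  have "\<forall>\<^sub>F y in nhds x. norm (1 / \<beta> y) \<le> t * norm (1 / \<beta> x)"
    by (rule eventually_norm_le_factor[where S = S]) (use assms nz in \<open>auto intro!: holomorphic_intros\<close>)
  moreover have "\<forall>\<^sub>F y in nhds x. norm (\<alpha> y / \<beta> y) \<le> t * norm (\<alpha> x / \<beta> x)"
    by (rule eventually_norm_le_factor[where S = S]) (use assms nz in \<open>auto intro!: holomorphic_intros\<close>)
  ultimately have "\<forall>\<^sub>F y in nhds x. \<forall>n. norm (\<eta> (\<alpha> y) (\<beta> y) (int n)) \<le> ?C * (t * norm (1 / \<beta> x)) ^ n"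
    by eventually_elim (intro allI norm_\<eta>_le pos)
  moreover have "?C > 0"
    by (intro mult_pos_pos K_pos)
  ultimately show ?thesis by blast
qed

lemma T_term_local_bound_nonneg:
  assumes S: "open S" and \<alpha>: "\<alpha> holomorphic_on S" "\<And>x. x \<in> S \<Longrightarrow> \<alpha> x \<noteq> 0"
    and b: "b holomorphic_on S" "\<And>x. x \<in> S \<Longrightarrow> b x \<noteq> 0"
    and c: "c holomorphic_on S" "\<And>x. x \<in> S \<Longrightarrow> c x \<noteq> 0"
    and d: "d holomorphic_on S" "\<And>x. x \<in> S \<Longrightarrow> d x \<noteq> 0"
    and e: "e holomorphic_on S" "\<And>x. x \<in> S \<Longrightarrow> e x \<noteq> 0"
    and f: "f holomorphic_on S" "\<And>x. x \<in> S \<Longrightarrow> f x \<noteq> 0"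
    and g: "g holomorphic_on S" "\<And>x. x \<in> S \<Longrightarrow> g x \<noteq> 0"
    and x: "x \<in> S"
    and z: "norm (\<alpha> x ^ 3 * q\<^sup>2 / (b x * c x * d x * e x * f x * g x)) < 1"
  shows "\<exists>C \<kappa>. C > 0 \<and> 0 \<le> \<kappa> \<and> \<kappa> < 1 \<and>
    (\<forall>\<^sub>F y in nhds x. \<forall>n. norm (T_term (\<alpha> y) (b y) (c y) (d y) (e y) (f y) (g y) (int n)) \<le> C * \<kappa> ^ n)"
proof -
  \<comment> \<open>Nine factors \<open>t\<close> have to fit: three from the cube of
    \<open>\<alpha>\<close> and one from each of the six \<open>\<eta>\<close>.\<close>
  obtain t where t: "t > 1" "t ^ 9 * norm (\<alpha> x ^ 3 * q\<^sup>2 / (b x * c x * d x * e x * f x * g x)) < 1"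
    using ex_growth_factor[OF z] by blast
  have nz: "\<alpha> x \<noteq> 0" using x \<alpha> by auto
  let ?P = "\<lambda>u C y. \<forall>n. norm (\<eta> (\<alpha> y) (u y) (int n)) \<le> C * (t * norm (1 / u x)) ^ n"
  have ev: "\<exists>C>0. \<forall>\<^sub>F y in nhds x. ?P u C y" if "u holomorphic_on S" "\<And>x. x \<in> S \<Longrightarrow> u x \<noteq> 0" for u
    by (rule \<eta>_local_bound[OF S \<alpha>(1) that(1) \<alpha>(2) that(2) x t(1)])
  obtain C1 where C1: "C1 > 0" "\<forall>\<^sub>F y in nhds x. ?P b C1 y" using ev[OF b] by blast
  obtain C2 where C2: "C2 > 0" "\<forall>\<^sub>F y in nhds x. ?P c C2 y" using ev[OF c] by blast
  obtain C3 where C3: "C3 > 0" "\<forall>\<^sub>F y in nhds x. ?P d C3 y" using ev[OF d] by blast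
  obtain C4 where C4: "C4 > 0" "\<forall>\<^sub>F y in nhds x. ?P e C4 y" using ev[OF e] by blast
  obtain C5 where C5: "C5 > 0" "\<forall>\<^sub>F y in nhds x. ?P f C5 y" using ev[OF f] by blast
  obtain C6 where C6: "C6 > 0" "\<forall>\<^sub>F y in nhds x. ?P g C6 y" using ev[OF g] by blast
  define C where "C = C1 * C2 * C3 * C4 * C5 * C6"
  have C: "C > 0" unfolding C_def using C1(1) C2(1) C3(1) C4(1) C5(1) C6(1) by simp
  define \<rho> where "\<rho> = t * norm (\<alpha> x)"
  have \<rho>: "\<rho> > 0" using nz t(1) by (simp add: \<rho>_def)
  define \<kappa> where "\<kappa> = t ^ 9 * norm (\<alpha> x ^ 3 * q\<^sup>2 / (b x * c x * d x * e x * f x * g x))"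
  have "\<forall>\<^sub>F y in nhds x. norm (\<alpha> y) \<le> \<rho>"
    unfolding \<rho>_def by (rule eventually_norm_le_factor[OF \<alpha>(1) S x nz t(1)])
  with C1(2) C2(2) C3(2) C4(2) C5(2) C6(2)
  have "\<forall>\<^sub>F y in nhds x. \<forall>n. norm (T_term (\<alpha> y) (b y) (c y) (d y) (e y) (f y) (g y) (int n)) \<le> (1 + \<rho>) * C * \<kappa> ^ n"
  proof eventually_elim
    case (elim y)
    show ?case
    proof
      fix n
      have "q powi (2 * int n) = q ^ (2 * n)"
        by (metis power_int_of_nat of_nat_mult of_nat_numeral)
      then have "norm (1 - \<alpha> y * q powi (2 * int n)) \<le> 1 + \<rho>"
        using norm_triangle_ineq4[of 1 "\<alpha> y * q ^ (2 * n)"] norm_mult_q_power_le[OF elim(7), of "2 * n"] by simp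
      moreover have "norm ((\<alpha> y ^ 3 * q\<^sup>2) powi int n) \<le> (\<rho> ^ 3 * norm q ^ 2) ^ n"
        unfolding power_int_of_nat norm_power norm_mult
        using elim(7) \<rho> by (intro power_mono mult_right_mono) auto
      moreover have "norm (\<eta> (\<alpha> y) (b y) (int n) * \<eta> (\<alpha> y) (c y) (int n) * \<eta> (\<alpha> y) (d y) (int n)
          * \<eta> (\<alpha> y) (e y) (int n) * \<eta> (\<alpha> y) (f y) (int n) * \<eta> (\<alpha> y) (g y) (int n))
        \<le> C * ((t * norm (1 / b x)) * (t * norm (1 / c x)) * (t * norm (1 / d x)) * (t * norm (1 / e x))
          * (t * norm (1 / f x)) * (t * norm (1 / g x))) ^ n"
        unfolding C_def using elim by (intro norm_prod6_le) blast+
      ultimately have "norm (T_term (\<alpha> y) (b y) (c y) (d y) (e y) (f y) (g y) (int n))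
        \<le> (1 + \<rho>) * (\<rho> ^ 3 * norm q ^ 2) ^ n * (C * ((t * norm (1 / b x)) * (t * norm (1 / c x))
          * (t * norm (1 / d x)) * (t * norm (1 / e x)) * (t * norm (1 / f x)) * (t * norm (1 / g x))) ^ n)"
        unfolding T_term_def norm_mult[of "_ * _" "_ * _ * _ * _ * _ * _"] norm_mult[of "1 - _"]
        using \<rho> by (intro mult_mono) auto
      also have "\<dots> = (1 + \<rho>) * C * ((\<rho> ^ 3 * norm q ^ 2) * ((t * norm (1 / b x)) * (t * norm (1 / c x))
          * (t * norm (1 / d x)) * (t * norm (1 / e x)) * (t * norm (1 / f x)) * (t * norm (1 / g x)))) ^ n"
        by (simp only: power_mult_distrib mult_ac)
      also have "(\<rho> ^ 3 * norm q ^ 2) * ((t * norm (1 / b x)) * (t * norm (1 / c x))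
          * (t * norm (1 / d x)) * (t * norm (1 / e x)) * (t * norm (1 / f x)) * (t * norm (1 / g x))) = \<kappa>"
        by (simp add: \<kappa>_def \<rho>_def norm_mult norm_divide norm_power eval_nat_numeral)
      finally show "norm (T_term (\<alpha> y) (b y) (c y) (d y) (e y) (f y) (g y) (int n)) \<le> (1 + \<rho>) * C * \<kappa> ^ n" .
    qed
  qed
  moreover have "(1 + \<rho>) * C > 0" "0 \<le> \<kappa>" "\<kappa> < 1"
    using C \<rho> t by (simp_all add: \<kappa>_def)
  ultimately show ?thesis by blast
qed

text \<open>Negative indices are the nonnegative indices of the reflected series, whose argument is
  the same number. One condition therefore controls both ends of the series.\<close>

lemma T_term_local_bound:
  assumes S: "open S" and \<alpha>: "\<alpha> holomorphic_on S" "\<And>x. x \<in> S \<Longrightarrow> \<alpha> x \<noteq> 0"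
    and b: "b holomorphic_on S" "\<And>x. x \<in> S \<Longrightarrow> b x \<noteq> 0"
    and c: "c holomorphic_on S" "\<And>x. x \<in> S \<Longrightarrow> c x \<noteq> 0"
    and d: "d holomorphic_on S" "\<And>x. x \<in> S \<Longrightarrow> d x \<noteq> 0"
    and e: "e holomorphic_on S" "\<And>x. x \<in> S \<Longrightarrow> e x \<noteq> 0"
    and f: "f holomorphic_on S" "\<And>x. x \<in> S \<Longrightarrow> f x \<noteq> 0"
    and g: "g holomorphic_on S" "\<And>x. x \<in> S \<Longrightarrow> g x \<noteq> 0"
    and x: "x \<in> S"
    and z: "norm (\<alpha> x ^ 3 * q\<^sup>2 / (b x * c x * d x * e x * f x * g x)) < 1"
  shows "\<exists>M. M summable_on UNIV \<and>
    (\<forall>\<^sub>F y in nhds x. \<forall>k\<in>UNIV. norm (T_term (\<alpha> y) (b y) (c y) (d y) (e y) (f y) (g y) k) \<le> M k)"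
proof -
  have nz: "\<alpha> x \<noteq> 0" using x \<alpha> by auto
  obtain C1 \<kappa>1 where 1: "C1 > 0" "0 \<le> \<kappa>1" "\<kappa>1 < 1"
    "\<forall>\<^sub>F y in nhds x. \<forall>n. norm (T_term (\<alpha> y) (b y) (c y) (d y) (e y) (f y) (g y) (int n)) \<le> C1 * \<kappa>1 ^ n"
    using T_term_local_bound_nonneg[OF S \<alpha> b c d e f g x z] by blast
  have "(1 / \<alpha> x) ^ 3 * q\<^sup>2 / (b x / \<alpha> x * (c x / \<alpha> x) * (d x / \<alpha> x) * (e x / \<alpha> x) * (f x / \<alpha> x) * (g x / \<alpha> x))
      = \<alpha> x ^ 3 * q\<^sup>2 / (b x * c x * d x * e x * f x * g x)"
    using nz by (simp add: eval_nat_numeral)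
  with z have z': "norm ((1 / \<alpha> x) ^ 3 * q\<^sup>2
      / (b x / \<alpha> x * (c x / \<alpha> x) * (d x / \<alpha> x) * (e x / \<alpha> x) * (f x / \<alpha> x) * (g x / \<alpha> x))) < 1"
    by (simp only:)
  have "\<exists>C \<kappa>. C > 0 \<and> 0 \<le> \<kappa> \<and> \<kappa> < 1 \<and>
    (\<forall>\<^sub>F y in nhds x. \<forall>n. norm (T_term (1 / \<alpha> y) (b y / \<alpha> y) (c y / \<alpha> y) (d y / \<alpha> y)
      (e y / \<alpha> y) (f y / \<alpha> y) (g y / \<alpha> y) (int n)) \<le> C * \<kappa> ^ n)"
    by (rule T_term_local_bound_nonneg[where S = S and \<alpha> = "\<lambda>y. 1 / \<alpha> y" and b = "\<lambda>y. b y / \<alpha> y"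
          and c = "\<lambda>y. c y / \<alpha> y" and d = "\<lambda>y. d y / \<alpha> y" and e = "\<lambda>y. e y / \<alpha> y"
          and f = "\<lambda>y. f y / \<alpha> y" and g = "\<lambda>y. g y / \<alpha> y"])
       (rule S x z' | use \<alpha> b c d e f g in \<open>force intro!: holomorphic_intros\<close>)+
  then obtain C2 \<kappa>2 where 2: "C2 > 0" "0 \<le> \<kappa>2" "\<kappa>2 < 1"
    "\<forall>\<^sub>F y in nhds x. \<forall>n. norm (T_term (1 / \<alpha> y) (b y / \<alpha> y) (c y / \<alpha> y) (d y / \<alpha> y)
      (e y / \<alpha> y) (f y / \<alpha> y) (g y / \<alpha> y) (int n)) \<le> C2 * \<kappa>2 ^ n"
    by blast
  define \<rho> where "\<rho> = 2 * norm (\<alpha> x)"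
  have \<rho>: "\<rho> \<ge> 0" by (simp add: \<rho>_def)
  define M where "M = (\<lambda>k::int. C1 * \<kappa>1 ^ nat \<bar>k\<bar> + \<rho> * C2 * \<kappa>2 ^ nat \<bar>k\<bar>)"
  have "M summable_on UNIV"
    unfolding M_def using 1 2 by (intro summable_on_add summable_on_int_geometric) auto
  moreover have "\<forall>\<^sub>F y in nhds x. norm (\<alpha> y) \<le> \<rho>"
    unfolding \<rho>_def by (rule eventually_norm_le_factor[OF \<alpha>(1) S x nz]) simp
  with eventually_nhds_in_open[OF S x] 1(4) 2(4)
  have "\<forall>\<^sub>F y in nhds x. \<forall>k\<in>UNIV. norm (T_term (\<alpha> y) (b y) (c y) (d y) (e y) (f y) (g y) k) \<le> M k"
  proof eventually_elim
    case (elim y)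
    have \<alpha>y: "\<alpha> y \<noteq> 0" using elim \<alpha> by blast
    show ?case
    proof
      fix k
      consider n where "k = int n" | n where "k = - int n"
        by (metis int_cases2)
      then show "norm (T_term (\<alpha> y) (b y) (c y) (d y) (e y) (f y) (g y) k) \<le> M k"
      proof cases
        case (1 n)
        have "0 \<le> \<rho> * C2 * \<kappa>2 ^ n" using \<rho> 2 by simp
        then show ?thesis
          using elim(2)[rule_format, of n] by (simp add: 1 M_def)
      next
        case (2 n)
        have "T_term (\<alpha> y) (b y) (c y) (d y) (e y) (f y) (g y) k
          = - \<alpha> y * T_term (1 / \<alpha> y) (b y / \<alpha> y) (c y / \<alpha> y) (d y / \<alpha> y) (e y / \<alpha> y) (f y / \<alpha> y) (g y / \<alpha> y) (int n)"
          unfolding T_term_reflect[OF \<alpha>y] 2 using \<alpha>y by simp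
        then have "norm (T_term (\<alpha> y) (b y) (c y) (d y) (e y) (f y) (g y) k) \<le> \<rho> * (C2 * \<kappa>2 ^ n)"
          using elim \<rho> by (simp add: norm_mult mult_mono)
        moreover have "0 \<le> C1 * \<kappa>1 ^ n" using \<open>C1 > 0\<close> \<open>0 \<le> \<kappa>1\<close> by simp
        ultimately show ?thesis
          by (simp add: 2 M_def)
      qed
    qed
  qed
  ultimately show ?thesis by blast
qed

lemma \<eta>_holomorphic:
  "\<alpha> holomorphic_on S \<Longrightarrow> b holomorphic_on S \<Longrightarrow> (\<And>x. x \<in> S \<Longrightarrow> b x \<noteq> 0)
    \<Longrightarrow> (\<lambda>x. \<eta> (\<alpha> x) (b x) k) holomorphic_on S"
  unfolding \<eta>_def by (intro holomorphic_intros) auto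

lemma T_holomorphic:
  assumes S: "open S" and \<alpha>: "\<alpha> holomorphic_on S" "\<And>x. x \<in> S \<Longrightarrow> \<alpha> x \<noteq> 0"
    and b: "b holomorphic_on S" "\<And>x. x \<in> S \<Longrightarrow> b x \<noteq> 0"
    and c: "c holomorphic_on S" "\<And>x. x \<in> S \<Longrightarrow> c x \<noteq> 0"
    and d: "d holomorphic_on S" "\<And>x. x \<in> S \<Longrightarrow> d x \<noteq> 0"
    and e: "e holomorphic_on S" "\<And>x. x \<in> S \<Longrightarrow> e x \<noteq> 0"
    and f: "f holomorphic_on S" "\<And>x. x \<in> S \<Longrightarrow> f x \<noteq> 0"
    and g: "g holomorphic_on S" "\<And>x. x \<in> S \<Longrightarrow> g x \<noteq> 0"
    and z: "\<And>x. x \<in> S \<Longrightarrow> norm (\<alpha> x ^ 3 * q\<^sup>2 / (b x * c x * d x * e x * f x * g x)) < 1"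
  shows "(\<lambda>x. T (\<alpha> x) (b x) (c x) (d x) (e x) (f x) (g x)) holomorphic_on S"
  unfolding T_def
proof (rule holomorphic_on_infsum[OF S])
  fix k
  show "(\<lambda>x. T_term (\<alpha> x) (b x) (c x) (d x) (e x) (f x) (g x) k) holomorphic_on S"
    unfolding T_term_def
    by (intro holomorphic_intros \<eta>_holomorphic \<alpha> b c d e f g) (use \<alpha>(2) q_nz in auto)
next
  fix x assume x: "x \<in> S"
  show "\<exists>M. M summable_on UNIV \<and>
    (\<forall>\<^sub>F y in nhds x. \<forall>k\<in>UNIV. norm (T_term (\<alpha> y) (b y) (c y) (d y) (e y) (f y) (g y) k) \<le> M k)"
    by (rule T_term_local_bound[OF S \<alpha> b c d e f g x z[OF x]])
qed

lemma V_holomorphic: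
  assumes S: "open S" and \<alpha>: "\<alpha> holomorphic_on S" "\<And>x. x \<in> S \<Longrightarrow> \<alpha> x \<noteq> 0"
    and b: "b holomorphic_on S" "\<And>x. x \<in> S \<Longrightarrow> b x \<noteq> 0"
    and c: "c holomorphic_on S" "\<And>x. x \<in> S \<Longrightarrow> c x \<noteq> 0"
    and d: "d holomorphic_on S" "\<And>x. x \<in> S \<Longrightarrow> d x \<noteq> 0"
    and e: "e holomorphic_on S" "\<And>x. x \<in> S \<Longrightarrow> e x \<noteq> 0"
    and f: "f holomorphic_on S" "\<And>x. x \<in> S \<Longrightarrow> f x \<noteq> 0"
    and z: "\<And>x. x \<in> S \<Longrightarrow> norm ((\<alpha> x)\<^sup>2 * q\<^sup>2 / (b x * c x * d x * e x * f x)) < 1"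
  shows "(\<lambda>x. V (\<alpha> x) (b x) (c x) (d x) (e x) (f x)) holomorphic_on S"
  unfolding V_def
proof (rule holomorphic_on_infsum[OF S])
  fix n
  have gh: "(\<lambda>x. gg (\<alpha> x * q / u x) (1 / u x) m) holomorphic_on S"
    if "u holomorphic_on S" "\<And>x. x \<in> S \<Longrightarrow> u x \<noteq> 0" for u m
    unfolding gg_def rp_def using that \<alpha> by (intro holomorphic_intros) auto
  show "(\<lambda>x. V_term (\<alpha> x) (b x) (c x) (d x) (e x) (f x) n) holomorphic_on S"
    unfolding V_term_def sv_def qp_def[of "_ * q"]
    by (cases "n = 0") (auto intro!: holomorphic_intros gh \<alpha> b c d e f simp: qp_q_nz)
next
  fix x assume x: "x \<in> S"
  \<comment> \<open>Two factors \<open>t\<close> come from the square of \<open>\<alpha>\<close> and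
    five from the factors \<open>gg\<close>.\<close>
  obtain t where t: "t > 1" "t ^ 7 * norm ((\<alpha> x)\<^sup>2 * q\<^sup>2 / (b x * c x * d x * e x * f x)) < 1"
    using ex_growth_factor[OF z[OF x]] by blast
  have nz: "\<alpha> x \<noteq> 0" "b x \<noteq> 0" "c x \<noteq> 0" "d x \<noteq> 0" "e x \<noteq> 0" "f x \<noteq> 0"
    using x \<alpha> b c d e f by auto
  define \<rho> where "\<rho> = t * norm (\<alpha> x)"
  have \<rho>: "\<rho> > 0" using nz t(1) by (simp add: \<rho>_def)
  have ev: "\<exists>C. \<forall>\<^sub>F y in nhds x. \<forall>n. norm (gg (\<alpha> y * q / u y) (1 / u y) n) \<le> C * (t * norm (1 / u x)) ^ n"
    if u: "u holomorphic_on S" "\<And>x. x \<in> S \<Longrightarrow> u x \<noteq> 0" for u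
  proof -
    have "\<forall>\<^sub>F y in nhds x. norm (1 / u y) \<le> t * norm (1 / u x)"
      by (rule eventually_norm_le_factor[where S = S]) (use u x S t in \<open>auto intro!: holomorphic_intros\<close>)
    moreover have "\<forall>\<^sub>F y in nhds x. norm (\<alpha> y * q / u y) \<le> t * norm (\<alpha> x * q / u x)"
      by (rule eventually_norm_le_factor[where S = S]) (use u x S t \<alpha> q_nz in \<open>auto intro!: holomorphic_intros\<close>)
    ultimately have "\<forall>\<^sub>F y in nhds x. \<forall>n. norm (gg (\<alpha> y * q / u y) (1 / u y) n)
        \<le> K (t * norm (\<alpha> x * q / u x)) * K (1 / (t * norm (1 / u x))) * (t * norm (1 / u x)) ^ n"
    proof eventually_elim
      case (elim y)
      then show ?case
        using u(2)[OF x] t(1) by (intro allI norm_gg_le) auto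
    qed
    then show ?thesis by blast
  qed
  obtain C1 where C1: "\<forall>\<^sub>F y in nhds x. \<forall>n. norm (gg (\<alpha> y * q / b y) (1 / b y) n) \<le> C1 * (t * norm (1 / b x)) ^ n"
    using ev[OF b] by blast
  obtain C2 where C2: "\<forall>\<^sub>F y in nhds x. \<forall>n. norm (gg (\<alpha> y * q / c y) (1 / c y) n) \<le> C2 * (t * norm (1 / c x)) ^ n"
    using ev[OF c] by blast
  obtain C3 where C3: "\<forall>\<^sub>F y in nhds x. \<forall>n. norm (gg (\<alpha> y * q / d y) (1 / d y) n) \<le> C3 * (t * norm (1 / d x)) ^ n"
    using ev[OF d] by blast
  obtain C4 where C4: "\<forall>\<^sub>F y in nhds x. \<forall>n. norm (gg (\<alpha> y * q / e y) (1 / e y) n) \<le> C4 * (t * norm (1 / e x)) ^ n"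
    using ev[OF e] by blast
  obtain C5 where C5: "\<forall>\<^sub>F y in nhds x. \<forall>n. norm (gg (\<alpha> y * q / f y) (1 / f y) n) \<le> C5 * (t * norm (1 / f x)) ^ n"
    using ev[OF f] by blast
  define C0 where "C0 = (1 + \<rho>) * K \<rho> * (K (norm q) / norm (qP q))"
  have C0: "C0 \<ge> 0" using \<rho> K_pos by (simp add: C0_def less_imp_le)
  define \<kappa> where "\<kappa> = t ^ 7 * norm ((\<alpha> x)\<^sup>2 * q\<^sup>2 / (b x * c x * d x * e x * f x))"
  define M where "M = (\<lambda>n. C0 * C1 * C2 * C3 * C4 * C5 * \<kappa> ^ n)"
  have "M summable_on UNIV"
    unfolding M_def using t
    by (intro norm_summable_imp_summable_on)
       (auto simp: \<kappa>_def abs_mult power_abs intro!: summable_mult summable_geometric)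
  moreover have "\<forall>\<^sub>F y in nhds x. norm (\<alpha> y) \<le> \<rho>"
    unfolding \<rho>_def using eventually_norm_le_factor[OF \<alpha>(1) S x nz(1) t(1)] by auto
  with C1 C2 C3 C4 C5
  have "\<forall>\<^sub>F y in nhds x. \<forall>n\<in>UNIV. norm (V_term (\<alpha> y) (b y) (c y) (d y) (e y) (f y) n) \<le> M n"
  proof eventually_elim
    case (elim y)
    have "norm (V_term (\<alpha> y) (b y) (c y) (d y) (e y) (f y) n) \<le> M n" for n
    proof -
      have h: "norm (sv (\<alpha> y) n / qp q n * (- ((\<alpha> y)\<^sup>2 * q\<^sup>2)) ^ n) \<le> C0 * (\<rho>\<^sup>2 * (norm q)\<^sup>2) ^ n"
      proof -
        have "norm (sv (\<alpha> y) n * (1 / qp q n)) \<le> C0"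
          unfolding norm_mult C0_def using \<rho> K_pos[of \<rho>]
          by (intro mult_mono norm_sv_le elim(6) norm_inverse_qp_le qP_q_nz) auto
        moreover have "norm ((- ((\<alpha> y)\<^sup>2 * q\<^sup>2)) ^ n) \<le> (\<rho>\<^sup>2 * (norm q)\<^sup>2) ^ n"
          unfolding norm_power norm_minus_cancel norm_mult
          using elim(6) by (intro power_mono mult_right_mono) auto
        ultimately show ?thesis
          unfolding norm_mult[of "_ / _"] using C0 by (intro mult_mono) auto
      qed
      have "V_term (\<alpha> y) (b y) (c y) (d y) (e y) (f y) n = sv (\<alpha> y) n / qp q n * (- ((\<alpha> y)\<^sup>2 * q\<^sup>2)) ^ n
        * gg (\<alpha> y * q / b y) (1 / b y) n * gg (\<alpha> y * q / c y) (1 / c y) n * gg (\<alpha> y * q / d y) (1 / d y) n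
        * gg (\<alpha> y * q / e y) (1 / e y) n * gg (\<alpha> y * q / f y) (1 / f y) n"
        by (simp add: V_term_def mult_ac)
      also have "norm \<dots> \<le> C0 * C1 * C2 * C3 * C4 * C5 * ((\<rho>\<^sup>2 * (norm q)\<^sup>2) * (t * norm (1 / b x)) * (t * norm (1 / c x))
        * (t * norm (1 / d x)) * (t * norm (1 / e x)) * (t * norm (1 / f x))) ^ n"
        by (rule norm_prod6_le) (use h elim in blast)+
      also have "(\<rho>\<^sup>2 * (norm q)\<^sup>2) * (t * norm (1 / b x)) * (t * norm (1 / c x))
        * (t * norm (1 / d x)) * (t * norm (1 / e x)) * (t * norm (1 / f x)) = \<kappa>"
        by (simp add: \<kappa>_def \<rho>_def norm_mult norm_divide norm_power eval_nat_numeral)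
      finally show ?thesis
        by (simp add: M_def)
    qed
    then show ?case by blast
  qed
  ultimately show "\<exists>M. M summable_on UNIV \<and>
    (\<forall>\<^sub>F y in nhds x. \<forall>n\<in>UNIV. norm (V_term (\<alpha> y) (b y) (c y) (d y) (e y) (f y) n) \<le> M n)"
    by blast
qed

lemma T_perm:
  "T a c b d e f g = T a b c d e f g" "T a b d c e f g = T a b c d e f g" "T a b c e d f g = T a b c d e f g"
  by (simp_all add: T_def T_term_def mult_ac)

section \<open>Division of the bilateral series by its theta factor\<close>

lemma \<theta>_nz_imp:
  assumes "\<theta> x \<noteq> 0"
  shows "qP x \<noteq> 0" "qP (q / x) \<noteq> 0" "qP (x * q) \<noteq> 0" "x \<noteq> 1"
  using assms qP_shift_nz[of x 1] \<theta>_1 by (auto simp: \<theta>_def)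

lemma \<theta>_inverse_nz: "x \<noteq> 0 \<Longrightarrow> \<theta> (1 / x) \<noteq> 0 \<longleftrightarrow> \<theta> x \<noteq> 0"
  by (simp add: \<theta>_inverse)

lemma \<theta>_rec: "\<theta> x = (1 - x) * qP (x * q) * qP (q / x)"
  unfolding \<theta>_def by (subst qP_rec) simp

lemma \<theta>_q2:
  assumes "x \<noteq> 0"
  shows "\<theta> (x * q\<^sup>2) = \<theta> x / (q * x\<^sup>2)"
proof -
  have "\<theta> (q * (q * x)) = \<theta> x / x / (q * x)"
    using \<theta>_q[of "q * x"] \<theta>_q[OF assms] assms q_nz by simp
  moreover have "x * q\<^sup>2 = q * (q * x)" "q * x\<^sup>2 = x * (q * x)"
    by (simp_all add: power2_eq_square)
  ultimately show ?thesis by (simp only: divide_divide_eq_left)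
qed

lemma theta_square_zeros:
  assumes "a \<noteq> 0"
  shows "(\<lambda>y. \<theta> (a * y\<^sup>2)) holomorphic_on - {0}"
    and "\<And>z. z \<in> - {0} \<Longrightarrow> \<theta> (a * z\<^sup>2) = 0 \<Longrightarrow> deriv (\<lambda>y. \<theta> (a * y\<^sup>2)) z \<noteq> 0"
proof -
  show "(\<lambda>y. \<theta> (a * y\<^sup>2)) holomorphic_on - {0}"
    using assms by (auto intro!: holomorphic_intros)
  fix z :: complex assume z: "z \<in> - {0}" "\<theta> (a * z\<^sup>2) = 0"
  have nz: "a * z\<^sup>2 \<noteq> 0" using z assms by simp
  have "(\<theta> has_field_derivative deriv \<theta> (a * z\<^sup>2)) (at (a * z\<^sup>2))"
    using \<theta>_field_differentiable[OF nz] DERIV_deriv_iff_field_differentiable by blast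
  then have "((\<lambda>y. \<theta> (a * y\<^sup>2)) has_field_derivative deriv \<theta> (a * z\<^sup>2) * (a * (2 * z))) (at z)"
    by (rule DERIV_chain2) (auto intro!: derivative_eq_intros)
  then have "deriv (\<lambda>y. \<theta> (a * y\<^sup>2)) z = deriv \<theta> (a * z\<^sup>2) * (a * (2 * z))"
    by (rule DERIV_imp_deriv)
  then show "deriv (\<lambda>y. \<theta> (a * y\<^sup>2)) z \<noteq> 0"
    using deriv_\<theta>_nz[OF nz z(2)] z assms by simp
qed

text \<open>When \<open>y\<close> becomes \<open>q * y\<close>, the series is divided by
  \<open>(a y^2)^3 q^2\<close> and the theta factor by \<open>q (a y^2)^2\<close>; the ratio of
  these monomials is the \<open>a q y^2\<close> of the conclusion. The argument of the series is the
  same for all \<open>y\<close>, so one convergence condition covers the punctured plane.\<close>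

lemma T_theta_quotient:
  assumes nz: "a \<noteq> 0" "b \<noteq> 0" "c \<noteq> 0" "d \<noteq> 0" "e \<noteq> 0" "f \<noteq> 0" "g \<noteq> 0"
    and z: "norm (a ^ 3 * q\<^sup>2 / (b * c * d * e * f * g)) < 1"
  obtains P where "P holomorphic_on - {0}"
    "\<And>y. y \<noteq> 0 \<Longrightarrow> T (a * y\<^sup>2) (b * y) (c * y) (d * y) (e * y) (f * y) (g * y) = \<theta> (a * y\<^sup>2) * P y"
    "\<And>y. y \<noteq> 0 \<Longrightarrow> P (q * y) = P y / (a * q * y\<^sup>2)"
proof -
  define F where "F = (\<lambda>y. T (a * y\<^sup>2) (b * y) (c * y) (d * y) (e * y) (f * y) (g * y))"
  have opn: "open (- {0 :: complex})" by (simp add: open_Compl)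
  have F: "F holomorphic_on - {0}"
    unfolding F_def
  proof (rule T_holomorphic[OF opn])
    fix y :: complex assume "y \<in> - {0}"
    then have "(a * y\<^sup>2) ^ 3 * q\<^sup>2 / (b * y * (c * y) * (d * y) * (e * y) * (f * y) * (g * y))
        = a ^ 3 * q\<^sup>2 / (b * c * d * e * f * g)"
      by (simp add: eval_nat_numeral mult_ac)
    then show "norm ((a * y\<^sup>2) ^ 3 * q\<^sup>2 / (b * y * (c * y) * (d * y) * (e * y) * (f * y) * (g * y))) < 1"
      using z by simp
  qed (use nz in \<open>auto intro!: holomorphic_intros\<close>)
  have zeros: "F y = 0" if "y \<noteq> 0" "\<theta> (a * y\<^sup>2) = 0" for y
    unfolding F_def by (rule T_eq_0) (use that nz in auto)
  obtain P where P: "P holomorphic_on - {0}" "\<And>y. y \<in> - {0} \<Longrightarrow> F y = \<theta> (a * y\<^sup>2) * P y"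
    by (rule holomorphic_division_simple_zeros[OF opn F theta_square_zeros(1)[OF nz(1)]])
       (use zeros theta_square_zeros(2)[OF nz(1)] in auto)
  have Fq: "F (q * y) = F y / ((a * y\<^sup>2) ^ 3 * q\<^sup>2)" if "y \<noteq> 0" for y
    using T_shift[of "a * y\<^sup>2" "b * y" "c * y" "d * y" "e * y" "f * y" "g * y"] nz that
    by (simp add: F_def power_mult_distrib mult_ac)
  have *: "P (q * y) * (a * q * y\<^sup>2) - P y = 0" if y: "y \<noteq> 0" "\<theta> (a * y\<^sup>2) \<noteq> 0" for y
  proof -
    have eq: "a * (q * y)\<^sup>2 = a * y\<^sup>2 * q\<^sup>2"
      by (simp add: power_mult_distrib)
    have ay: "a * y\<^sup>2 \<noteq> 0" using y nz by simp
    have "\<theta> (a * y\<^sup>2) / (q * (a * y\<^sup>2)\<^sup>2) * P (q * y) = \<theta> (a * (q * y)\<^sup>2) * P (q * y)"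
      unfolding eq \<theta>_q2[OF ay] ..
    also have "\<dots> = F (q * y)"
      using P(2)[of "q * y"] y q_nz by simp
    also have "\<dots> = F y / ((a * y\<^sup>2) ^ 3 * q\<^sup>2)"
      by (rule Fq[OF y(1)])
    also have "F y = \<theta> (a * y\<^sup>2) * P y"
      using P(2)[of y] y by simp
    finally have "\<theta> (a * y\<^sup>2) / (q * (a * y\<^sup>2)\<^sup>2) * P (q * y) = \<theta> (a * y\<^sup>2) * P y / ((a * y\<^sup>2) ^ 3 * q\<^sup>2)" .
    moreover have "X / (q * W\<^sup>2) * P1 = X * P0 / (W ^ 3 * q\<^sup>2) \<longleftrightarrow> P1 * (q * W) = P0"
      if "X \<noteq> 0" "W \<noteq> 0" for X W P0 P1 :: complex
      using that q_nz by (auto simp: field_simps eval_nat_numeral)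
    ultimately have "P (q * y) * (q * (a * y\<^sup>2)) = P y"
      using y nz by simp
    then show ?thesis by (simp add: mult_ac)
  qed
  define D where "D = (\<lambda>y. P (q * y) * (a * q * y\<^sup>2) - P y)"
  have "(P \<circ> (\<lambda>y. q * y)) holomorphic_on - {0}"
  proof (rule holomorphic_on_compose_gen[OF _ P(1)])
    show "(\<lambda>y. q * y) holomorphic_on - {0}"
      by (intro holomorphic_intros)
    show "(\<lambda>y. q * y) ` (- {0}) \<subseteq> - {0}"
      using q_nz by auto
  qed
  then have "(\<lambda>y. P (q * y)) holomorphic_on - {0}"
    by (simp only: o_def)
  then have "D holomorphic_on - {0}"
    unfolding D_def by (intro holomorphic_intros P(1))
  then have cont: "continuous_on (- {0}) D"
    by (rule holomorphic_on_imp_continuous_on)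
  have D0: "D y = 0" if "y \<noteq> 0" for y
  proof (rule continuous_eq_0_off_simple_zeros[OF opn theta_square_zeros[OF nz(1)] cont])
    show "D z = 0" if "z \<in> - {0}" "\<theta> (a * z\<^sup>2) \<noteq> 0" for z
      using *[of z] that by (simp add: D_def)
  qed (use that in auto)
  have "P (q * y) = P y / (a * q * y\<^sup>2)" if "y \<noteq> 0" for y
  proof -
    have "a * q * y\<^sup>2 \<noteq> 0" using that nz q_nz by simp
    moreover have "P (q * y) * (a * q * y\<^sup>2) = P y"
      using D0[OF that] by (simp only: D_def right_minus_eq)
    ultimately show ?thesis
      by (rule nonzero_eq_divide_eq[THEN iffD2])
  qed
  then show ?thesis
    using that[OF P(1)] P(2) by (simp add: F_def)
qed

section \<open>The three-term relation\<close>

text \<open>The conditions under which, after scaling by \<open>1/c\<close>, \<open>1/d\<close> and \<open>1/e\<close>, Bailey's transformation applies,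
  and under which \<open>1/c, 1/d, 1/e, b/a\<close> are distinct modulo powers of \<open>q\<close>.\<close>

definition generic where
  "generic a b c d e f g m \<longleftrightarrow> (\<forall>x\<in>{
     c\<^sup>2 / a, c\<^sup>2 / m, c / b, c / d, c / e, c / f, c / g, c * a / (m * f), c * a / (m * g),
     d\<^sup>2 / a, d\<^sup>2 / m, d / b, d / c, d / e, d / f, d / g, d * a / (m * f), d * a / (m * g),
     e\<^sup>2 / a, e\<^sup>2 / m, e / b, e / c, e / d, e / f, e / g, e * a / (m * f), e * a / (m * g),
     m / a, b * c / a, b * d / a, b * e / a, b\<^sup>2 / a}. \<theta> x \<noteq> 0)"

text \<open>At \<open>y = 1 / c\<close> the parameter \<open>c * y\<close> is 1. Reflection turns
  the base \<open>a / c^2\<close> into \<open>A\<close> and this parameter into \<open>A\<close> as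
  well, so that the reflected series has its base among its parameters and is unilateral; the same
  happens with \<open>L\<close> on the other side. \<open>A\<close> and \<open>L\<close> are related
  exactly as the two bases of Bailey's transformation.\<close>

lemma center_identity:
  assumes nz: "a \<noteq> 0" "b \<noteq> 0" "c \<noteq> 0" "d \<noteq> 0" "e \<noteq> 0" "f \<noteq> 0" "g \<noteq> 0"
    and m: "m = b * c * d * e / (a * q)"
    and z: "norm (a ^ 3 * q\<^sup>2 / (b * c * d * e * f * g)) < 1" "norm (a * q / (f * g)) < 1"
    and gen: "\<theta> (c\<^sup>2 / a) \<noteq> 0" "\<theta> (c\<^sup>2 / m) \<noteq> 0" "\<theta> (c / b) \<noteq> 0" "\<theta> (c / d) \<noteq> 0" "\<theta> (c / e) \<noteq> 0"
      "\<theta> (c / f) \<noteq> 0" "\<theta> (c / g) \<noteq> 0" "\<theta> (c * a / (m * f)) \<noteq> 0" "\<theta> (c * a / (m * g)) \<noteq> 0" "\<theta> (m / a) \<noteq> 0"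
    and P: "\<And>y. y \<noteq> 0 \<Longrightarrow> T (a * y\<^sup>2) (b * y) (c * y) (d * y) (e * y) (f * y) (g * y) = \<theta> (a * y\<^sup>2) * P y"
    and R: "\<And>y. y \<noteq> 0 \<Longrightarrow> T (m * y\<^sup>2) (b * y) (c * y) (d * y) (e * y) (m * f / a * y) (m * g / a * y) = \<theta> (m * y\<^sup>2) * R y"
  shows "qP (b * c / a) * qP (b * d / a) * qP (b * e / a) * qP (a\<^sup>2 * q / (m * f * g)) * P (1 / c) * \<theta> (d * e / a)
    = qP (a * q / (c * d)) * qP (a * q / (c * e)) * qP (a * q / (d * e)) * qP (a * q / (f * g))
      * \<theta> (a * q / (b * c)) * R (1 / c)"
proof -
  define A where "A = c\<^sup>2 / a"
  define L where "L = c\<^sup>2 / m"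
  have m0: "m \<noteq> 0" using nz q_nz by (simp add: m)
  have AL: "A \<noteq> 0" "L \<noteq> 0" using nz m0 by (simp_all add: A_def L_def)
  have L: "L = q * A\<^sup>2 / (c * b / a * (c * d / a) * (c * e / a))"
    using nz q_nz by (simp add: L_def A_def m field_simps eval_nat_numeral)
  have fg: "L * q / (c * f / a * (c * g / a)) = a\<^sup>2 * q / (m * f * g)" "A * q / (c * f / a * (c * g / a)) = a * q / (f * g)"
    using nz m0 by (simp_all add: L_def A_def field_simps eval_nat_numeral)
  have zz: "a\<^sup>2 * q / (m * f * g) = a ^ 3 * q\<^sup>2 / (b * c * d * e * f * g)"
    using nz q_nz by (simp add: m field_simps eval_nat_numeral)
  have Lx: "L * (c * b / a) / A = c * b / m" "L * (c * d / a) / A = c * d / m" "L * (c * e / a) / A = c * e / m"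
    using nz m0 by (simp_all add: L_def A_def)
  have bailey: "qP (L * q) * qP (a\<^sup>2 * q / (m * f * g)) * V A (c * b / a) (c * d / a) (c * e / a) (c * f / a) (c * g / a)
    = qP (A * q) * qP (a * q / (f * g)) * V L (c * b / m) (c * d / m) (c * e / m) (c * f / a) (c * g / a)"
  proof -
    have q1: "A * q / (c * y / a) = c / y * q" if "y \<noteq> 0" for y
      using nz that by (simp add: A_def field_simps eval_nat_numeral)
    have q2: "L * q / (c * y / a) = c * a / (m * y) * q" if "y \<noteq> 0" for y
      using nz m0 that by (simp add: L_def field_simps eval_nat_numeral)
    have q3: "A / L = m / a"
      using nz m0 by (simp add: L_def A_def)
    show ?thesis
    proof (rule bailey_two_term_V[of A "c * b / a" "c * d / a" "c * e / a" "c * f / a" "c * g / a" L, unfolded fg Lx])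
      show "L = q * A\<^sup>2 / (c * b / a * (c * d / a) * (c * e / a))" by (rule L)
      show "norm (a\<^sup>2 * q / (m * f * g)) < 1" "norm (a * q / (f * g)) < 1"
        using z zz by simp_all
      show "qP A \<noteq> 0" "qP L \<noteq> 0"
        using gen \<theta>_nz_imp(1) by (auto simp: A_def L_def)
      show "qP (A * q / (c * b / a)) \<noteq> 0" "qP (A * q / (c * d / a)) \<noteq> 0" "qP (A * q / (c * e / a)) \<noteq> 0"
        "qP (A * q / (c * f / a)) \<noteq> 0" "qP (A * q / (c * g / a)) \<noteq> 0"
        unfolding q1[OF nz(2)] q1[OF nz(4)] q1[OF nz(5)] q1[OF nz(6)] q1[OF nz(7)]
        by (intro \<theta>_nz_imp(3) gen)+
      show "qP (L * q / (c * f / a)) \<noteq> 0" "qP (L * q / (c * g / a)) \<noteq> 0"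
        unfolding q2[OF nz(6)] q2[OF nz(7)] by (intro \<theta>_nz_imp(3) gen)+
      show "\<theta> (A / L) \<noteq> 0"
        unfolding q3 by (rule gen)
    qed (use nz AL in auto)
  qed
  have TA: "T (a / c\<^sup>2) (b / c) 1 (d / c) (e / c) (f / c) (g / c)
    = - ((1 - A) * qP q * qP (q / A) * (qP (a * q / (b * c)) * qP (a * q / (c * d)) * qP (a * q / (c * e))
       * (qP (a * q / (c * f)) * qP (a * q / (c * g)))) * V A (c * b / a) (c * d / a) (c * e / a) (c * f / a) (c * g / a)) / A"
  proof -
    have "T (a / c\<^sup>2) (b / c) 1 (d / c) (e / c) (f / c) (g / c)
      = T (1 / A) (A / A) (c * b / a / A) (c * d / a / A) (c * e / a / A) (c * f / a / A) (c * g / a / A)"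
      using nz by (subst T_perm(1)) (simp add: A_def power2_eq_square)
    also have "\<dots> = - T A A (c * b / a) (c * d / a) (c * e / a) (c * f / a) (c * g / a) / A"
      by (rule T_reflect[OF AL(1)])
    also have "T A A (c * b / a) (c * d / a) (c * e / a) (c * f / a) (c * g / a) =
      (1 - A) * qP q * qP (q / A) * (qP (q / (c * b / a)) * qP (q / (c * d / a)) * qP (q / (c * e / a))
       * (qP (q / (c * f / a)) * qP (q / (c * g / a)))) * V A (c * b / a) (c * d / a) (c * e / a) (c * f / a) (c * g / a)"
      by (rule T_unilateral) (use nz AL in auto)
    finally show ?thesis
      by (simp add: mult_ac)
  qed
  have TL: "T (m / c\<^sup>2) (b / c) 1 (d / c) (e / c) (m * f / a / c) (m * g / a / c)
    = - ((1 - L) * qP q * qP (q / L) * (qP (d * e / a) * qP (b * e / a) * qP (b * d / a)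
       * (qP (a * q / (c * f)) * qP (a * q / (c * g)))) * V L (c * b / m) (c * d / m) (c * e / m) (c * f / a) (c * g / a)) / L"
  proof -
    have "T (m / c\<^sup>2) (b / c) 1 (d / c) (e / c) (m * f / a / c) (m * g / a / c)
      = T (1 / L) (L / L) (c * b / m / L) (c * d / m / L) (c * e / m / L) (c * f / a / L) (c * g / a / L)"
      using nz m0 by (subst T_perm(1)) (simp add: L_def power2_eq_square mult_ac)
    also have "\<dots> = - T L L (c * b / m) (c * d / m) (c * e / m) (c * f / a) (c * g / a) / L"
      by (rule T_reflect[OF AL(2)])
    also have "T L L (c * b / m) (c * d / m) (c * e / m) (c * f / a) (c * g / a) =
      (1 - L) * qP q * qP (q / L) * (qP (q / (c * b / m)) * qP (q / (c * d / m)) * qP (q / (c * e / m))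
       * (qP (q / (c * f / a)) * qP (q / (c * g / a)))) * V L (c * b / m) (c * d / m) (c * e / m) (c * f / a) (c * g / a)"
      by (rule T_unilateral) (use nz AL m0 in auto)
    also have "q / (c * b / m) = d * e / a"
      using nz q_nz by (simp add: m field_simps)
    also have "q / (c * d / m) = b * e / a"
      using nz q_nz by (simp add: m field_simps)
    also have "q / (c * e / m) = b * d / a"
      using nz q_nz by (simp add: m field_simps)
    finally show ?thesis
      by (simp add: mult_ac)
  qed
  have 1: "\<theta> (m / c\<^sup>2) = - ((1 - L) * qP (L * q) * qP (q / L)) / L"
  proof -
    have "m / c\<^sup>2 = 1 / L" by (simp add: L_def)
    then show ?thesis by (simp only: \<theta>_inverse[OF AL(2)] \<theta>_rec[of L])
  qed
  have 2: "\<theta> (a / c\<^sup>2) = - ((1 - A) * qP (A * q) * qP (q / A)) / A"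
  proof -
    have "a / c\<^sup>2 = 1 / A" by (simp add: A_def)
    then show ?thesis by (simp only: \<theta>_inverse[OF AL(1)] \<theta>_rec[of A])
  qed
  have 3: "\<theta> (d * e / a) = qP (d * e / a) * qP (a * q / (d * e))"
    "\<theta> (a * q / (b * c)) = qP (a * q / (b * c)) * qP (b * c / a)"
    using q_nz by (simp_all add: \<theta>_def mult_ac)
  \<comment> \<open>Everything that the two sides share; what is left of them is the relation
    \<open>bailey\<close>.\<close>
  define W where "W = (1 - A) * (1 - L) * qP q * qP (q / A) * qP (q / L) / (A * L)
    * qP (b * c / a) * qP (b * d / a) * qP (b * e / a) * qP (a * q / (b * c)) * qP (a * q / (c * d)) * qP (a * q / (c * e))
    * qP (a * q / (c * f)) * qP (a * q / (c * g)) * qP (d * e / a) * qP (a * q / (d * e))"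
  have P1: "T (a / c\<^sup>2) (b / c) 1 (d / c) (e / c) (f / c) (g / c) = \<theta> (a / c\<^sup>2) * P (1 / c)"
    using P[of "1 / c"] nz by (simp add: power_one_over)
  have R1: "T (m / c\<^sup>2) (b / c) 1 (d / c) (e / c) (m * f / a / c) (m * g / a / c) = \<theta> (m / c\<^sup>2) * R (1 / c)"
    using R[of "1 / c"] nz by (simp add: power_one_over)
  have "\<theta> (1 / (c\<^sup>2 / a)) \<noteq> 0" "\<theta> (1 / (c\<^sup>2 / m)) \<noteq> 0"
    using gen(1,2) nz m0 by (subst \<theta>_inverse_nz; simp)+
  then have N: "\<theta> (a / c\<^sup>2) * \<theta> (m / c\<^sup>2) \<noteq> 0"
    by simp
  have "\<theta> (a / c\<^sup>2) * \<theta> (m / c\<^sup>2) *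
      (qP (b * c / a) * qP (b * d / a) * qP (b * e / a) * qP (a\<^sup>2 * q / (m * f * g)) * P (1 / c) * \<theta> (d * e / a))
    = qP (b * c / a) * qP (b * d / a) * qP (b * e / a) * qP (a\<^sup>2 * q / (m * f * g))
      * T (a / c\<^sup>2) (b / c) 1 (d / c) (e / c) (f / c) (g / c) * \<theta> (m / c\<^sup>2) * \<theta> (d * e / a)"
    unfolding P1 by (simp only: mult_ac)
  also have "\<dots> = W * (qP (L * q) * qP (a\<^sup>2 * q / (m * f * g)) * V A (c * b / a) (c * d / a) (c * e / a) (c * f / a) (c * g / a))"
    unfolding TA 1 3 W_def by (simp add: mult_ac)
  also have "\<dots> = W * (qP (A * q) * qP (a * q / (f * g)) * V L (c * b / m) (c * d / m) (c * e / m) (c * f / a) (c * g / a))"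
    unfolding bailey ..
  also have "\<dots> = qP (a * q / (c * d)) * qP (a * q / (c * e)) * qP (a * q / (d * e)) * qP (a * q / (f * g))
      * \<theta> (a / c\<^sup>2) * \<theta> (a * q / (b * c))
      * T (m / c\<^sup>2) (b / c) 1 (d / c) (e / c) (m * f / a / c) (m * g / a / c)"
    unfolding TL 2 3 W_def by (simp add: mult_ac)
  also have "\<dots> = \<theta> (a / c\<^sup>2) * \<theta> (m / c\<^sup>2) *
     (qP (a * q / (c * d)) * qP (a * q / (c * e)) * qP (a * q / (d * e)) * qP (a * q / (f * g))
      * \<theta> (a * q / (b * c)) * R (1 / c))"
    unfolding R1 by (simp only: mult_ac)
  finally show ?thesis
    by (simp only: mult_left_cancel[OF N])
qed

text \<open>The factor \<open>qP (b\<^sup>2 * q / a)\<close>, shared with \<open>coefB\<close>, is a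
  denominator of the last term. At \<open>y = b / a\<close> it completes the products of the
  unilateral series to \<open>\<theta> (b\<^sup>2 / a)\<close>.\<close>

definition coefA where
  "coefA a b c d e f g m = qP (b * c / a) * qP (b * d / a) * qP (b * e / a) * qP (a\<^sup>2 * q / (m * f * g)) * qP (b\<^sup>2 * q / a)"

definition coefB where
  "coefB a b c d e f g = qP (a * q / (c * d)) * qP (a * q / (c * e)) * qP (a * q / (d * e)) * qP (a * q / (f * g)) * qP (b\<^sup>2 * q / a)"

text \<open>The constant is determined by the zero at \<open>y = b / a\<close>: there
  \<open>\<theta> (c * d * e / a * y)\<close> has its argument lowered by one factor
  \<open>q\<close>, which costs \<open>- (a^2 q/(bcde))\<close>, and \<open>a q/(cde)\<close> times
  \<open>1 / y\<close> compensates for this.\<close>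

definition coefC where
  "coefC a b c d e f g m = a * q / (c * d * e) * (qP q * qP (a * q / (b * f)) * qP (a * q / (b * g))
     * \<theta> (b * c * d * e / (a\<^sup>2 * q)) * qP (a\<^sup>2 * q / (m * f * g))
     * V (b\<^sup>2 / a) (b * c / a) (b * d / a) (b * e / a) (b * f / a) (b * g / a))"

definition defect where
  "defect a b c d e f g m = coefA a b c d e f g m * (T a b c d e f g * \<theta> m * \<theta> (c * d * e / a))
     - coefB a b c d e f g * (\<theta> a * \<theta> (a * q / b) * T m b c d e (m * f / a) (m * g / a))
     + coefC a b c d e f g m * (\<theta> a * \<theta> m * (\<theta> c * \<theta> d * \<theta> e))"

theorem defect_generic:
  assumes nz: "a \<noteq> 0" "b \<noteq> 0" "c \<noteq> 0" "d \<noteq> 0" "e \<noteq> 0" "f \<noteq> 0" "g \<noteq> 0"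
    and m: "m = b * c * d * e / (a * q)"
    and z: "norm (a ^ 3 * q\<^sup>2 / (b * c * d * e * f * g)) < 1" "norm (a * q / (f * g)) < 1"
    and gen: "generic a b c d e f g m"
  shows "defect a b c d e f g m = 0"
proof -
  have m0: "m \<noteq> 0" using nz q_nz by (simp add: m)
  obtain P where P: "P holomorphic_on - {0}"
    "\<And>y. y \<noteq> 0 \<Longrightarrow> T (a * y\<^sup>2) (b * y) (c * y) (d * y) (e * y) (f * y) (g * y) = \<theta> (a * y\<^sup>2) * P y"
    "\<And>y. y \<noteq> 0 \<Longrightarrow> P (q * y) = P y / (a * q * y\<^sup>2)"
    using T_theta_quotient[OF nz z(1)] by blast
  have z2: "norm (m ^ 3 * q\<^sup>2 / (b * c * d * e * (m * f / a) * (m * g / a))) < 1"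
  proof -
    have "m ^ 3 * q\<^sup>2 / (b * c * d * e * (m * f / a) * (m * g / a)) = a * q / (f * g)"
      using nz q_nz by (simp add: m field_simps eval_nat_numeral)
    then show ?thesis using z(2) by simp
  qed
  have nzm: "m * f / a \<noteq> 0" "m * g / a \<noteq> 0" using nz m0 by simp_all
  obtain R where R: "R holomorphic_on - {0}"
    "\<And>y. y \<noteq> 0 \<Longrightarrow> T (m * y\<^sup>2) (b * y) (c * y) (d * y) (e * y) (m * f / a * y) (m * g / a * y) = \<theta> (m * y\<^sup>2) * R y"
    "\<And>y. y \<noteq> 0 \<Longrightarrow> R (q * y) = R y / (m * q * y\<^sup>2)"
    using T_theta_quotient[OF m0 nz(2-5) nzm z2] by blast
  \<comment> \<open>The theta factors \<open>\<theta> (c * d * e / a * y)\<close> and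
    \<open>\<theta> (a * q / b * y)\<close> and the factor \<open>1 / y\<close> give the three
    summands the same multiplier; for the second one this uses the value of
    \<open>m\<close>.\<close>
  define D where "D = (\<lambda>y. coefA a b c d e f g m * (P y * \<theta> (c * d * e / a * y))
     - coefB a b c d e f g * (\<theta> (a * q / b * y) * R y)
     + coefC a b c d e f g m * (1 / y * (\<theta> (c * y) * \<theta> (d * y) * \<theta> (e * y))))"
  have hol: "D holomorphic_on - {0}"
    unfolding D_def using nz q_nz by (intro holomorphic_intros P(1) R(1)) auto
  have \<theta>y: "\<theta> (x * (q * y)) = - \<theta> (x * y) / (x * y)" if "x \<noteq> 0" "y \<noteq> 0" for x y
    using \<theta>_q[of "x * y"] that by (simp add: mult_ac)
  have quasi: "D (q * y) * y ^ length [1 / c, 1 / d, 1 / e, b / a] = - (1 / (q * (c * d * e))) * y * D y" if y: "y \<noteq> 0" for y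
  proof -
    define \<kappa> where "\<kappa> = - (1 / (q * (c * d * e)))"
    have 1: "P (q * y) * \<theta> (c * d * e / a * (q * y)) = \<kappa> / y ^ 3 * (P y * \<theta> (c * d * e / a * y))"
      unfolding P(3)[OF y] using y nz q_nz
      by (subst \<theta>y) (simp_all add: \<kappa>_def eval_nat_numeral)
    have 2: "\<theta> (a * q / b * (q * y)) * R (q * y) = \<kappa> / y ^ 3 * (\<theta> (a * q / b * y) * R y)"
      unfolding R(3)[OF y] using y nz q_nz
      by (subst \<theta>y) (simp_all add: \<kappa>_def m eval_nat_numeral)
    have 3: "1 / (q * y) * (\<theta> (c * (q * y)) * \<theta> (d * (q * y)) * \<theta> (e * (q * y)))
        = \<kappa> / y ^ 3 * (1 / y * (\<theta> (c * y) * \<theta> (d * y) * \<theta> (e * y)))"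
      unfolding \<theta>y[OF nz(3) y] \<theta>y[OF nz(4) y] \<theta>y[OF nz(5) y] using y nz q_nz
      by (simp add: \<kappa>_def eval_nat_numeral)
    have "D (q * y) = \<kappa> / y ^ 3 * D y"
      unfolding D_def 1 2 3 by (simp only: distrib_left right_diff_distrib mult_ac)
    then show ?thesis
      using y unfolding \<kappa>_def[symmetric] by (simp add: eval_nat_numeral)
  qed
  have g: "\<theta> x \<noteq> 0" if "x \<in> {
     c\<^sup>2 / a, c\<^sup>2 / m, c / b, c / d, c / e, c / f, c / g, c * a / (m * f), c * a / (m * g),
     d\<^sup>2 / a, d\<^sup>2 / m, d / b, d / c, d / e, d / f, d / g, d * a / (m * f), d * a / (m * g),
     e\<^sup>2 / a, e\<^sup>2 / m, e / b, e / c, e / d, e / f, e / g, e * a / (m * f), e * a / (m * g),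
     m / a, b * c / a, b * d / a, b * e / a, b\<^sup>2 / a}" for x
    using gen that unfolding generic_def by blast
  \<comment> \<open>The three points differ only by which of \<open>c\<close>, \<open>d\<close>,
    \<open>e\<close> is put in front, and \<open>T\<close> is symmetric in its parameters. The third
    summand vanishes because one of its factors is \<open>\<theta> 1\<close>.\<close>
  have zero: "D (1 / u) = 0" if uvw: "(u, v, w) \<in> {(c, d, e), (d, c, e), (e, c, d)}" for u v w
  proof -
    have T_uvw: "T x y u v w f' g' = T x y c d e f' g'" if "(u, v, w) \<in> {(c, d, e), (d, c, e), (e, c, d)}" for x y u v w c d e f' g'
      using that T_perm(2)[of x y c d e f' g'] T_perm(2)[of x y c e d f' g'] T_perm(3)[of x y c d e f' g'] by auto
    have "(u * y, v * y, w * y) \<in> {(c * y, d * y, e * y), (d * y, c * y, e * y), (e * y, c * y, d * y)}" for y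
      using uvw by auto
    note T = T_uvw[OF this]
    have "b * u * v * w = b * c * d * e"
      using uvw by auto
    note m' = m[folded this] z(1)[folded this]
    have "qP (b * u / a) * qP (b * v / a) * qP (b * w / a) * qP (a\<^sup>2 * q / (m * f * g)) * P (1 / u) * \<theta> (v * w / a)
      = qP (a * q / (u * v)) * qP (a * q / (u * w)) * qP (a * q / (v * w)) * qP (a * q / (f * g))
      * \<theta> (a * q / (b * u)) * R (1 / u)"
      by (rule center_identity[OF nz(1,2) _ _ _ nz(6,7) m' z(2)]; (unfold T, erule P(2) R(2))?; (use uvw nz g in auto)?)
    then show ?thesis
      using uvw nz by (auto simp: D_def coefA_def coefB_def mult_ac)
  qed
  then have "D (1 / c) = 0" "D (1 / d) = 0" "D (1 / e) = 0"
    by blast+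
  \<comment> \<open>Here both \<open>b * y\<close> and the base \<open>a y^2\<close> equal
    \<open>b^2/a\<close>, so the first series is unilateral without any reflection. The second
    summand contains \<open>\<theta> q = 0\<close>, and the other two cancel.\<close>
  moreover have "D (b / a) = 0"
  proof -
    define A where "A = b\<^sup>2 / a"
    have A: "A \<noteq> 0" "\<theta> A \<noteq> 0" using nz g[of "b\<^sup>2 / a"] by (simp_all add: A_def)
    define W where "W = V A (b * c / a) (b * d / a) (b * e / a) (b * f / a) (b * g / a)"
    have "T A A (b * c / a) (b * d / a) (b * e / a) (b * f / a) (b * g / a) = \<theta> A * P (b / a)"
      using P(2)[of "b / a"] nz by (simp add: A_def power2_eq_square mult_ac)
    moreover have "T A A (b * c / a) (b * d / a) (b * e / a) (b * f / a) (b * g / a) = (1 - A) * qP q * qP (q / A)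
       * (qP (q / (b * c / a)) * qP (q / (b * d / a)) * qP (q / (b * e / a)) * (qP (q / (b * f / a)) * qP (q / (b * g / a)))) * W"
      unfolding W_def by (rule T_unilateral) (use nz A in auto)
    ultimately have PA: "\<theta> A * P (b / a) = (1 - A) * qP q * qP (q / A)
       * (qP (q / (b * c / a)) * qP (q / (b * d / a)) * qP (q / (b * e / a)) * (qP (q / (b * f / a)) * qP (q / (b * g / a)))) * W"
      by simp
    have th: "\<theta> (b * x / a) = qP (b * x / a) * qP (q / (b * x / a))" for x
      by (simp add: \<theta>_def)
    have tq: "\<theta> (c * d * e / a * (b / a)) = - (a\<^sup>2 * q / (b * c * d * e)) * \<theta> (b * c * d * e / (a\<^sup>2 * q))"
      using \<theta>_q[of "b * c * d * e / (a\<^sup>2 * q)"] nz q_nz by (simp add: power2_eq_square mult_ac)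
    have cA: "coefA a b c d e f g m = qP (b * c / a) * qP (b * d / a) * qP (b * e / a) * qP (a\<^sup>2 * q / (m * f * g)) * qP (A * q)"
      by (simp add: coefA_def A_def)
    have "\<theta> A * (coefA a b c d e f g m * (P (b / a) * \<theta> (c * d * e / a * (b / a))))
      = coefA a b c d e f g m * (\<theta> A * P (b / a)) * \<theta> (c * d * e / a * (b / a))"
      by (simp only: mult_ac)
    also have "\<dots> = ((1 - A) * qP (A * q) * qP (q / A)) * (qP (b * c / a) * qP (q / (b * c / a)))
       * (qP (b * d / a) * qP (q / (b * d / a))) * (qP (b * e / a) * qP (q / (b * e / a)))
       * (qP q * qP (q / (b * f / a)) * qP (q / (b * g / a)) * qP (a\<^sup>2 * q / (m * f * g)) * W)
       * (- (a\<^sup>2 * q / (b * c * d * e)) * \<theta> (b * c * d * e / (a\<^sup>2 * q)))"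
      unfolding PA tq cA by (simp only: mult_ac)
    also have "\<dots> = \<theta> A * (- (coefC a b c d e f g m * (1 / (b / a) * (\<theta> (c * (b / a)) * \<theta> (d * (b / a)) * \<theta> (e * (b / a))))))"
    proof -
      have 1: "c * (b / a) = b * c / a" "d * (b / a) = b * d / a" "e * (b / a) = b * e / a"
        "q / (b * f / a) = a * q / (b * f)" "q / (b * g / a) = a * q / (b * g)"
        by simp_all
      show ?thesis
        unfolding coefC_def A_def[symmetric] W_def[symmetric] \<theta>_rec[of A] th[symmetric] 1
        using nz by (simp add: power2_eq_square mult_ac)
    qed
    finally have "coefA a b c d e f g m * (P (b / a) * \<theta> (c * d * e / a * (b / a)))
      = - (coefC a b c d e f g m * (1 / (b / a) * (\<theta> (c * (b / a)) * \<theta> (d * (b / a)) * \<theta> (e * (b / a)))))"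
      by (simp only: mult_left_cancel[OF A(2)])
    moreover have "\<theta> (a * q / b * (b / a)) = 0"
      using \<theta>_reflect[of 1] nz by simp
    ultimately show ?thesis
      unfolding D_def by simp
  qed
  moreover have "sorted_wrt (\<lambda>x y. \<theta> (y / x) \<noteq> 0) [1 / c, 1 / d, 1 / e, b / a]"
    using nz g[of "c / d"] g[of "c / e"] g[of "d / e"] g[of "b * c / a"] g[of "b * d / a"] g[of "b * e / a"]
    by simp
  ultimately have "D 1 = 0"
    using nz q_nz by (intro quasi_periodic_eq_0[OF hol quasi]) auto
  then have "\<theta> a * \<theta> m * D 1 = 0" by simp
  moreover have "\<theta> a * \<theta> m * D 1 = defect a b c d e f g m"
    using P(2)[of 1] R(2)[of 1] by (simp add: D_def defect_def algebra_simps)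
  ultimately show ?thesis by simp
qed

section \<open>Removal of the genericity conditions\<close>

lemma exists_generic_sequence:
  fixes S :: "(complex \<times> int) set"
  assumes "finite S" and S: "\<And>\<kappa> m. (\<kappa>, m) \<in> S \<Longrightarrow> \<kappa> \<noteq> 0 \<and> m \<noteq> 0"
  obtains t :: "nat \<Rightarrow> real" where "t \<longlonglongrightarrow> 1" "\<And>n. t n > 0"
    "\<And>n \<kappa> m. (\<kappa>, m) \<in> S \<Longrightarrow> \<theta> (\<kappa> * of_real (t n) powi m) \<noteq> 0"
proof -
  \<comment> \<open>If the theta function vanishes at \<open>\<kappa> * t powi m\<close>, comparison
    of norms forces \<open>t powi m = norm q powi j / norm \<kappa>\<close> for some integer
    \<open>j\<close>. \<open>B\<close> contains these \<open>t\<close>; being countable, it misses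
    points of every interval to the right of 1.\<close>
  define B where "B = (\<Union>(\<kappa>, m)\<in>S. \<Union>j::int. {exp (ln (norm q powi j / norm \<kappa>) / of_int m)})"
  have "countable B"
    unfolding B_def using \<open>finite S\<close> by (intro countable_UN) (auto intro: countable_finite)
  have good: "\<theta> (\<kappa> * of_real t powi m) \<noteq> 0" if "t > 0" "t \<notin> B" "(\<kappa>, m) \<in> S" for t \<kappa> m
  proof
    assume 0: "\<theta> (\<kappa> * of_real t powi m) = 0"
    have nz: "\<kappa> \<noteq> 0" "m \<noteq> 0" using S that(3) by auto
    then have "\<kappa> * of_real t powi m \<noteq> 0" using that(1) by simp
    then obtain j where "\<kappa> * of_real t powi m = q powi j"
      using \<theta>_zero_imp 0 by blast
    then have "norm (\<kappa> * of_real t powi m) = norm (q powi j)"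
      by simp
    then have "t powi m = norm q powi j / norm \<kappa>"
      using nz that(1) by (simp add: norm_mult norm_power_int field_simps)
    moreover have "t powi m = exp (of_int m * ln t)"
      using that(1) by (simp add: powr_real_of_int' [symmetric] powr_def)
    ultimately have "ln (norm q powi j / norm \<kappa>) = of_int m * ln t"
      by (metis ln_exp)
    then have "t = exp (ln (norm q powi j / norm \<kappa>) / of_int m)"
      using nz that(1) by simp
    then have "t \<in> B"
      using that(3) by (auto simp: B_def)
    with that(2) show False ..
  qed
  have "\<exists>t. 1 < t \<and> t < 1 + 1 / real (Suc n) \<and> t \<notin> B" for n
  proof -
    have "uncountable ({1<..<1 + 1 / real (Suc n)} - B)"
      using \<open>countable B\<close> by (intro uncountable_minus_countable) (simp_all add: uncountable_open_interval)
    then have "{1<..<1 + 1 / real (Suc n)} - B \<noteq> {}"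
      by (metis countable_empty)
    then show ?thesis by auto
  qed
  then obtain t where t: "\<And>n. 1 < t n" "\<And>n. t n < 1 + 1 / real (Suc n)" "\<And>n. t n \<notin> B"
    by metis
  show ?thesis
  proof (rule that)
    show "t \<longlonglongrightarrow> 1"
    proof (rule tendsto_sandwich)
      show "(\<lambda>n. 1) \<longlonglongrightarrow> (1 :: real)" by simp
      have "(\<lambda>n. 1 + 1 / real (Suc n)) \<longlonglongrightarrow> 1 + 0"
        by (intro tendsto_intros LIMSEQ_Suc[OF lim_1_over_n])
      then show "(\<lambda>n. 1 + 1 / real (Suc n)) \<longlonglongrightarrow> 1" by simp
    qed (use t in \<open>auto intro!: always_eventually less_imp_le\<close>)
    show "t n > 0" for n using t(1)[of n] by simp
    then show "\<theta> (\<kappa> * of_real (t n) powi m) \<noteq> 0" if "(\<kappa>, m) \<in> S" for n \<kappa> m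
      using good t(3) that by blast
  qed
qed

theorem defect_eq_0:
  assumes nz: "a \<noteq> 0" "b \<noteq> 0" "c \<noteq> 0" "d \<noteq> 0" "e \<noteq> 0" "f \<noteq> 0" "g \<noteq> 0"
    and m: "m = b * c * d * e / (a * q)"
    and z: "norm (a ^ 3 * q\<^sup>2 / (b * c * d * e * f * g)) < 1" "norm (a * q / (f * g)) < 1"
  shows "defect a b c d e f g m = 0"
proof -
  have m0: "m \<noteq> 0" using nz q_nz by (simp add: m)
  define z0 where "z0 = a ^ 3 * q\<^sup>2 / (b * c * d * e * f * g)"
  \<comment> \<open>The exponents 1, 2, 3, 4 used below add up to 10: the first argument becomes
    \<open>z0 / t ^ 10\<close> and \<open>m\<close> becomes \<open>m * t ^ 10\<close>, while
    \<open>a * q / (f * g)\<close> does not move. \<open>U\<close> is the set on which the first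
    argument stays inside the unit disc.\<close>
  define U where "U = {t :: complex. t \<noteq> 0 \<and> norm z0 < norm (t ^ 10)}"
  \<comment> \<open>with these exponents every quantity in \<open>generic\<close> contains a nonzero power of \<open>t\<close>\<close>
  define F where "F = (\<lambda>t. defect a (b * t) (c * t ^ 2) (d * t ^ 3) (e * t ^ 4) f g (m * t ^ 10))"
  have U: "open U"
    unfolding U_def by (intro open_Collect_conj open_Collect_neq open_Collect_less continuous_intros)
  have U1: "1 \<in> U" using z by (simp add: U_def z0_def)
  have z1: "norm (a ^ 3 * q\<^sup>2 / (b * t * (c * t ^ 2) * (d * t ^ 3) * (e * t ^ 4) * f * g)) < 1" if "t \<in> U" for t
  proof -
    have "a ^ 3 * q\<^sup>2 / (b * t * (c * t ^ 2) * (d * t ^ 3) * (e * t ^ 4) * f * g) = z0 / t ^ 10"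
      by (simp add: z0_def eval_nat_numeral)
    then show ?thesis
      using that by (simp add: U_def norm_divide)
  qed
  have mt: "m * t ^ 10 = b * t * (c * t ^ 2) * (d * t ^ 3) * (e * t ^ 4) / (a * q)" for t
    by (simp add: m eval_nat_numeral)
  have t0: "t \<noteq> 0" if "t \<in> U" for t using that by (simp add: U_def)
  have hT1: "(\<lambda>t. T a (b * t) (c * t ^ 2) (d * t ^ 3) (e * t ^ 4) f g) holomorphic_on U"
    by (rule T_holomorphic[OF U]) (use nz t0 z1 in \<open>auto intro!: holomorphic_intros\<close>)
  have hT2: "(\<lambda>t. T (m * t ^ 10) (b * t) (c * t ^ 2) (d * t ^ 3) (e * t ^ 4) (m * t ^ 10 * f / a) (m * t ^ 10 * g / a)) holomorphic_on U"
  proof (rule T_holomorphic[OF U])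
    fix t assume t: "t \<in> U"
    have "(m * t ^ 10) ^ 3 * q\<^sup>2 / (b * t * (c * t ^ 2) * (d * t ^ 3) * (e * t ^ 4) * (m * t ^ 10 * f / a) * (m * t ^ 10 * g / a))
      = a * q / (f * g)"
      using nz q_nz t0[OF t] by (simp add: m field_simps eval_nat_numeral)
    then show "norm ((m * t ^ 10) ^ 3 * q\<^sup>2 / (b * t * (c * t ^ 2) * (d * t ^ 3) * (e * t ^ 4) * (m * t ^ 10 * f / a) * (m * t ^ 10 * g / a))) < 1"
      using z(2) by simp
  qed (use nz m0 t0 in \<open>auto intro!: holomorphic_intros\<close>)
  have hV: "(\<lambda>t. V ((b * t)\<^sup>2 / a) (b * t * (c * t ^ 2) / a) (b * t * (d * t ^ 3) / a) (b * t * (e * t ^ 4) / a) (b * t * f / a) (b * t * g / a))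
      holomorphic_on U"
  proof (rule V_holomorphic[OF U])
    fix t assume t: "t \<in> U"
    have "((b * t)\<^sup>2 / a)\<^sup>2 * q\<^sup>2 / (b * t * (c * t ^ 2) / a * (b * t * (d * t ^ 3) / a) * (b * t * (e * t ^ 4) / a) * (b * t * f / a) * (b * t * g / a))
      = a ^ 3 * q\<^sup>2 / (b * t * (c * t ^ 2) * (d * t ^ 3) * (e * t ^ 4) * f * g)"
      using nz q_nz t0[OF t] by (simp add: field_simps eval_nat_numeral)
    then show "norm (((b * t)\<^sup>2 / a)\<^sup>2 * q\<^sup>2 / (b * t * (c * t ^ 2) / a * (b * t * (d * t ^ 3) / a) * (b * t * (e * t ^ 4) / a) * (b * t * f / a) * (b * t * g / a))) < 1"
      using z1[OF t] by simp
  qed (use nz m0 t0 in \<open>auto intro!: holomorphic_intros\<close>)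
  have "F holomorphic_on U"
    unfolding F_def defect_def coefA_def coefB_def coefC_def
    by (intro holomorphic_intros hT1 hT2 hV) (use nz q_nz m0 t0 in auto)
  then have cont: "isCont F 1"
    using U U1 holomorphic_on_imp_continuous_on continuous_on_eq_continuous_at by blast
  define S :: "(complex \<times> int) set" where "S = {
     (c\<^sup>2 / a, 4), (c\<^sup>2 / m, -6), (c / b, 1), (c / d, -1), (c / e, -2), (c / f, 2), (c / g, 2), (c * a / (m * f), -8), (c * a / (m * g), -8),
     (d\<^sup>2 / a, 6), (d\<^sup>2 / m, -4), (d / b, 2), (d / c, 1), (d / e, -1), (d / f, 3), (d / g, 3), (d * a / (m * f), -7), (d * a / (m * g), -7),
     (e\<^sup>2 / a, 8), (e\<^sup>2 / m, -2), (e / b, 3), (e / c, 2), (e / d, 1), (e / f, 4), (e / g, 4), (e * a / (m * f), -6), (e * a / (m * g), -6),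
     (m / a, 10), (b * c / a, 3), (b * d / a, 4), (b * e / a, 5), (b\<^sup>2 / a, 2)}"
  have "finite S" by (simp add: S_def)
  moreover have "\<kappa> \<noteq> 0 \<and> k \<noteq> 0" if "(\<kappa>, k) \<in> S" for \<kappa> k
    using that nz m0 by (auto simp: S_def)
  ultimately obtain t where t: "t \<longlonglongrightarrow> 1" "\<And>n. t n > 0"
    "\<And>n \<kappa> k. (\<kappa>, k) \<in> S \<Longrightarrow> \<theta> (\<kappa> * of_real (t n) powi k) \<noteq> 0"
    using exists_generic_sequence by blast
  have gen: "generic a (b * x) (c * x ^ 2) (d * x ^ 3) (e * x ^ 4) f g (m * x ^ 10)"
    if x: "x \<noteq> 0" "\<And>\<kappa> k. (\<kappa>, k) \<in> S \<Longrightarrow> \<theta> (\<kappa> * x powi k) \<noteq> 0" for x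
  proof -
    have p: "x powi (- numeral n) = 1 / x ^ numeral n" "x powi (- 1) = 1 / x" "x powi (numeral n) = x ^ numeral n" "x powi 1 = x" for n
      by (simp_all add: power_int_minus divide_inverse)
    have "generic a (b * x) (c * x ^ 2) (d * x ^ 3) (e * x ^ 4) f g (m * x ^ 10)
        = (\<forall>y\<in>(\<lambda>(\<kappa>, k). \<kappa> * x powi k) ` S. \<theta> y \<noteq> 0)"
      unfolding generic_def S_def image_insert image_empty prod.case
      by (intro arg_cong2[where f = Ball] arg_cong2[where f = insert] refl)
         (simp_all add: p, use x(1) in \<open>simp_all add: field_simps eval_nat_numeral\<close>)
    then show ?thesis
      using x(2) by auto
  qed
  have tc: "(\<lambda>n. complex_of_real (t n)) \<longlonglongrightarrow> 1"
    using tendsto_of_real[OF t(1), where 'a = complex] by simp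
  have "(\<lambda>n. F (of_real (t n))) \<longlonglongrightarrow> F 1"
    by (rule isCont_tendsto_compose[OF cont tc])
  moreover have "\<forall>\<^sub>F n in sequentially. F (of_real (t n)) = 0"
  proof -
    have "\<forall>\<^sub>F n in sequentially. complex_of_real (t n) \<in> U"
      using tc U U1 by (rule topological_tendstoD)
    then show ?thesis
    proof eventually_elim
      case (elim n)
      have n0: "complex_of_real (t n) \<noteq> 0" using t(2)[of n] by simp
      show ?case
        unfolding F_def
        by (rule defect_generic[OF _ _ _ _ _ _ _ mt z1[OF elim] z(2) gen[OF n0 t(3)]]) (use nz n0 in auto)
    qed
  qed
  then have "(\<lambda>n. F (of_real (t n))) \<longlonglongrightarrow> 0"
    by (rule tendsto_eventually)
  ultimately have "F 1 = 0"
    by (rule LIMSEQ_unique)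
  then show ?thesis
    by (simp add: F_def)
qed

section \<open>Return to the series in the usual notation\<close>

definition rr where "rr x n = (\<Prod>j=1..n. 1 - x / q ^ j)"

lemma rr_0 [simp]: "rr x 0 = 1"
  by (simp add: rr_def)

lemma rr_Suc: "rr x (Suc n) = rr x n * (1 - x / q ^ Suc n)"
  by (simp add: rr_def prod.nat_ivl_Suc')

lemma rr_q: "rr (q * x) (Suc n) = (1 - x) * rr x n"
proof (induction n)
  case 0
  then show ?case using q_nz by (simp add: rr_def)
next
  case (Suc n)
  have "rr (q * x) (Suc (Suc n)) = rr (q * x) (Suc n) * (1 - x / q ^ Suc n)"
    using q_nz by (subst rr_Suc) simp
  then show ?case
    unfolding Suc.IH rr_Suc[of x n] by simp
qed

lemma qpoch_of_nat: "qpoch x q (int n) = qp x n"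
  by (simp add: qpoch_def qp_def)

lemma qpoch_minus_of_nat: "qpoch x q (- int n) = 1 / rr x n"
  by (cases "n = 0") (simp_all add: qpoch_def rr_def)

lemma qP_div_power: "qP (x / q ^ n) = rr x n * qP x"
proof (induction n)
  case (Suc n)
  have "qP (x / q ^ Suc n) = (1 - x / q ^ Suc n) * qP (x / q ^ n)"
    using q_nz by (subst qP_rec) simp
  then show ?case
    unfolding Suc.IH rr_Suc by simp
qed simp

lemma int_nat_cases:
  obtains n where "k = int n" | n where "k = - int n"
  by (metis int_cases2)

text \<open>The reciprocal form also covers \<open>x = q ^ j\<close> with \<open>j \<ge> 1\<close>:
  for \<open>k \<le> - j\<close> both sides are 0, the left one because of
  \<open>1 / 0 = 0\<close>.\<close>

lemma inverse_qpoch: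
  assumes "qP x \<noteq> 0"
  shows "1 / qpoch x q k = qP (x * q powi k) / qP x"
proof (cases k rule: int_nat_cases)
  case (1 n)
  then show ?thesis
    using qP_split[of x n] assms qp_nz[OF assms, of n] by (simp add: qpoch_of_nat field_simps)
next
  case (2 n)
  have "x * q powi (- int n) = x / q ^ n"
    by (simp add: power_int_minus divide_inverse)
  then show ?thesis
    using assms by (simp add: 2 qpoch_minus_of_nat qP_div_power)
qed

lemma rr_reflect:
  assumes "x \<noteq> 0"
  shows "rr x n * q powi (int n * (int n - 1) div 2 + int n) = (- x) ^ n * qp (q / x) n"
proof (induction n)
  case (Suc n)
  have "int (Suc n) * (int (Suc n) - 1) = int n * (int n - 1) + int n * 2"
    by (simp add: algebra_simps)
  then have "int (Suc n) * (int (Suc n) - 1) div 2 + int (Suc n) = (int n * (int n - 1) div 2 + int n) + int (Suc n)"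
    by simp
  then have e: "q powi (int (Suc n) * (int (Suc n) - 1) div 2 + int (Suc n))
      = q powi (int n * (int n - 1) div 2 + int n) * q ^ Suc n"
    using q_nz by (simp only: power_int_add power_int_of_nat simp_thms)
  have "(1 - x / q ^ Suc n) * q ^ Suc n = (- x) * (1 - q / x * q ^ n)"
    using q_nz assms by (simp add: left_diff_distrib right_diff_distrib)
  moreover have "rr x (Suc n) * q powi (int (Suc n) * (int (Suc n) - 1) div 2 + int (Suc n))
    = rr x n * q powi (int n * (int n - 1) div 2 + int n) * ((1 - x / q ^ Suc n) * q ^ Suc n)"
    unfolding e rr_Suc by (simp only: mult_ac)
  ultimately have "rr x (Suc n) * q powi (int (Suc n) * (int (Suc n) - 1) div 2 + int (Suc n))
    = (- x) ^ n * qp (q / x) n * ((- x) * (1 - q / x * q ^ n))"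
    by (simp only: Suc.IH)
  then show ?case
    unfolding qp_Suc by (simp only: power_Suc mult_ac)
qed simp

text \<open>This gives numerators as infinite products for both signs of \<open>k\<close>. For
  nonnegative \<open>k\<close> it combines \<open>triangular_qP\<close> with
  \<open>qp_conv_rp\<close>; for negative \<open>k\<close> it is the reversed product of
  \<open>rr_reflect\<close>.\<close>

lemma qpoch_reflect:
  assumes "x \<noteq> 0" "qP (q / x) \<noteq> 0"
  shows "qpoch x q k = (- x) powi k * (q powi (k * (k - 1) div 2) * qP (q powi (1 - k) / x)) / qP (q / x)"
proof (cases k rule: int_nat_cases)
  case (1 n)
  have "q powi (k * (k - 1) div 2) * qP (q powi (1 - k) / x) = qP (q / x) * rp (1 / x) n"
    using triangular_qP[of n "1 / x"] by (simp add: 1)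
  then show ?thesis
    using assms qp_conv_rp[OF assms(1), of n] by (simp add: 1 qpoch_of_nat)
next
  case (2 n)
  have "- int n * (- int n - 1) = int n * (int n - 1) + int n * 2"
    by (simp add: algebra_simps)
  then have e: "k * (k - 1) div 2 = int n * (int n - 1) div 2 + int n"
    by (simp add: 2)
  have E: "q powi (int n * (int n - 1) div 2 + int n) \<noteq> 0"
    using q_nz by simp
  have qpn: "qp (q / x) n \<noteq> 0" by (rule qp_nz[OF assms(2)])
  have rr: "rr x n = (- x) ^ n * qp (q / x) n / q powi (int n * (int n - 1) div 2 + int n)"
    using rr_reflect[OF assms(1), of n] by (simp only: nonzero_eq_divide_eq[OF E])
  have s: "q powi (1 - k) / x = q / x * q ^ n"
    using q_nz by (simp add: 2 power_int_add)
  have "qP (q / x) = qp (q / x) n * qP (q / x * q ^ n)" by (rule qP_split)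
  moreover have "(- x) powi k = 1 / (- x) ^ n"
    by (simp add: 2 power_int_minus divide_inverse)
  ultimately show ?thesis
    unfolding e s using assms qpn E by (simp add: 2 qpoch_minus_of_nat rr)
qed

lemma qpoch_ratio:
  assumes "b \<noteq> 0" "qP (q / b) \<noteq> 0" "qP (a * q / b) \<noteq> 0"
  shows "qpoch b q k / qpoch (a * q / b) q k = (- b) powi k * \<eta> a b k / (qP (q / b) * qP (a * q / b))"
proof -
  have s: "a * q / b * q powi k = a * q powi (1 + k) / b"
    using q_nz by (simp add: power_int_add)
  have "qpoch b q k / qpoch (a * q / b) q k = qpoch b q k * (1 / qpoch (a * q / b) q k)"
    by simp
  then show ?thesis
    unfolding inverse_qpoch[OF assms(3)] qpoch_reflect[OF assms(1,2)] s \<eta>_def by simp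
qed

lemma qpoch_very_well_poised:
  assumes "qP r \<noteq> 0" "\<And>j. j \<ge> 1 \<Longrightarrow> 1 - q * r / q ^ j \<noteq> 0"
  shows "qpoch (q * r) q k / qpoch r q k = (1 - r * q powi k) / (1 - r)"
proof -
  have r1: "1 - r \<noteq> 0" using qp_nz[OF assms(1), of 1] by (simp add: qp_Suc)
  show ?thesis
  proof (cases k rule: int_nat_cases)
    case (1 n)
    have "(1 - r) * qp (q * r) n = qp r n * (1 - r * q ^ n)"
      by (metis mult.commute qp_Suc qp_Suc_left)
    then have "qp (q * r) n = qp r n * (1 - r * q ^ n) / (1 - r)"
      using r1 by (simp add: field_simps)
    then show ?thesis
      using qp_nz[OF assms(1), of n] by (simp add: 1 qpoch_of_nat)
  next
    case (2 n)
    have rrn: "rr (q * r) n \<noteq> 0"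
    proof -
      have "\<forall>j\<in>{1..n}. 1 - q * r / q ^ j \<noteq> 0"
        by (intro ballI assms(2)) simp
      then show ?thesis
        unfolding rr_def by (simp only: prod_zero_iff finite_atLeastAtMost) blast
    qed
    have "rr r n = (1 - r / q ^ n) / (1 - r) * rr (q * r) n"
    proof (cases n)
      case (Suc i)
      then show ?thesis
        using r1 rr_q[of r i] rr_Suc[of r i] by simp
    qed (use r1 in simp)
    then show ?thesis
      using rrn by (simp add: 2 qpoch_minus_of_nat power_int_minus divide_inverse)
  qed
qed

lemma qpoch_inf_list_nz: "qpoch_inf_list xs q \<noteq> 0 \<Longrightarrow> x \<in> set xs \<Longrightarrow> qP x \<noteq> 0"
  by (induction xs) (auto simp: qpoch_inf_list_def)

lemma qP_nz_lower: "(\<And>i::nat. 1 - x * q ^ i \<noteq> 0) \<Longrightarrow> qP x \<noteq> 0"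
  by (auto simp: qP_zero_iff)

lemma qP_nz_upper:
  assumes "x \<noteq> 0" "\<And>j::nat. j \<ge> 1 \<Longrightarrow> 1 - x / q ^ j \<noteq> 0"
  shows "qP (q / x) \<noteq> 0"
proof
  assume "qP (q / x) = 0"
  then obtain i where "q / x * q ^ i = 1" by (auto simp: qP_zero_iff)
  then have "x = q ^ Suc i" using assms(1) by (simp add: field_simps)
  then show False using assms(2)[of "Suc i"] q_nz by simp
qed

text \<open>The pairs belonging to \<open>r\<close> and \<open>- r\<close> multiply to
  \<open>(1 - a q^(2k)) / (1 - a)\<close>, and each other pair is given by
  \<open>qpoch_ratio\<close>. So the two series agree term by term up to the constant
  \<open>N\<close>, which the conditions on the denominators keep nonzero.\<close>

lemma psi_eq_T:
  assumes nz: "a \<noteq> 0" "b \<noteq> 0" "c \<noteq> 0" "d \<noteq> 0" "e \<noteq> 0" "f \<noteq> 0" "g \<noteq> 0" and r: "r\<^sup>2 = a"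
    and denoms: "psi_denoms_nonzero [q*r, -q*r, b, c, d, e, f, g]
        [r, -r, a*q/b, a*q/c, a*q/d, a*q/e, a*q/f, a*q/g] q"
    and z: "z = a^3 * q^2 / (b*c*d*e*f*g)"
  defines "N \<equiv> (1 - a) * (qP (q/b) * qP (a*q/b) * qP (q/c) * qP (a*q/c) * qP (q/d) * qP (a*q/d)
        * qP (q/e) * qP (a*q/e) * qP (q/f) * qP (a*q/f) * qP (q/g) * qP (a*q/g))"
  shows "N \<noteq> 0"
    and "bilateral_psi [q*r, -q*r, b, c, d, e, f, g]
        [r, -r, a*q/b, a*q/c, a*q/d, a*q/e, a*q/f, a*q/g] q z = T a b c d e f g / N"
proof -
  have lo: "qP x \<noteq> 0" if "x \<in> set [r, -r, a*q/b, a*q/c, a*q/d, a*q/e, a*q/f, a*q/g]" for x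
    using denoms that unfolding psi_denoms_nonzero_def by (intro qP_nz_lower) blast
  have up: "1 - x / q ^ j \<noteq> 0" if "x \<in> set [q*r, -q*r, b, c, d, e, f, g]" "j \<ge> 1" for x j
    using denoms that unfolding psi_denoms_nonzero_def by blast
  have upn: "qP (q / x) \<noteq> 0" if "x \<noteq> 0" "x \<in> set [q*r, -q*r, b, c, d, e, f, g]" for x
    using that by (intro qP_nz_upper up)
  have lows: "qP (a*q/b) \<noteq> 0" "qP (a*q/c) \<noteq> 0" "qP (a*q/d) \<noteq> 0" "qP (a*q/e) \<noteq> 0" "qP (a*q/f) \<noteq> 0" "qP (a*q/g) \<noteq> 0"
    by (rule lo, simp)+
  have ups: "qP (q/b) \<noteq> 0" "qP (q/c) \<noteq> 0" "qP (q/d) \<noteq> 0" "qP (q/e) \<noteq> 0" "qP (q/f) \<noteq> 0" "qP (q/g) \<noteq> 0"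
    by (rule upn; simp add: nz)+
  have r1: "qP r \<noteq> 0" "qP (- r) \<noteq> 0" by (rule lo, simp)+
  have "1 - r \<noteq> 0" "1 - (- r) \<noteq> 0"
    using qp_nz[OF r1(1), of 1] qp_nz[OF r1(2), of 1] by (auto simp: qp_Suc)
  moreover have a1: "1 - a = (1 - r) * (1 - (- r))"
    unfolding r[symmetric] by (simp add: power2_eq_square algebra_simps)
  ultimately have "1 - a \<noteq> 0" by simp
  then show N: "N \<noteq> 0"
    unfolding N_def using lows ups by simp
  have "qpoch_list [q*r, -q*r, b, c, d, e, f, g] q k
      / qpoch_list [r, -r, a*q/b, a*q/c, a*q/d, a*q/e, a*q/f, a*q/g] q k * z powi k
      = 1 / N * T_term a b c d e f g k" for k
  proof -
    have v1: "qpoch (q * r) q k / qpoch r q k = (1 - r * q powi k) / (1 - r)"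
      by (rule qpoch_very_well_poised[OF r1(1)]) (rule up, simp_all)
    have v2: "qpoch (q * (- r)) q k / qpoch (- r) q k = (1 - (- r) * q powi k) / (1 - (- r))"
      by (rule qpoch_very_well_poised[OF r1(2)]) (rule up, simp_all)
    have "(1 - r * q powi k) * (1 - (- r) * q powi k) = 1 - r\<^sup>2 * (q powi k)\<^sup>2"
      by (simp add: power2_eq_square algebra_simps)
    also have "(q powi k)\<^sup>2 = q powi (2 * k)"
      by (simp add: mult.commute[of 2] power_int_mult)
    finally have v: "(1 - r * q powi k) / (1 - r) * ((1 - (- r) * q powi k) / (1 - (- r))) = (1 - a * q powi (2 * k)) / (1 - a)"
      unfolding a1 by (simp add: r)
    have pw: "(- b) powi k * (- c) powi k * (- d) powi k * (- e) powi k * (- f) powi k * (- g) powi k * z powi k = (a ^ 3 * q\<^sup>2) powi k"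
    proof -
      have "(- b) * (- c) * (- d) * (- e) * (- f) * (- g) * z = a ^ 3 * q\<^sup>2"
        using nz by (simp add: z)
      then show ?thesis by (simp only: power_int_mult_distrib[symmetric])
    qed
    have "qpoch_list [q*r, -q*r, b, c, d, e, f, g] q k
      / qpoch_list [r, -r, a*q/b, a*q/c, a*q/d, a*q/e, a*q/f, a*q/g] q k * z powi k
      = (qpoch (q * r) q k / qpoch r q k) * (qpoch (q * (- r)) q k / qpoch (- r) q k)
        * ((qpoch b q k / qpoch (a*q/b) q k) * (qpoch c q k / qpoch (a*q/c) q k) * (qpoch d q k / qpoch (a*q/d) q k)
        * (qpoch e q k / qpoch (a*q/e) q k) * (qpoch f q k / qpoch (a*q/f) q k) * (qpoch g q k / qpoch (a*q/g) q k)) * z powi k"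
      by (simp add: qpoch_list_def mult_ac)
    also have "\<dots> = (1 - a * q powi (2 * k)) / (1 - a)
        * (((- b) powi k * \<eta> a b k / (qP (q/b) * qP (a*q/b))) * ((- c) powi k * \<eta> a c k / (qP (q/c) * qP (a*q/c)))
         * ((- d) powi k * \<eta> a d k / (qP (q/d) * qP (a*q/d))) * ((- e) powi k * \<eta> a e k / (qP (q/e) * qP (a*q/e)))
         * ((- f) powi k * \<eta> a f k / (qP (q/f) * qP (a*q/f))) * ((- g) powi k * \<eta> a g k / (qP (q/g) * qP (a*q/g)))) * z powi k"
      unfolding v1 v2 v qpoch_ratio[OF nz(2) ups(1) lows(1)] qpoch_ratio[OF nz(3) ups(2) lows(2)]
        qpoch_ratio[OF nz(4) ups(3) lows(3)] qpoch_ratio[OF nz(5) ups(4) lows(4)]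
        qpoch_ratio[OF nz(6) ups(5) lows(5)] qpoch_ratio[OF nz(7) ups(6) lows(6)] ..
    also have "\<dots> = 1 / N * ((1 - a * q powi (2 * k))
        * ((- b) powi k * (- c) powi k * (- d) powi k * (- e) powi k * (- f) powi k * (- g) powi k * z powi k)
        * (\<eta> a b k * \<eta> a c k * \<eta> a d k * \<eta> a e k * \<eta> a f k * \<eta> a g k))"
      by (simp only: N_def times_divide_eq_left times_divide_eq_right divide_divide_eq_left mult_1_left mult_ac)
    finally show ?thesis
      unfolding pw T_term_def .
  qed
  then have "bilateral_psi [q*r, -q*r, b, c, d, e, f, g]
        [r, -r, a*q/b, a*q/c, a*q/d, a*q/e, a*q/f, a*q/g] q z = (\<Sum>\<^sub>\<infinity>k\<in>UNIV. 1 / N * T_term a b c d e f g k)"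
    unfolding bilateral_psi_def by (rule infsum_cong)
  then show "bilateral_psi [q*r, -q*r, b, c, d, e, f, g]
        [r, -r, a*q/b, a*q/c, a*q/d, a*q/e, a*q/f, a*q/g] q z = T a b c d e f g / N"
    by (simp only: infsum_cmult_right' T_def[symmetric]) simp
qed

lemma w8_summable:
  assumes "qP a \<noteq> 0" "qP (a * q / b) \<noteq> 0" "qP (a * q / c) \<noteq> 0" "qP (a * q / d) \<noteq> 0" "qP (a * q / e) \<noteq> 0" "qP (a * q / f) \<noteq> 0"
    and z: "norm (a\<^sup>2 * q\<^sup>2 / (b * c * d * e * f)) < 1"
  shows "summable (\<lambda>k. norm (w8_term a b c d e f k))"
proof -
  \<comment> \<open>The trivial power \<open>q ^ 0\<close> brings the base into the shifted form for
    which \<open>bdd_vw\<close> and \<open>bdd_fr\<close> are stated.\<close>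
  define h where "h = (\<lambda>k. vw (a * q ^ 0) k * (fr (a * q ^ 0) b k * fr (a * q ^ 0) c k * fr (a * q ^ 0) d k)
      * (fr (a * q ^ 0) e k * fr (a * q ^ 0) f k))"
  have "bdd h"
    unfolding h_def using assms by (intro bdd_mult bdd_vw bdd_fr)
  from bddE[OF this] obtain C where C: "\<And>k. norm (h k) \<le> C"
    by blast
  show ?thesis
  proof (rule summable_comparison_test'[where N = 0])
    show "summable (\<lambda>k. C * norm (a\<^sup>2 * q\<^sup>2 / (b * c * d * e * f)) ^ k)"
      using z by (intro summable_mult summable_geometric) auto
    fix k
    have "w8_term a b c d e f k = h k * (a\<^sup>2 * q\<^sup>2 / (b * c * d * e * f)) ^ k"
      by (simp add: w8_term_def h_def)
    then show "norm (norm (w8_term a b c d e f k)) \<le> C * norm (a\<^sup>2 * q\<^sup>2 / (b * c * d * e * f)) ^ k"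
      using C[of k] by (simp add: norm_mult norm_power mult_right_mono)
  qed
qed

text \<open>\<open>b / r\<close> is a square root of the base \<open>b\<^sup>2 / a\<close>, so the
  parameters with \<open>b / r\<close> and \<open>- b / r\<close> again multiply to the
  very-well-poised factor in \<open>vw\<close>.\<close>

lemma phi_eq_V:
  assumes nz: "a \<noteq> 0" "b \<noteq> 0" "c \<noteq> 0" "d \<noteq> 0" "e \<noteq> 0" "f \<noteq> 0" "g \<noteq> 0" and r: "r\<^sup>2 = a"
    and denoms: "phi_denoms_nonzero [b/r, -b/r, b*q/c, b*q/d, b*q/e, b*q/f, b*q/g] q"
    and A: "qP (b\<^sup>2 * q / a) \<noteq> 0"
    and z: "norm (a^3 * q^2 / (b*c*d*e*f*g)) < 1"
  shows "V (b\<^sup>2 / a) (b * c / a) (b * d / a) (b * e / a) (b * f / a) (b * g / a)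
    = qP (b*q/c) * qP (b*q/d) * qP (b*q/e) * (qP (b*q/f) * qP (b*q/g)) *
      basic_phi [b^2/a, q*b/r, -q*b/r, b*c/a, b*d/a, b*e/a, b*f/a, b*g/a]
        [b/r, -b/r, b*q/c, b*q/d, b*q/e, b*q/f, b*q/g] q (a^3 * q^2 / (b*c*d*e*f*g))"
proof -
  define B where "B = b\<^sup>2 / a"
  have r0: "r \<noteq> 0" using r nz by auto
  have lo: "qP x \<noteq> 0" if "x \<in> set [b/r, -b/r, b*q/c, b*q/d, b*q/e, b*q/f, b*q/g]" for x
    using denoms that unfolding phi_denoms_nonzero_def by (intro qP_nz_lower) blast
  have lows: "qP (b*q/c) \<noteq> 0" "qP (b*q/d) \<noteq> 0" "qP (b*q/e) \<noteq> 0" "qP (b*q/f) \<noteq> 0" "qP (b*q/g) \<noteq> 0"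
    by (rule lo, simp)+
  have r1: "qP (b/r) \<noteq> 0" "qP (- (b/r)) \<noteq> 0" using lo[of "b/r"] lo[of "-b/r"] by simp_all
  have s1: "1 - b/r \<noteq> 0" "1 - (- (b/r)) \<noteq> 0"
    using qp_nz[OF r1(1), of 1] qp_nz[OF r1(2), of 1] by (auto simp: qp_Suc)
  have Bs: "1 - B * x\<^sup>2 = (1 - b/r * x) * (1 - (- (b/r)) * x)" for x
    unfolding B_def r[symmetric] by (simp add: power2_eq_square algebra_simps)
  have B1: "1 - B = (1 - b/r) * (1 - (- (b/r)))"
    using Bs[of 1] by simp
  then have "1 - B \<noteq> 0" using s1 by simp
  have "qP B = (1 - B) * qP (b\<^sup>2 * q / a)"
    by (subst qP_rec) (simp add: B_def)
  then have qPB: "qP B \<noteq> 0" using A \<open>1 - B \<noteq> 0\<close> by simp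
  have low: "B * q / (b * x / a) = b * q / x" for x
    using nz by (simp add: B_def power2_eq_square)
  have zz: "B\<^sup>2 * q\<^sup>2 / (b * c / a * (b * d / a) * (b * e / a) * (b * f / a) * (b * g / a)) = a^3 * q^2 / (b*c*d*e*f*g)"
    using nz by (simp add: B_def field_simps eval_nat_numeral)
  have trm: "qpoch_list [b^2/a, q*b/r, -q*b/r, b*c/a, b*d/a, b*e/a, b*f/a, b*g/a] q (int k)
      / qpoch_list (q # [b/r, -b/r, b*q/c, b*q/d, b*q/e, b*q/f, b*q/g]) q (int k) * (a^3 * q^2 / (b*c*d*e*f*g)) ^ k
    = w8_term B (b * c / a) (b * d / a) (b * e / a) (b * f / a) (b * g / a) k" for k
  proof -
    have v: "qp (q * x) k / qp x k = (1 - x * q ^ k) / (1 - x)" if "qP x \<noteq> 0" "1 - x \<noteq> 0" for x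
    proof -
      have "(1 - x) * qp (q * x) k = qp x k * (1 - x * q ^ k)"
        by (metis mult.commute qp_Suc qp_Suc_left)
      then have "qp (q * x) k = qp x k * (1 - x * q ^ k) / (1 - x)"
        using that by (simp add: field_simps)
      then show ?thesis using qp_nz[OF that(1), of k] by simp
    qed
    have vw: "vw B k = (qp (q * (b/r)) k / qp (b/r) k) * (qp (q * (- (b/r))) k / qp (- (b/r)) k) * (qp B k / qp q k)"
      unfolding v[OF r1(1) s1(1)] v[OF r1(2) s1(2)] vw_def B1 power_mult[of q 2 k]
      using Bs[of "q ^ k"] by (simp flip: power_mult add: mult.commute)
    show ?thesis
      unfolding w8_term_def zz fr_def low vw
      by (simp add: qpoch_list_def qpoch_of_nat B_def mult_ac)
  qed
  have "basic_phi [b^2/a, q*b/r, -q*b/r, b*c/a, b*d/a, b*e/a, b*f/a, b*g/a]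
        [b/r, -b/r, b*q/c, b*q/d, b*q/e, b*q/f, b*q/g] q (a^3 * q^2 / (b*c*d*e*f*g))
      = suminf (w8_term B (b * c / a) (b * d / a) (b * e / a) (b * f / a) (b * g / a))"
    unfolding basic_phi_def trm ..
  also have "\<dots> = infsum (w8_term B (b * c / a) (b * d / a) (b * e / a) (b * f / a) (b * g / a)) UNIV"
    by (rule infsum_eq_suminf[symmetric], rule w8_summable, unfold low zz) (rule qPB lows z)+
  finally have "basic_phi [b^2/a, q*b/r, -q*b/r, b*c/a, b*d/a, b*e/a, b*f/a, b*g/a]
        [b/r, -b/r, b*q/c, b*q/d, b*q/e, b*q/f, b*q/g] q (a^3 * q^2 / (b*c*d*e*f*g))
      = infsum (w8_term B (b * c / a) (b * d / a) (b * e / a) (b * f / a) (b * g / a)) UNIV" .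
  moreover have "V B (b * c / a) (b * d / a) (b * e / a) (b * f / a) (b * g / a)
    = qP (b*q/c) * qP (b*q/d) * qP (b*q/e) * (qP (b*q/f) * qP (b*q/g)) *
      infsum (w8_term B (b * c / a) (b * d / a) (b * e / a) (b * f / a) (b * g / a)) UNIV"
    using V_eq_w8[of B "b * c / a" "b * d / a" "b * e / a" "b * f / a" "b * g / a", unfolded low] nz lows \<open>1 - B \<noteq> 0\<close>
    by simp
  ultimately show ?thesis
    by (simp only: B_def)
qed

end

section \<open>The transformation formula in the usual notation\<close>

theorem theorem3:
  fixes q a b c d e f g \<mu> ra r\<mu> :: complex
  assumes q: "norm q < 1"
    and conv: "max (norm (a^3 * q^2 / (b*c*d*e*f*g))) (norm (a*q / (f*g))) < 1"
    and \<mu>: "\<mu> = b*c*d*e / (a*q)"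
    and sqrts: "ra^2 = a" "r\<mu>^2 = \<mu>"
    and nonzero: "q \<noteq> 0" "a \<noteq> 0" "b \<noteq> 0" "c \<noteq> 0" "d \<noteq> 0" "e \<noteq> 0" "f \<noteq> 0" "g \<noteq> 0"
    and psi1: "psi_denoms_nonzero
        [q*ra, -q*ra, b, c, d, e, f, g]
        [ra, -ra, a*q/b, a*q/c, a*q/d, a*q/e, a*q/f, a*q/g] q"
    and psi2: "psi_denoms_nonzero
        [q*r\<mu>, -q*r\<mu>, b, c, d, e, \<mu>*f/a, \<mu>*g/a]
        [r\<mu>, -r\<mu>, \<mu>*q/b, \<mu>*q/c, \<mu>*q/d, \<mu>*q/e, a*q/f, a*q/g] q"
    and phi: "phi_denoms_nonzero
        [b/ra, -b/ra, b*q/c, b*q/d, b*q/e, b*q/f, b*q/g] q"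
    and prefactor1: "qpoch_inf_list
        [q/f, q/g, a*q/c, a*q/d, a*q/e, b*c/a, b*d/a, b*e/a, b/\<mu>, \<mu>*q, q/\<mu>,
         a^2*q/(\<mu>*f*g)] q \<noteq> 0"
    and prefactor2: "qpoch_inf_list
        [q/f, q/g, a*q/b, a*q/c, a*q/d, a*q/e, a*q/f, a*q/g, b*c/a, b*d/a, b*e/a] q \<noteq> 0"
    and prefactor3: "qpoch_inf_list
        [q/b, b^2*q/a, c*d*e/(a*q), a*q^2/(c*d*e)] q \<noteq> 0"
  shows "bilateral_psi
        [q*ra, -q*ra, b, c, d, e, f, g]
        [ra, -ra, a*q/b, a*q/c, a*q/d, a*q/e, a*q/f, a*q/g]
        q (a^3 * q^2 / (b*c*d*e*f*g))
    = qpoch_inf_list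
        [a*q, q/a, a*q/(c*d), a*q/(c*e), a*q/(d*e), a*q/(f*g), b/a, \<mu>*q/c, \<mu>*q/d, \<mu>*q/e,
         a*q/(\<mu>*f), a*q/(\<mu>*g)] q
      / qpoch_inf_list
        [q/f, q/g, a*q/c, a*q/d, a*q/e, b*c/a, b*d/a, b*e/a, b/\<mu>, \<mu>*q, q/\<mu>,
         a^2*q/(\<mu>*f*g)] q
      * bilateral_psi
        [q*r\<mu>, -q*r\<mu>, b, c, d, e, \<mu>*f/a, \<mu>*g/a]
        [r\<mu>, -r\<mu>, \<mu>*q/b, \<mu>*q/c, \<mu>*q/d, \<mu>*q/e, a*q/f, a*q/g]
        q (a*q / (f*g))
    + qpoch_inf_list
        [q, a*q, q/a, c, d, e, b*q/c, b*q/d, b*q/e, b*q/f, b*q/g] q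
      / qpoch_inf_list
        [q/f, q/g, a*q/b, a*q/c, a*q/d, a*q/e, a*q/f, a*q/g, b*c/a, b*d/a, b*e/a] q
      * (qpoch_inf_list
          [a*q/(b*f), a*q/(b*g), b*c*d*e/(a^2*q), a^2*q^2/(b*c*d*e)] q
        / qpoch_inf_list
          [q/b, b^2*q/a, c*d*e/(a*q), a*q^2/(c*d*e)] q)
      * basic_phi
        [b^2/a, q*b/ra, -q*b/ra, b*c/a, b*d/a, b*e/a, b*f/a, b*g/a]
        [b/ra, -b/ra, b*q/c, b*q/d, b*q/e, b*q/f, b*q/g]
        q (a^3 * q^2 / (b*c*d*e*f*g))"
proof -
  interpret q_base q
    by unfold_locales (use q nonzero in auto)
  define z where "z = a^3 * q^2 / (b*c*d*e*f*g)"
  have z1: "norm (a^3 * q^2 / (b*c*d*e*f*g)) < 1" and z2: "norm (a*q / (f*g)) < 1"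
    using conv by simp_all
  have \<mu>0: "\<mu> \<noteq> 0"
    using nonzero by (simp add: \<mu>)
  note p1 = qpoch_inf_list_nz[OF prefactor1] and p3 = qpoch_inf_list_nz[OF prefactor3]
  define \<phi> where "\<phi> = basic_phi
        [b^2/a, q*b/ra, -q*b/ra, b*c/a, b*d/a, b*e/a, b*f/a, b*g/a]
        [b/ra, -b/ra, b*q/c, b*q/d, b*q/e, b*q/f, b*q/g] q z"
  define \<Psi>1 where "\<Psi>1 = bilateral_psi
        [q*ra, -q*ra, b, c, d, e, f, g]
        [ra, -ra, a*q/b, a*q/c, a*q/d, a*q/e, a*q/f, a*q/g] q z"
  define \<Psi>2 where "\<Psi>2 = bilateral_psi
        [q*r\<mu>, -q*r\<mu>, b, c, d, e, \<mu>*f/a, \<mu>*g/a]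
        [r\<mu>, -r\<mu>, \<mu>*q/b, \<mu>*q/c, \<mu>*q/d, \<mu>*q/e, a*q/f, a*q/g] q (a*q / (f*g))"
  define N1 where "N1 = (1 - a) * (qP (q/b) * qP (a*q/b) * qP (q/c) * qP (a*q/c) * qP (q/d) * qP (a*q/d)
        * qP (q/e) * qP (a*q/e) * qP (q/f) * qP (a*q/f) * qP (q/g) * qP (a*q/g))"
  define N2 where "N2 = (1 - \<mu>) * (qP (q/b) * qP (\<mu>*q/b) * qP (q/c) * qP (\<mu>*q/c) * qP (q/d) * qP (\<mu>*q/d)
        * qP (q/e) * qP (\<mu>*q/e) * qP (a*q/(\<mu>*f)) * qP (a*q/f) * qP (a*q/(\<mu>*g)) * qP (a*q/g))"
  note T1 = psi_eq_T[OF nonzero(2-8) sqrts(1) psi1 z_def, folded N1_def]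
  have T1': "T a b c d e f g = N1 * \<Psi>1"
    using T1 by (simp add: \<Psi>1_def)
  \<comment> \<open>Relative to the base \<open>\<mu>\<close>, the partners of
    \<open>\<mu> * f / a\<close> and \<open>\<mu> * g / a\<close> are the same as those of
    \<open>f\<close> and \<open>g\<close> relative to \<open>a\<close>.\<close>
  have s: "\<mu> * q / (\<mu> * x / a) = a * q / x" "q / (\<mu> * x / a) = a * q / (\<mu> * x)" for x
    using \<mu>0 nonzero by simp_all
  have z2': "a * q / (f * g) = \<mu>^3 * q^2 / (b*c*d*e*(\<mu>*f/a)*(\<mu>*g/a))"
    using nonzero by (simp add: \<mu> field_simps eval_nat_numeral)
  have \<mu>f0: "\<mu> * f / a \<noteq> 0" "\<mu> * g / a \<noteq> 0"
    using \<mu>0 nonzero by simp_all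
  note T2 = psi_eq_T[OF \<mu>0 nonzero(3-6) \<mu>f0 sqrts(2) _ z2', unfolded s, OF psi2, folded N2_def]
  have T2': "T \<mu> b c d e (\<mu> * f / a) (\<mu> * g / a) = N2 * \<Psi>2"
    using T2 by (simp add: \<Psi>2_def)
  have b2: "qP (b\<^sup>2 * q / a) \<noteq> 0"
    by (rule p3) simp
  note V' = phi_eq_V[OF nonzero(2-8) sqrts(1) phi b2 z1, folded z_def, folded \<phi>_def]
  have arg: "\<mu> * q / b = c * d * e / a" "b / \<mu> = a * q / (c * d * e)" "q / (c * d * e / a) = a * q / (c * d * e)"
    "q / (a * q / b) = b / a" "q / (b * c * d * e / (a\<^sup>2 * q)) = a\<^sup>2 * q\<^sup>2 / (b * c * d * e)"
    "q / (c * d * e / (a * q)) = a * q\<^sup>2 / (c * d * e)"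
    using nonzero by (simp_all add: \<mu> power2_eq_square)
  have \<theta>a: "\<theta> a = (1 - a) * qP (a * q) * qP (q / a)" and \<theta>\<mu>: "\<theta> \<mu> = (1 - \<mu>) * qP (\<mu> * q) * qP (q / \<mu>)"
    by (rule \<theta>_rec)+
  have \<theta>cde: "\<theta> (c * d * e / a) = qP (c * d * e / a) * qP (a * q / (c * d * e))"
    "\<theta> (c * d * e / a) = - (a * q / (c * d * e)) * (qP (c * d * e / (a * q)) * qP (a * q\<^sup>2 / (c * d * e)))"
  proof -
    show "\<theta> (c * d * e / a) = qP (c * d * e / a) * qP (a * q / (c * d * e))"
      by (simp only: \<theta>_def arg)
    have "\<theta> (q * (c * d * e / (a * q))) = - \<theta> (c * d * e / (a * q)) / (c * d * e / (a * q))"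
      by (rule \<theta>_q) (use nonzero in simp)
    moreover have "q * (c * d * e / (a * q)) = c * d * e / a"
      using nonzero by simp
    moreover have "\<theta> (c * d * e / (a * q)) = qP (c * d * e / (a * q)) * qP (a * q\<^sup>2 / (c * d * e))"
      by (simp only: \<theta>_def arg)
    ultimately show "\<theta> (c * d * e / a) = - (a * q / (c * d * e)) * (qP (c * d * e / (a * q)) * qP (a * q\<^sup>2 / (c * d * e)))"
      by simp
  qed
  have \<theta>ab: "\<theta> (a * q / b) = qP (a * q / b) * qP (b / a)"
    and \<theta>b4: "\<theta> (b * c * d * e / (a\<^sup>2 * q)) = qP (b * c * d * e / (a\<^sup>2 * q)) * qP (a\<^sup>2 * q\<^sup>2 / (b * c * d * e))"
    by (simp_all only: \<theta>_def arg)
  \<comment> \<open>The coefficient of \<open>\<Psi>1\<close> in the vanishing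
    \<open>defect\<close>. The conditions on the prefactors and on the denominators of the series
    make it nonzero, so the formula may be compared after multiplication by
    \<open>X\<close>.\<close>
  define X where "X = coefA a b c d e f g \<mu> * (N1 * \<theta> \<mu> * \<theta> (c * d * e / a))"
  have X: "X \<noteq> 0"
  proof -
    have "coefA a b c d e f g \<mu> \<noteq> 0"
      unfolding coefA_def by (intro no_zero_divisors p1 b2) simp_all
    \<comment> \<open>\<open>1 - \<mu>\<close> is a factor of the constant that clears the second
      bilateral series, and that constant is nonzero.\<close>
    moreover have "1 - \<mu> \<noteq> 0"
      using psi2 \<open>r\<mu>^2 = \<mu>\<close> psi_eq_T(1)[OF \<mu>0 nonzero(3-6) \<mu>f0 sqrts(2) _ z2', unfolded s, OF psi2] by auto
    then have "\<theta> \<mu> \<noteq> 0"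
      unfolding \<theta>\<mu> by (intro no_zero_divisors p1) simp_all
    moreover have "\<theta> (c * d * e / a) \<noteq> 0"
      unfolding \<theta>cde(2) using nonzero p3[of "c*d*e/(a*q)"] p3[of "a*q^2/(c*d*e)"] by simp
    ultimately show ?thesis
      unfolding X_def using T1(1) by simp
  qed
  have main: "X * \<Psi>1 = coefB a b c d e f g * (\<theta> a * \<theta> (a * q / b)) * N2 * \<Psi>2
     - coefC a b c d e f g \<mu> * (\<theta> a * \<theta> \<mu> * (\<theta> c * \<theta> d * \<theta> e))"
    using defect_eq_0[OF nonzero(2-8) \<mu> z1 z2] unfolding defect_def T1' T2' X_def
    by (simp add: algebra_simps)
  define n1 where "n1 = qpoch_inf_list
        [a*q, q/a, a*q/(c*d), a*q/(c*e), a*q/(d*e), a*q/(f*g), b/a, \<mu>*q/c, \<mu>*q/d, \<mu>*q/e,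
         a*q/(\<mu>*f), a*q/(\<mu>*g)] q"
  define d1 where "d1 = qpoch_inf_list
        [q/f, q/g, a*q/c, a*q/d, a*q/e, b*c/a, b*d/a, b*e/a, b/\<mu>, \<mu>*q, q/\<mu>,
         a^2*q/(\<mu>*f*g)] q"
  define n2 where "n2 = qpoch_inf_list [q, a*q, q/a, c, d, e, b*q/c, b*q/d, b*q/e, b*q/f, b*q/g] q"
  define d2 where "d2 = qpoch_inf_list
        [q/f, q/g, a*q/b, a*q/c, a*q/d, a*q/e, a*q/f, a*q/g, b*c/a, b*d/a, b*e/a] q"
  define n3 where "n3 = qpoch_inf_list [a*q/(b*f), a*q/(b*g), b*c*d*e/(a^2*q), a^2*q^2/(b*c*d*e)] q"
  define d3 where "d3 = qpoch_inf_list [q/b, b^2*q/a, c*d*e/(a*q), a*q^2/(c*d*e)] q"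
  have d: "d1 \<noteq> 0" "d2 \<noteq> 0" "d3 \<noteq> 0"
    using prefactor1 prefactor2 prefactor3 by (simp_all only: d1_def d2_def d3_def not_False_eq_True)
  \<comment> \<open>Both sides consist of the same infinite products, matched by commutativity
    alone. The value \<open>\<theta> (c * d * e / a)\<close> is expanded in its first form here and
    in its second form in \<open>e2\<close>, where the sign and the constant
    \<open>a q/(cde)\<close> of \<open>coefC\<close> have to appear.\<close>
  have e1: "X * n1 = coefB a b c d e f g * (\<theta> a * \<theta> (a * q / b)) * N2 * d1"
    unfolding X_def n1_def d1_def coefA_def coefB_def N1_def N2_def \<theta>cde(1) \<theta>a \<theta>\<mu> \<theta>ab arg(1,2)
      qpoch_inf_list_def list.map prod_list.Cons prod_list.Nil mult_1_right
    by (simp only: mult_ac)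
  have e2: "X * (n2 * n3 * \<phi>) = - (coefC a b c d e f g \<mu> * (\<theta> a * \<theta> \<mu> * (\<theta> c * \<theta> d * \<theta> e))) * (d2 * d3)"
    unfolding X_def n2_def n3_def d2_def d3_def coefA_def coefC_def N1_def V' \<theta>cde(2) \<theta>a \<theta>b4 \<theta>_def[of c] \<theta>_def[of d] \<theta>_def[of e]
      qpoch_inf_list_def list.map prod_list.Cons prod_list.Nil mult_1_right
    by (simp only: mult_minus_left mult_minus_right mult_ac)
  have "X * (n1 / d1 * \<Psi>2 + n2 / d2 * (n3 / d3) * \<phi>) = X * n1 / d1 * \<Psi>2 + X * (n2 * n3 * \<phi>) / (d2 * d3)"
    by (simp add: distrib_left)
  also have "\<dots> = coefB a b c d e f g * (\<theta> a * \<theta> (a * q / b)) * N2 * \<Psi>2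
     - coefC a b c d e f g \<mu> * (\<theta> a * \<theta> \<mu> * (\<theta> c * \<theta> d * \<theta> e))"
    unfolding e1 e2 using d by simp
  also have "\<dots> = X * \<Psi>1"
    by (rule main[symmetric])
  finally have "n1 / d1 * \<Psi>2 + n2 / d2 * (n3 / d3) * \<phi> = \<Psi>1"
    by (simp only: mult_left_cancel[OF X])
  from this[symmetric] show ?thesis
    unfolding \<Psi>1_def \<Psi>2_def \<phi>_def z_def n1_def d1_def n2_def d2_def n3_def d3_def .
qed

end
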